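(* There exist infinitely many $\omega$-tree-automatic atomless boolean algebras $\mathcal{B}_n$, $n\geq1$, which are pairwise isomorphic under CH and pairwise non-isomorphic under AT. (Namely $\mathcal{B}_n=(\mathcal{P}(\omega^n)/I_{\omega^n},\cap,\cup,\neg,\mathbf{0},\mathbf{1})$.)
   Context: $I_{\omega^n}=\{P\subseteq\omega^n\mid \mathrm{o.t.}(P)<\omega^n\}$ ($\mathrm{o.t.}$ = order type as a suborder of $(\omega^n,<)$) and $\mathcal{B}_n$ is the quotient boolean algebra of $\mathcal{P}(\omega^n)$ modulo this ideal. A boolean algebra is atomless if every nonzero element strictly contains a nonzero element. A Muller tree automaton $(Q,\Sigma,\Delta,q_0,\mathcal{F})$ with $\Delta\subseteq Q\times\Sigma\times Q\times Q$ and $\mathcal{F}\subseteq 2^Q$ reads infinite binary trees $t:\{l,r\}^*\to\Sigma$; a run is $\rho:\{l,r\}^*\to Q$ with $\rho(\varepsilon)=q_0$ and $(\rho(u),t(u),\rho(ul),\rho(ur))\in\Delta$ for all $u$, accepting if on every infinite branch the set of states occurring infinitely often lies in $\mathcal{F}$. A relational structure $(M,(R_i)_{i\le k})$ (operations replaced by graphs; relations on trees read as tree languages over product alphabets) is $\omega$-tree-automatic if there are Muller tree automata $\mathcal{A},\mathcal{A}_=,\mathcal{A}_1,\dots,\mathcal{A}_k$ and a surjection $h:L(\mathcal{A})\to M$ such that $\mathcal{A}_=$ accepts an equivalence $E$ on $L(\mathcal{A})$, each $\mathcal{A}_i$ accepts a relation $R_i'$ compatible with $E$, and $h$ induces an isomorphism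 $(L(\mathcal{A}),(R_i'))/E\cong M$. CH is the continuum hypothesis. AT is Just's axiom: for every ${\bf\Sigma}^1_1$-ideal $I$ of subsets of $\omega$ (subsets identified with points of $2^\omega$), every $H:\mathcal{P}(\omega)\to\mathcal{P}(\omega)$ preserving intersections modulo $I$ (i.e. $H(X)\triangle H(Y)\in I$ whenever $X\triangle Y$ is finite, and $H(X\cap Y)\triangle(H(X)\cap H(Y))\in I$), and every uncountable family $\mathcal{A}$ of pairwise almost disjoint infinite subsets of $\omega$, there exist $A\in\mathcal{A}$ and a finite decomposition $A=\bigcup_{i<k}A_i$ with continuous $F_i:\mathcal{P}(A_i)\to\mathcal{P}(\omega)$ such that $F_i(X)\triangle H(X)\in I$ for all $X\subseteq A_i$. Statements "under CH"/"under AT" mean provable in ZFC+CH, resp. ZFC+AT. *)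

theory Defs
  imports "HOL-Analysis.Analysis"
begin

unbundle cardinal_syntax

section \<open>The ordinal \<open>\<omega>\<^sup>n\<close> and its ideal of subsets of smaller order type\<close>

text \<open>
  The ordinal \<open>\<omega>\<^sup>n\<close> is represented by the lexicographic well-order on \<open>n\<close>-tuples of natural numbers,
  the head being the most significant entry; lemma \<open>omega_power_Suc\<close> is the recursion
  \<open>\<omega>\<^bsup>n+1\<^esup> = \<omega>\<^sup>n \<cdot> \<omega>\<close> for the ordinal product.
\<close>

definition omega_power :: "nat \<Rightarrow> nat list rel" where
  "omega_power n =
     {(xs, ys). length xs = n \<and> length ys = n \<and> (xs = ys \<or> (xs, ys) \<in> lexn less_than n)}"

lemma Field_omega_power: "Field (omega_power n) = {xs. length xs = n}"
  by (auto simp: omega_power_def Field_def)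

lemma omega_power_0: "omega_power 0 = {([], [])}"
  by (auto simp: omega_power_def)

lemma Cons_lexn_Suc:
  "(x # xs, y # ys) \<in> lexn less_than (Suc n) \<longleftrightarrow>
     length xs = n \<and> length ys = n \<and> (x < y \<or> x = y \<and> (xs, ys) \<in> lexn less_than n)"
  by (auto simp: image_iff Bex_def dest: lexn_length)

lemma omega_power_Suc:
  "omega_power (Suc n) =
     {(x # xs, y # ys) | x xs y ys. xs \<in> Field (omega_power n) \<and> ys \<in> Field (omega_power n) \<and>
        (x < y \<or> x = y \<and> (xs, ys) \<in> omega_power n)}"
  unfolding Field_omega_power unfolding omega_power_def
  by (auto simp: length_Suc_conv Cons_lexn_Suc simp del: lexn.simps)

lemma Well_order_omega_power: "Well_order (omega_power n)"
proof -
  have tr: "trans (lexn less_than n)"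
    by (rule lexn_transI) (rule trans_less_than)
  have wfl: "wf (lexn less_than n)"
    by (simp add: wf_lexn)
  have irr: "(xs, xs) \<notin> lexn less_than n" for xs
    using wfl by (auto dest: wf_irrefl)
  have tot: "length xs = n \<Longrightarrow> length ys = n \<Longrightarrow> xs = ys \<or> (xs, ys) \<in> lexn less_than n
      \<or> (ys, xs) \<in> lexn less_than n" for xs ys :: "nat list"
  proof (induction n arbitrary: xs ys)
    case 0
    then show ?case by simp
  next
    case (Suc n)
    then obtain x xs' y ys' where "xs = x # xs'" "ys = y # ys'" "length xs' = n" "length ys' = n"
      by (metis length_Suc_conv)
    then show ?case
      using Suc.IH[of xs' ys'] by (auto simp: Cons_lexn_Suc simp del: lexn.simps)
  qed
  have "wf (omega_power n - Id)"
    by (rule wf_subset[OF wfl]) (auto simp: omega_power_def)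
  moreover have "Refl (omega_power n)"
    by (auto simp: refl_on_def Field_omega_power) (auto simp: omega_power_def)
  moreover have "trans (omega_power n)"
    using tr by (auto simp: trans_def omega_power_def)
  moreover have "antisym (omega_power n)"
    using tr irr by (auto simp: antisym_def trans_def omega_power_def)
  moreover have "Total (omega_power n)"
    using tot unfolding total_on_def Field_omega_power by (auto simp: omega_power_def)
  ultimately show ?thesis
    by (auto simp: well_order_on_def linear_order_on_def partial_order_on_def preorder_on_def
        Field_def)
qed

definition omega_ideal :: "nat \<Rightarrow> nat list set set" where
  "omega_ideal n =
     {P. P \<subseteq> Field (omega_power n) \<and> Restr (omega_power n) P <o omega_power n}"


section \<open>Boolean algebras with explicit carrier\<close>

record 'a bool_alg =
  ba_carrier :: "'a set"
  ba_meet :: "'a \<Rightarrow> 'a \<Rightarrow> 'a"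
  ba_join :: "'a \<Rightarrow> 'a \<Rightarrow> 'a"
  ba_compl :: "'a \<Rightarrow> 'a"
  ba_zero :: 'a
  ba_one :: 'a

locale carrier_boolean_algebra =
  fixes B :: "'a bool_alg"
  assumes meet_closed: "\<lbrakk>x \<in> ba_carrier B; y \<in> ba_carrier B\<rbrakk> \<Longrightarrow> ba_meet B x y \<in> ba_carrier B"
    and join_closed: "\<lbrakk>x \<in> ba_carrier B; y \<in> ba_carrier B\<rbrakk> \<Longrightarrow> ba_join B x y \<in> ba_carrier B"
    and compl_closed: "x \<in> ba_carrier B \<Longrightarrow> ba_compl B x \<in> ba_carrier B"
    and zero_closed: "ba_zero B \<in> ba_carrier B"
    and one_closed: "ba_one B \<in> ba_carrier B"
    and meet_assoc: "\<lbrakk>x \<in> ba_carrier B; y \<in> ba_carrier B; z \<in> ba_carrier B\<rbrakk> \<Longrightarrow>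
      ba_meet B (ba_meet B x y) z = ba_meet B x (ba_meet B y z)"
    and join_assoc: "\<lbrakk>x \<in> ba_carrier B; y \<in> ba_carrier B; z \<in> ba_carrier B\<rbrakk> \<Longrightarrow>
      ba_join B (ba_join B x y) z = ba_join B x (ba_join B y z)"
    and meet_commute: "\<lbrakk>x \<in> ba_carrier B; y \<in> ba_carrier B\<rbrakk> \<Longrightarrow> ba_meet B x y = ba_meet B y x"
    and join_commute: "\<lbrakk>x \<in> ba_carrier B; y \<in> ba_carrier B\<rbrakk> \<Longrightarrow> ba_join B x y = ba_join B y x"
    and meet_join_distrib: "\<lbrakk>x \<in> ba_carrier B; y \<in> ba_carrier B; z \<in> ba_carrier B\<rbrakk> \<Longrightarrow>
      ba_meet B x (ba_join B y z) = ba_join B (ba_meet B x y) (ba_meet B x z)"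
    and join_meet_distrib: "\<lbrakk>x \<in> ba_carrier B; y \<in> ba_carrier B; z \<in> ba_carrier B\<rbrakk> \<Longrightarrow>
      ba_join B x (ba_meet B y z) = ba_meet B (ba_join B x y) (ba_join B x z)"
    and meet_one: "x \<in> ba_carrier B \<Longrightarrow> ba_meet B x (ba_one B) = x"
    and join_zero: "x \<in> ba_carrier B \<Longrightarrow> ba_join B x (ba_zero B) = x"
    and meet_compl: "x \<in> ba_carrier B \<Longrightarrow> ba_meet B x (ba_compl B x) = ba_zero B"
    and join_compl: "x \<in> ba_carrier B \<Longrightarrow> ba_join B x (ba_compl B x) = ba_one B"

definition ba_le :: "'a bool_alg \<Rightarrow> 'a \<Rightarrow> 'a \<Rightarrow> bool" where
  "ba_le B x y \<longleftrightarrow> ba_meet B x y = x"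

definition ba_atomless :: "'a bool_alg \<Rightarrow> bool" where
  "ba_atomless B \<longleftrightarrow>
     (\<forall>x\<in>ba_carrier B. x \<noteq> ba_zero B \<longrightarrow>
        (\<exists>y\<in>ba_carrier B. y \<noteq> ba_zero B \<and> ba_le B y x \<and> y \<noteq> x))"

definition ba_iso :: "('a \<Rightarrow> 'b) \<Rightarrow> 'a bool_alg \<Rightarrow> 'b bool_alg \<Rightarrow> bool" where
  "ba_iso f A B \<longleftrightarrow>
     bij_betw f (ba_carrier A) (ba_carrier B) \<and>
     (\<forall>x\<in>ba_carrier A. \<forall>y\<in>ba_carrier A. f (ba_meet A x y) = ba_meet B (f x) (f y)) \<and>
     (\<forall>x\<in>ba_carrier A. \<forall>y\<in>ba_carrier A. f (ba_join A x y) = ba_join B (f x) (f y)) \<and>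
     (\<forall>x\<in>ba_carrier A. f (ba_compl A x) = ba_compl B (f x)) \<and>
     f (ba_zero A) = ba_zero B \<and> f (ba_one A) = ba_one B"

definition ba_isomorphic :: "'a bool_alg \<Rightarrow> 'b bool_alg \<Rightarrow> bool" where
  "ba_isomorphic A B \<longleftrightarrow> (\<exists>f. ba_iso f A B)"

definition mod_rel :: "'a set \<Rightarrow> 'a set set \<Rightarrow> 'a set rel" where
  "mod_rel S I = {(X, Y). X \<subseteq> S \<and> Y \<subseteq> S \<and> sym_diff X Y \<in> I}"

definition powerset_quotient :: "'a set \<Rightarrow> 'a set set \<Rightarrow> 'a set set bool_alg" where
  "powerset_quotient S I =
     \<lparr> ba_carrier = Pow S // mod_rel S I,
       ba_meet = (\<lambda>A B. \<Union>X\<in>A. \<Union>Y\<in>B. mod_rel S I `` {X \<inter> Y}),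
       ba_join = (\<lambda>A B. \<Union>X\<in>A. \<Union>Y\<in>B. mod_rel S I `` {X \<union> Y}),
       ba_compl = (\<lambda>A. \<Union>X\<in>A. mod_rel S I `` {S - X}),
       ba_zero = mod_rel S I `` {{}},
       ba_one = mod_rel S I `` {S} \<rparr>"

definition omega_algebra :: "nat \<Rightarrow> nat list set set bool_alg" where
  "omega_algebra n = powerset_quotient (Field (omega_power n)) (omega_ideal n)"


section \<open>Muller tree automata\<close>

datatype dir = Lft | Rgt

type_synonym 's inf_tree = "dir list \<Rightarrow> 's"

record ('q, 's) tree_automaton =
  states :: "'q set"
  alphabet :: "'s set"
  transitions :: "('q \<times> 's \<times> 'q \<times> 'q) set"
  initial :: 'q
  accepting :: "'q set set"

definition muller_automaton :: "('q, 's) tree_automaton \<Rightarrow> bool" where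
  "muller_automaton A \<longleftrightarrow>
     finite (states A) \<and> finite (alphabet A) \<and> initial A \<in> states A \<and>
     transitions A \<subseteq> states A \<times> alphabet A \<times> states A \<times> states A \<and>
     accepting A \<subseteq> Pow (states A)"

definition is_run :: "('q, 's) tree_automaton \<Rightarrow> 's inf_tree \<Rightarrow> 'q inf_tree \<Rightarrow> bool" where
  "is_run A t \<rho> \<longleftrightarrow>
     (\<forall>u. \<rho> u \<in> states A) \<and> \<rho> [] = initial A \<and>
     (\<forall>u. (\<rho> u, t u, \<rho> (u @ [Lft]), \<rho> (u @ [Rgt])) \<in> transitions A)"

definition infinitely_often :: "'q inf_tree \<Rightarrow> (nat \<Rightarrow> dir) \<Rightarrow> 'q set" where
  "infinitely_often \<rho> \<beta> = {q. \<exists>\<^sub>\<infinity>n. \<rho> (map \<beta> [0..<n]) = q}"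

definition accepting_run :: "('q, 's) tree_automaton \<Rightarrow> 's inf_tree \<Rightarrow> 'q inf_tree \<Rightarrow> bool" where
  "accepting_run A t \<rho> \<longleftrightarrow> is_run A t \<rho> \<and> (\<forall>\<beta>. infinitely_often \<rho> \<beta> \<in> accepting A)"

definition language :: "('q, 's) tree_automaton \<Rightarrow> 's inf_tree set" where
  "language A = {t. (\<forall>u. t u \<in> alphabet A) \<and> (\<exists>\<rho>. accepting_run A t \<rho>)}"


section \<open>Tree-automatic structures\<close>

text \<open>A relation of arity \<open>k\<close> is the pair of \<open>k\<close> and a set of lists of length \<open>k\<close>.\<close>

record 'a rel_structure =
  universe :: "'a set"
  relations :: "(nat \<times> 'a list set) list"

definition tuples :: "nat \<Rightarrow> 'a set \<Rightarrow> 'a list set" where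
  "tuples k S = {xs. length xs = k \<and> set xs \<subseteq> S}"

definition structure_iso :: "('a \<Rightarrow> 'b) \<Rightarrow> 'a rel_structure \<Rightarrow> 'b rel_structure \<Rightarrow> bool" where
  "structure_iso g M N \<longleftrightarrow>
     bij_betw g (universe M) (universe N) \<and>
     map fst (relations M) = map fst (relations N) \<and>
     (\<forall>i<length (relations M). \<forall>xs\<in>tuples (fst (relations M ! i)) (universe M).
        xs \<in> snd (relations M ! i) \<longleftrightarrow> map g xs \<in> snd (relations N ! i))"

definition compatible :: "'a rel \<Rightarrow> 'a list set \<Rightarrow> bool" where
  "compatible E R \<longleftrightarrow>
     (\<forall>xs ys. list_all2 (\<lambda>x y. (x, y) \<in> E) xs ys \<longrightarrow> xs \<in> R \<longrightarrow> ys \<in> R)"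

definition quotient_structure :: "'a rel_structure \<Rightarrow> 'a rel \<Rightarrow> 'a set rel_structure" where
  "quotient_structure M E =
     \<lparr> universe = universe M // E,
       relations = map (\<lambda>(k, R). (k, map (\<lambda>x. E `` {x}) ` R)) (relations M) \<rparr>"

definition convolution :: "'s inf_tree list \<Rightarrow> 's list inf_tree" where
  "convolution ts = (\<lambda>u. map (\<lambda>t. t u) ts)"

definition recognized_relation :: "nat \<Rightarrow> ('q, 's list) tree_automaton \<Rightarrow> 's inf_tree list set" where
  "recognized_relation k A = {ts. length ts = k \<and> convolution ts \<in> language A}"

text \<open>
  States and base letters are drawn from \<open>nat\<close>; as the sets of states and letters of an automaton
  are finite, this is only a choice of names. The automaton for a relation of arity \<open>k\<close> works over
  the product alphabet \<open>\<Sigma>\<^sup>k\<close>, where \<open>\<Sigma>\<close> is the alphabet of the automaton for the domain.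
\<close>

definition omega_tree_automatic :: "'a rel_structure \<Rightarrow> bool" where
  "omega_tree_automatic M \<longleftrightarrow>
     (\<exists>(A :: (nat, nat) tree_automaton) (Aeq :: (nat, nat list) tree_automaton)
        (As :: (nat, nat list) tree_automaton list) h E Rs g.
        muller_automaton A \<and> muller_automaton Aeq \<and> (\<forall>C\<in>set As. muller_automaton C) \<and>
        alphabet Aeq = tuples 2 (alphabet A) \<and>
        length As = length (relations M) \<and>
        (\<forall>i<length As. alphabet (As ! i) = tuples (fst (relations M ! i)) (alphabet A)) \<and>
        E = {(s, t). [s, t] \<in> recognized_relation 2 Aeq} \<and> equiv (language A) E \<and>
        Rs = map2 (\<lambda>R C. (fst R, recognized_relation (fst R) C)) (relations M) As \<and>
        (\<forall>(k, R)\<in>set Rs. R \<subseteq> tuples k (language A) \<and> compatible E R) \<and>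
        h ` language A = universe M \<and>
        structure_iso g (quotient_structure \<lparr>universe = language A, relations = Rs\<rparr> E) M \<and>
        (\<forall>t\<in>language A. g (E `` {t}) = h t))"

definition ba_structure :: "'a bool_alg \<Rightarrow> 'a rel_structure" where
  "ba_structure B =
     \<lparr> universe = ba_carrier B,
       relations =
         [(3, {[x, y, ba_meet B x y] | x y. x \<in> ba_carrier B \<and> y \<in> ba_carrier B}),
          (3, {[x, y, ba_join B x y] | x y. x \<in> ba_carrier B \<and> y \<in> ba_carrier B}),
          (2, {[x, ba_compl B x] | x. x \<in> ba_carrier B}),
          (1, {[ba_zero B]}),
          (1, {[ba_one B]})] \<rparr>"


section \<open>The continuum hypothesis and Just's axiom AT\<close>

text \<open>\<open>\<aleph>\<^sub>1 = 2\<^bsup>\<aleph>\<^sub>0\<^esup>\<close>\<close>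

definition CH :: bool where
  "CH \<longleftrightarrow> cardSuc natLeq =o |UNIV :: nat set set|"

text \<open>
  Subsets of \<open>\<omega>\<close> are identified with points of the Cantor space \<open>nat \<Rightarrow> bool\<close> (product of discrete
  spaces). A boldface \<open>\<Sigma>\<^sup>1\<^sub>1\<close> set is the projection of a closed subset of the product with the Baire
  space \<open>nat \<Rightarrow> nat\<close>.
\<close>

definition char_fun :: "nat set \<Rightarrow> nat \<Rightarrow> bool" where
  "char_fun X = (\<lambda>n. n \<in> X)"

definition analytic_family :: "nat set set \<Rightarrow> bool" where
  "analytic_family I \<longleftrightarrow>
     (\<exists>C :: ((nat \<Rightarrow> bool) \<times> (nat \<Rightarrow> nat)) set. closed C \<and> char_fun ` I = fst ` C)"

definition ideal_of_sets :: "'a set set \<Rightarrow> bool" where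
  "ideal_of_sets I \<longleftrightarrow>
     {} \<in> I \<and> (\<forall>X Y. X \<in> I \<longrightarrow> Y \<subseteq> X \<longrightarrow> Y \<in> I) \<and> (\<forall>X\<in>I. \<forall>Y\<in>I. X \<union> Y \<in> I)"

definition preserves_intersections_mod :: "nat set set \<Rightarrow> (nat set \<Rightarrow> nat set) \<Rightarrow> bool" where
  "preserves_intersections_mod I H \<longleftrightarrow>
     (\<forall>X Y. finite (sym_diff X Y) \<longrightarrow> sym_diff (H X) (H Y) \<in> I) \<and>
     (\<forall>X Y. sym_diff (H (X \<inter> Y)) (H X \<inter> H Y) \<in> I)"

definition almost_disjoint_family :: "nat set set \<Rightarrow> bool" where
  "almost_disjoint_family \<A> \<longleftrightarrow>
     (\<forall>A\<in>\<A>. infinite A) \<and> (\<forall>A\<in>\<A>. \<forall>B\<in>\<A>. A \<noteq> B \<longrightarrow> finite (A \<inter> B))"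

definition continuous_on_Pow :: "nat set \<Rightarrow> (nat set \<Rightarrow> nat set) \<Rightarrow> bool" where
  "continuous_on_Pow A F \<longleftrightarrow>
     continuous_on (char_fun ` Pow A) (\<lambda>x. char_fun (F {n. x n}))"

definition AT :: bool where
  "AT \<longleftrightarrow>
     (\<forall>I H \<A>. ideal_of_sets I \<and> analytic_family I \<and> preserves_intersections_mod I H \<and>
        uncountable \<A> \<and> almost_disjoint_family \<A> \<longrightarrow>
        (\<exists>A\<in>\<A>. \<exists>(k :: nat) D F. A = (\<Union>i<k. D i) \<and>
           (\<forall>i<k. continuous_on_Pow (D i) (F i) \<and>
              (\<forall>X. X \<subseteq> D i \<longrightarrow> sym_diff (F i X) (H X) \<in> I))))"

end

theory Submission
  imports Defs
begin

text \<open>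
  A subset of \<open>\<omega>\<^bsup>n+1\<^esup>\<close> has order type less than \<open>\<omega>\<^bsup>n+1\<^esup>\<close> iff all but finitely many of its slices, which
  are subsets of \<open>\<omega>\<^sup>n\<close>, have order type less than \<open>\<omega>\<^sup>n\<close>. Everything rests on this recursion.

  An automaton checks it by guessing, level by level, the column after which all slices are small.

  The recursion also makes the quotient a reduced power modulo the finite sets, hence countably
  saturated; under CH a back-and-forth construction of length \<open>\<omega>\<^sub>1\<close> yields isomorphisms.

  Finally it makes the ideal on \<open>\<omega>\<^sup>n\<close> complete for \<open>\<Sigma>\<^sup>0\<^bsub>2n\<^esub>\<close>, even when relativised to any set of
  order type \<open>\<omega>\<^sup>n\<close>. Under AT an isomorphism from the \<open>m\<close>-th to the \<open>n\<close>-th algebra has a continuous lifting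
  on some such set, which reduces the \<open>m\<close>-th ideal to the \<open>n\<close>-th one; for \<open>m > n\<close> this contradicts the
  strictness of the Borel hierarchy.
\<close>

section \<open>The ideal of sets of small order type\<close>

text \<open>Two features of AT shape the rigidity argument. Its continuous lifting lives only on the
  subsets of one piece of one member of an almost disjoint family, and AT chooses both. So the
  family consists of codes of sets of full order type; as the ideal is closed under finite unions,
  one of the finitely many pieces is again not small, and completeness is proved inside an arbitrary
  non-small set in order to apply there. Moreover the lifting agrees with the isomorphism only
  modulo the ideal, which is harmless because only membership in the ideal is compared.

  Non-smallness consists of \<open>n\<close> nested quantifiers
  \<open>\<exists>\<^sub>\<infinity>\<close>, so complexity is measured in the classes generated
  from the clopen sets by this quantifier. Complements of members of one class lie in the next, and
  strictness becomes a diagonal argument with universal sets.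

  Under CH the recursion runs over countable relations between representatives rather than maps
  between classes; initial segments of the chosen well-order are countable, so every stage stays
  within reach of countable saturation.\<close>

definition slice :: "nat \<Rightarrow> nat list set \<Rightarrow> nat list set" where
  "slice k P = {xs. k # xs \<in> P}"

fun small :: "nat \<Rightarrow> nat list set \<Rightarrow> bool" where
  "small 0 P \<longleftrightarrow> [] \<notin> P"
| "small (Suc n) P \<longleftrightarrow> (\<forall>\<^sub>\<infinity>k. small n (slice k P))"

lemma in_slice [simp]: "xs \<in> slice k P \<longleftrightarrow> k # xs \<in> P"
  by (simp add: slice_def)

lemma slice_simps [simp]:
  "slice k {} = {}" "slice k UNIV = UNIV" "slice k (P \<union> Q) = slice k P \<union> slice k Q"
  "slice k (P \<inter> Q) = slice k P \<inter> slice k Q" "slice k (P - Q) = slice k P - slice k Q"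
  "slice k (- P) = - slice k P" "slice k (\<Union>i\<in>J. R i) = (\<Union>i\<in>J. slice k (R i))"
  by (auto simp: slice_def)

text \<open>Tuples of other lengths are invisible to \<open>small\<close>, so unions, complements
  and \<open>UNIV\<close> can be formed among all lists; trimming to length \<open>n\<close> is left
  to the algebras themselves.\<close>

lemma small_cong: "(\<And>xs. length xs = n \<Longrightarrow> xs \<in> P \<longleftrightarrow> xs \<in> Q) \<Longrightarrow> small n P \<longleftrightarrow> small n Q"
proof (induction n arbitrary: P Q)
  case (Suc n)
  have "small n (slice k P) \<longleftrightarrow> small n (slice k Q)" for k
    by (rule Suc.IH) (simp add: Suc.prems)
  then show ?case by simp
qed simp

lemma small_mono: "small n P \<Longrightarrow> Q \<subseteq> P \<Longrightarrow> small n Q"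
proof (induction n arbitrary: P Q)
  case (Suc n)
  from Suc.prems(2) have "slice k Q \<subseteq> slice k P" for k by auto
  then show ?case
    using Suc.prems(1) Suc.IH by (auto elim!: MOST_mono)
qed auto

lemma small_empty [simp]: "small n {}"
  by (induction n) auto

lemma small_Un [simp]: "small n (P \<union> Q) \<longleftrightarrow> small n P \<and> small n Q"
  by (induction n arbitrary: P Q) (auto simp: MOST_conj_distrib)

lemma small_UN_finite: "finite J \<Longrightarrow> small n (\<Union>i\<in>J. P i) \<longleftrightarrow> (\<forall>i\<in>J. small n (P i))"
  by (induction J rule: finite_induct) auto

lemma not_small_UNIV: "\<not> small n UNIV"
  by (induction n) (auto simp: MOST_nat)

text \<open>Only finitely many columns meet a finite set. The exponent has to be positive, as
  \<open>{[]}\<close> is not small for \<open>n = 0\<close>.\<close>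

lemma small_finite: "finite P \<Longrightarrow> small (Suc n) P"
proof -
  assume "finite P"
  then have "finite (hd ` P)" by simp
  then have "\<forall>\<^sub>\<infinity>k. k \<notin> hd ` P" by (simp add: eventually_cofinite)
  then have "\<forall>\<^sub>\<infinity>k. slice k P = {}"
    by (rule MOST_mono) (force simp: slice_def)
  then show ?thesis by (auto elim!: MOST_mono)
qed

text \<open>
  A strictly increasing self-map of a well-order never moves a point down; this is how order types
  are compared below, without computing them.
\<close>

lemma wf_strict_mono_not_less:
  assumes "wf R" and mono: "\<And>x y. x \<in> A \<Longrightarrow> y \<in> A \<Longrightarrow> (x, y) \<in> R \<Longrightarrow> (h x, h y) \<in> R"
    and "h ` A \<subseteq> A" and "x \<in> A"
  shows "(h x, x) \<notin> R"
  using assms(1,4)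
proof (induction x rule: wf_induct_rule)
  case (less x)
  then show ?case using mono[of "h x" x] assms(3) by blast
qed

definition lex_less :: "nat \<Rightarrow> nat list rel" where
  "lex_less n = lexn less_than n"

lemma wf_lex_less: "wf (lex_less n)"
  by (simp add: lex_less_def wf_lexn)

lemma lex_less_0 [simp]: "lex_less 0 = {}"
  by (simp add: lex_less_def)

lemma lex_less_Cons [simp]:
  "(x # xs, y # ys) \<in> lex_less (Suc n) \<longleftrightarrow>
     length xs = n \<and> length ys = n \<and> (x < y \<or> x = y \<and> (xs, ys) \<in> lex_less n)"
  unfolding lex_less_def by (rule Cons_lexn_Suc)

lemma lex_less_length: "(xs, ys) \<in> lex_less n \<Longrightarrow> length xs = n \<and> length ys = n"
  by (simp add: lex_less_def lexn_length)

lemma lex_less_iff: "(xs, ys) \<in> lex_less n \<longleftrightarrow> (xs, ys) \<in> omega_power n \<and> xs \<noteq> ys"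
  using wf_lex_less[of n] lexn_length[of xs ys less_than n]
  unfolding omega_power_def lex_less_def by (auto dest: wf_irrefl)

text \<open>A non-small set contains a copy of the whole order: column \<open>j\<close> is sent into
  the \<open>j\<close>-th of the infinitely many non-small slices, by induction inside the
  column.\<close>

lemma not_small_strict_mono:
  "\<not> small n P \<Longrightarrow> \<exists>f. (\<forall>xs. length xs = n \<longrightarrow> f xs \<in> P \<and> length (f xs) = n) \<and>
      (\<forall>xs ys. (xs, ys) \<in> lex_less n \<longrightarrow> (f xs, f ys) \<in> lex_less n)"
proof (induction n arbitrary: P)
  case 0
  then show ?case by (intro exI[of _ "\<lambda>_. []"]) auto
next
  case (Suc n)
  let ?K = "{k. \<not> small n (slice k P)}"
  have inf: "infinite ?K" using Suc.prems by (simp add: eventually_cofinite)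
  have "\<forall>k\<in>?K. \<exists>f. (\<forall>xs. length xs = n \<longrightarrow> f xs \<in> slice k P \<and> length (f xs) = n) \<and>
      (\<forall>xs ys. (xs, ys) \<in> lex_less n \<longrightarrow> (f xs, f ys) \<in> lex_less n)"
    using Suc.IH by blast
  then obtain f where f: "\<And>k xs. k \<in> ?K \<Longrightarrow> length xs = n \<Longrightarrow> k # f k xs \<in> P \<and> length (f k xs) = n"
    "\<And>k xs ys. k \<in> ?K \<Longrightarrow> (xs, ys) \<in> lex_less n \<Longrightarrow> (f k xs, f k ys) \<in> lex_less n"
    by (metis in_slice)
  define e where "e = enumerate ?K"
  have e: "e j \<in> ?K" for j unfolding e_def by (rule enumerate_in_set[OF inf])
  have em: "i < j \<Longrightarrow> e i < e j" for i j
    unfolding e_def by (rule enumerate_mono[OF _ inf])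
  define F where "F xs = e (hd xs) # f (e (hd xs)) (tl xs)" for xs
  show ?case
  proof (intro exI[of _ F] conjI allI impI)
    fix xs :: "nat list" assume "length xs = Suc n"
    then show "F xs \<in> P" "length (F xs) = Suc n"
      using f(1)[OF e, of "tl xs" "hd xs"] by (auto simp: F_def)
  next
    fix xs ys assume l: "(xs, ys) \<in> lex_less (Suc n)"
    then obtain x xs' y ys' where "xs = x # xs'" "ys = y # ys'"
      by (metis lex_less_length length_Suc_conv)
    with l show "(F xs, F ys) \<in> lex_less (Suc n)"
      using em f[OF e] by (auto simp: F_def)
  qed
qed

text \<open>The bound \<open>c\<close> confines the image to the first \<open>c\<close> columns, a
  proper initial segment; an increasing map without such a bound would say nothing about the order
  type. The bounds on the slices also keep the induction going.\<close>

lemma small_strict_mono_bounded: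
  "small (Suc n) P \<Longrightarrow> \<exists>f c. (\<forall>xs\<in>P. length xs = Suc n \<longrightarrow> length (f xs) = Suc n \<and> hd (f xs) < c) \<and>
      (\<forall>xs\<in>P. \<forall>ys\<in>P. (xs, ys) \<in> lex_less (Suc n) \<longrightarrow> (f xs, f ys) \<in> lex_less (Suc n))"
proof (induction n arbitrary: P)
  case 0
  then obtain c where c: "\<And>k. k \<ge> c \<Longrightarrow> [k] \<notin> P" by (auto simp: MOST_nat_le)
  have "\<forall>xs\<in>P. length xs = Suc 0 \<longrightarrow> hd xs < c"
    using c by (auto simp: length_Suc_conv not_le[symmetric])
  then show ?case by (intro exI[of _ "\<lambda>x. x"] exI[of _ c]) auto
next
  case (Suc n)
  then obtain K where K: "\<And>k. k \<ge> K \<Longrightarrow> small (Suc n) (slice k P)" by (auto simp: MOST_nat_le)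
  have "\<forall>k. \<exists>f c. k \<ge> K \<longrightarrow> (\<forall>xs\<in>slice k P. length xs = Suc n \<longrightarrow> length (f xs) = Suc n \<and> hd (f xs) < c) \<and>
      (\<forall>xs\<in>slice k P. \<forall>ys\<in>slice k P. (xs, ys) \<in> lex_less (Suc n) \<longrightarrow> (f xs, f ys) \<in> lex_less (Suc n))"
    using Suc.IH[OF K] by blast
  then obtain f c where fc: "\<And>k. k \<ge> K \<longrightarrow> (\<forall>xs\<in>slice k P. length xs = Suc n \<longrightarrow> length (f k xs) = Suc n \<and> hd (f k xs) < c k) \<and>
      (\<forall>xs\<in>slice k P. \<forall>ys\<in>slice k P. (xs, ys) \<in> lex_less (Suc n) \<longrightarrow> (f k xs, f k ys) \<in> lex_less (Suc n))"
    by metis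
  have f1: "length (f k xs) = Suc n \<and> hd (f k xs) < c k" if "k \<ge> K" "k # xs \<in> P" "length xs = Suc n" for k xs
    using fc[of k] that by auto
  have f2: "(f k xs, f k ys) \<in> lex_less (Suc n)"
    if "k \<ge> K" "k # xs \<in> P" "k # ys \<in> P" "(xs, ys) \<in> lex_less (Suc n)" for k xs ys
    using fc[of k] that by auto
  \<comment> \<open>The images of the slices from \<open>K\<close> on are placed one after the other inside column \<open>K\<close>, which
    their bounded heads permit.\<close>
  define off where "off k = (\<Sum>i<k. c i)" for k
  have off: "off k + c k \<le> off l" if "k < l" for k l
  proof -
    have "off k + c k = (\<Sum>i<Suc k. c i)" by (simp add: off_def)
    also have "\<dots> \<le> off l" unfolding off_def using that by (intro sum_mono2) auto
    finally show ?thesis .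
  qed
  define F where "F xs = (let k = hd xs; ys = f k (tl xs) in
      if k < K then xs else K # (off k + hd ys) # tl ys)" for xs
  show ?case
  proof (intro exI[of _ F] exI[of _ "Suc K"] conjI ballI impI)
    fix xs :: "nat list" assume "xs \<in> P" "length xs = Suc (Suc n)"
    then show "length (F xs) = Suc (Suc n)" "hd (F xs) < Suc K"
      using f1[of "hd xs" "tl xs"] by (auto simp: F_def Let_def length_Suc_conv)
  next
    fix xs ys assume P: "xs \<in> P" "ys \<in> P" and l: "(xs, ys) \<in> lex_less (Suc (Suc n))"
    then obtain x xs' y ys' where eq: "xs = x # xs'" "ys = y # ys'" and len: "length xs' = Suc n" "length ys' = Suc n"
      by (metis lex_less_length length_Suc_conv)
    consider "x < K" | "x \<ge> K" "x < y" | "x \<ge> K" "x = y" "(xs', ys') \<in> lex_less (Suc n)"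
      using l eq by fastforce
    then show "(F xs, F ys) \<in> lex_less (Suc (Suc n))"
    proof cases
      case 1
      with l show ?thesis using eq f1[of y ys'] P len by (auto simp: F_def Let_def)
    next
      case 2
      have "off x + hd (f x xs') < off y + hd (f y ys')"
        using f1[of x xs'] off[of x y] 2 P eq len by simp
      then show ?thesis using 2 f1[of x xs'] f1[of y ys'] P eq len by (auto simp: F_def Let_def)
    next
      case 3
      obtain u us v vs where "f x xs' = u # us" "f x ys' = v # vs"
        using f1[of x xs'] f1[of x ys'] 3 P eq len by (metis length_Suc_conv)
      then show ?thesis using 3 f2[of x xs' ys'] P eq len by (auto simp: F_def Let_def)
    qed
  qed
qed

lemma embed_strict_mono:
  assumes "Well_order r" "embed r r' f" "(x, y) \<in> r" "x \<noteq> y"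
  shows "(f x, f y) \<in> r' \<and> f x \<noteq> f y"
proof -
  have "x \<in> Field r" "y \<in> Field r" using assms(3) by (auto simp: Field_def)
  moreover have "inj_on f (Field r)" using embed_inj_on assms by blast
  moreover have "compat r r' f" using embed_compat assms by blast
  ultimately show ?thesis using assms(3,4) by (auto simp: inj_on_def compat_def)
qed

text \<open>Both directions end in a strictly increasing self-map of the whole order that moves a
  point down. An embedding of the whole order into a small \<open>P\<close> is followed by the
  compression of \<open>P\<close> into finitely many columns; an embedding of a non-small
  \<open>P\<close> onto a proper initial segment is preceded by a copy of the whole order inside
  \<open>P\<close>.\<close>

lemma omega_ideal_iff:
  "P \<in> omega_ideal (Suc n) \<longleftrightarrow> (\<forall>xs\<in>P. length xs = Suc n) \<and> small (Suc n) P"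
proof (cases "\<forall>xs\<in>P. length xs = Suc n")
  case len: True
  let ?r = "omega_power (Suc n)" and ?s = "Restr (omega_power (Suc n)) P"
  let ?L = "{xs :: nat list. length xs = Suc n}"
  have wr: "Well_order ?r" and ws: "Well_order ?s"
    using Well_order_omega_power Well_order_Restr by blast+
  have Fs: "Field ?s = P"
    using len Well_order_omega_power
    by (subst Refl_Field_Restr) (auto simp: Field_omega_power order_on_defs)
  have impossible: False
    if h: "h ` ?L \<subseteq> ?L" "\<And>xs ys. (xs, ys) \<in> lex_less (Suc n) \<Longrightarrow> (h xs, h ys) \<in> lex_less (Suc n)"
      and "a \<in> ?L" "(h a, a) \<in> lex_less (Suc n)" for h a
    using wf_strict_mono_not_less[OF wf_lex_less, of ?L "Suc n" h a] that by blast
  have "small (Suc n) P \<longleftrightarrow> ?s <o ?r"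
  proof
    assume "small (Suc n) P"
    from small_strict_mono_bounded[OF this] obtain f c where
      f1: "\<And>xs. xs \<in> P \<Longrightarrow> length (f xs) = Suc n \<and> hd (f xs) < c"
      and f2: "\<And>xs ys. xs \<in> P \<Longrightarrow> ys \<in> P \<Longrightarrow> (xs, ys) \<in> lex_less (Suc n) \<Longrightarrow> (f xs, f ys) \<in> lex_less (Suc n)"
      using len by metis
    show "?s <o ?r"
    proof (rule ccontr)
      assume "\<not> ?s <o ?r"
      then have "?r \<le>o ?s" using wr ws by (simp add: not_ordLess_iff_ordLeq)
      then obtain g where g: "embed ?r ?s g" by (auto simp: ordLeq_def)
      have gP: "g xs \<in> P" if "length xs = Suc n" for xs
        using embed_in_Field[OF g, of xs] that Fs by (simp add: Field_omega_power)
      have gm: "(f (g xs), f (g ys)) \<in> lex_less (Suc n)" if l: "(xs, ys) \<in> lex_less (Suc n)" for xs ys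
        using embed_strict_mono[OF wr g, of xs ys] l lex_less_length[OF l] f2[OF gP gP]
        by (auto simp: lex_less_iff)
      \<comment> \<open>The least tuple of column \<open>c\<close>, beyond every value of
        \<open>f\<close> on \<open>P\<close>.\<close>
      let ?a = "c # replicate n 0"
      have "length (f (g ?a)) = Suc n" "hd (f (g ?a)) < c" using f1[OF gP[of ?a]] by simp_all
      then have "(f (g ?a), ?a) \<in> lex_less (Suc n)" by (cases "f (g ?a)") auto
      then show False using impossible[of "f \<circ> g" ?a] gm f1 gP by auto
    qed
  next
    assume "?s <o ?r"
    then obtain g where g: "embedS ?s ?r g" by (auto simp: ordLess_def)
    then have ge: "embed ?s ?r g" by (simp add: embedS_def)
    show "small (Suc n) P"
    proof (rule ccontr)
      assume "\<not> small (Suc n) P"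
      from not_small_strict_mono[OF this] obtain f where
        f1: "\<And>xs. length xs = Suc n \<Longrightarrow> f xs \<in> P \<and> length (f xs) = Suc n" and
        f2: "\<And>xs ys. (xs, ys) \<in> lex_less (Suc n) \<Longrightarrow> (f xs, f ys) \<in> lex_less (Suc n)" by metis
      have "g ` P \<noteq> ?L" and sub: "g ` P \<subseteq> ?L"
        using embedS_iff[OF ws ge] g embed_Field[OF ge] by (auto simp: Fs Field_omega_power)
      then obtain a where a: "a \<in> ?L" "a \<notin> g ` P" by blast
      \<comment> \<open>The range of an embedding is downward closed, so the point \<open>a\<close>
        outside it lies above all of it.\<close>
      have ofil: "wo_rel.ofilter ?r (g ` P)"
        using embed_Field_ofilter[OF ws wr ge] by (simp add: Fs)
      have "b \<noteq> a \<and> (a, b) \<notin> ?r" if "b \<in> g ` P" for b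
        using ofil a that wr by (auto simp: wo_rel.ofilter_def wo_rel_def under_def)
      moreover have "(b, a) \<in> ?r \<or> (a, b) \<in> ?r" if "length b = Suc n" for b
        using wr a that by (cases "b = a")
          (auto simp: well_order_on_def linear_order_on_def partial_order_on_def preorder_on_def
            refl_on_def total_on_def Field_omega_power)
      ultimately have less: "(g (f a), a) \<in> lex_less (Suc n)"
        using f1[of a] a sub unfolding lex_less_iff by blast
      have "(g (f xs), g (f ys)) \<in> lex_less (Suc n)" if l: "(xs, ys) \<in> lex_less (Suc n)" for xs ys
        using embed_strict_mono[OF ws ge, of "f xs" "f ys"] f2[OF l] f1 lex_less_length[OF l]
        by (auto simp: lex_less_iff)
      moreover have "g (f xs) \<in> ?L" if "xs \<in> ?L" for xs
        using sub f1[of xs] that by blast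
      ultimately show False using impossible[of "g \<circ> f" a] less a by fastforce
    qed
  qed
  then show ?thesis using len by (auto simp: omega_ideal_def Field_omega_power)
qed (auto simp: omega_ideal_def Field_omega_power)

section \<open>Quotients of power sets\<close>

locale powerset_ideal =
  fixes S :: "'a set" and I :: "'a set set"
  assumes ideal_sub: "I \<subseteq> Pow S"
    and ideal_empty: "{} \<in> I"
    and ideal_down: "X \<in> I \<Longrightarrow> Y \<subseteq> X \<Longrightarrow> Y \<in> I"
    and ideal_Un: "X \<in> I \<Longrightarrow> Y \<in> I \<Longrightarrow> X \<union> Y \<in> I"
begin

abbreviation B where "B \<equiv> powerset_quotient S I"

definition cls :: "'a set \<Rightarrow> 'a set set" where
  "cls X = mod_rel S I `` {X}"

lemma ideal_sym_diff_trans: "sym_diff X Y \<in> I \<Longrightarrow> sym_diff Y Z \<in> I \<Longrightarrow> sym_diff X Z \<in> I"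
  by (rule ideal_down[OF ideal_Un[of "sym_diff X Y" "sym_diff Y Z"]]) auto

lemma equiv_mod_rel: "equiv (Pow S) (mod_rel S I)"
proof (rule equivI)
  show "mod_rel S I \<subseteq> Pow S \<times> Pow S"
    by (auto simp: mod_rel_def)
  show "refl_on (Pow S) (mod_rel S I)"
    by (auto simp: refl_on_def mod_rel_def ideal_empty)
  show "sym (mod_rel S I)"
    by (auto simp: sym_def mod_rel_def Un_commute)
  show "trans (mod_rel S I)"
    unfolding trans_def mod_rel_def using ideal_sym_diff_trans by blast
qed

lemma cls_eq_iff: "X \<subseteq> S \<Longrightarrow> Y \<subseteq> S \<Longrightarrow> cls X = cls Y \<longleftrightarrow> sym_diff X Y \<in> I"
  unfolding cls_def using eq_equiv_class_iff[OF equiv_mod_rel, of X Y] by (auto simp: mod_rel_def)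

lemma in_cls_iff: "Y \<in> cls X \<longleftrightarrow> X \<subseteq> S \<and> Y \<subseteq> S \<and> sym_diff X Y \<in> I"
  by (simp add: cls_def mod_rel_def)

lemma carrier_eq: "ba_carrier B = cls ` Pow S"
  by (auto simp: powerset_quotient_def cls_def quotient_def)

lemma cls_in_carrier [simp]: "X \<subseteq> S \<Longrightarrow> cls X \<in> ba_carrier B"
  by (auto simp: carrier_eq)

lemma carrier_cases: "x \<in> ba_carrier B \<Longrightarrow> (\<And>X. X \<subseteq> S \<Longrightarrow> x = cls X \<Longrightarrow> thesis) \<Longrightarrow> thesis"
  by (auto simp: carrier_eq)

text \<open>The quotient operations are unions over all representatives; such a union collapses to
  one class as soon as its members do not depend on the representative.\<close>

lemma UN_cls_const:
  assumes "X \<subseteq> S" "\<And>X'. X' \<in> cls X \<Longrightarrow> F X' = C"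
  shows "(\<Union>X'\<in>cls X. F X') = C"
proof -
  have "X \<in> cls X" using assms(1) by (simp add: in_cls_iff ideal_empty)
  then show ?thesis using assms(2) by blast
qed

lemma cls_cong: "sym_diff X Y \<in> I \<Longrightarrow> X \<subseteq> S \<Longrightarrow> Y \<subseteq> S \<Longrightarrow> cls X = cls Y"
  by (simp add: cls_eq_iff)

lemma sym_diff_ideal2:
  "sym_diff X X' \<in> I \<Longrightarrow> sym_diff Y Y' \<in> I \<Longrightarrow> Z \<subseteq> sym_diff X X' \<union> sym_diff Y Y' \<Longrightarrow> Z \<in> I"
  using ideal_Un ideal_down by blast

lemma meet_cls [simp]:
  assumes "X \<subseteq> S" "Y \<subseteq> S" shows "ba_meet B (cls X) (cls Y) = cls (X \<inter> Y)"
proof -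
  have "cls (X' \<inter> Y') = cls (X \<inter> Y)" if "X' \<in> cls X" "Y' \<in> cls Y" for X' Y'
  proof (rule cls_cong)
    show "sym_diff (X' \<inter> Y') (X \<inter> Y) \<in> I"
      by (rule sym_diff_ideal2[of X X' Y Y']) (use that in \<open>auto simp: in_cls_iff\<close>)
  qed (use that assms in \<open>auto simp: in_cls_iff\<close>)
  then show ?thesis
    unfolding powerset_quotient_def bool_alg.simps cls_def[symmetric]
    by (intro UN_cls_const assms)
qed

lemma join_cls [simp]:
  assumes "X \<subseteq> S" "Y \<subseteq> S" shows "ba_join B (cls X) (cls Y) = cls (X \<union> Y)"
proof -
  have "cls (X' \<union> Y') = cls (X \<union> Y)" if "X' \<in> cls X" "Y' \<in> cls Y" for X' Y'
  proof (rule cls_cong)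
    show "sym_diff (X' \<union> Y') (X \<union> Y) \<in> I"
      by (rule sym_diff_ideal2[of X X' Y Y']) (use that in \<open>auto simp: in_cls_iff\<close>)
  qed (use that assms in \<open>auto simp: in_cls_iff\<close>)
  then show ?thesis
    unfolding powerset_quotient_def bool_alg.simps cls_def[symmetric]
    by (intro UN_cls_const assms)
qed

lemma compl_cls [simp]:
  assumes "X \<subseteq> S" shows "ba_compl B (cls X) = cls (S - X)"
proof -
  have "cls (S - X') = cls (S - X)" if "X' \<in> cls X" for X'
  proof (rule cls_cong)
    show "sym_diff (S - X') (S - X) \<in> I"
      by (rule ideal_down[of "sym_diff X X'"]) (use that in \<open>auto simp: in_cls_iff\<close>)
  qed auto
  then show ?thesis
    unfolding powerset_quotient_def bool_alg.simps cls_def[symmetric]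
    by (intro UN_cls_const assms)
qed

lemma zero_eq: "ba_zero B = cls {}" and one_eq: "ba_one B = cls S"
  by (simp_all add: powerset_quotient_def cls_def)

lemma cls_eq_zero_iff: "X \<subseteq> S \<Longrightarrow> cls X = ba_zero B \<longleftrightarrow> X \<in> I"
  by (simp add: zero_eq cls_eq_iff)

lemma boolean_algebra: "carrier_boolean_algebra B"
  by (unfold_locales; (elim carrier_cases)?; (simp add: zero_eq one_eq le_infI1)?; (rule arg_cong[where f = cls], blast)?)

lemma atomlessI:
  assumes "\<And>X. X \<subseteq> S \<Longrightarrow> X \<notin> I \<Longrightarrow> \<exists>Y\<subseteq>X. Y \<notin> I \<and> X - Y \<notin> I"
  shows "ba_atomless B"
  unfolding ba_atomless_def
proof (intro ballI impI)
  fix x assume "x \<in> ba_carrier B" "x \<noteq> ba_zero B"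
  then obtain X where X: "X \<subseteq> S" "x = cls X" "X \<notin> I"
    by (metis carrier_cases cls_eq_zero_iff)
  then obtain Y where Y: "Y \<subseteq> X" "Y \<notin> I" "X - Y \<notin> I" using assms by blast
  then have "Y \<subseteq> S" "X \<inter> Y = Y" "sym_diff Y X = X - Y" using X by auto
  then show "\<exists>y\<in>ba_carrier B. y \<noteq> ba_zero B \<and> ba_le B y x \<and> y \<noteq> x"
    using X Y by (intro bexI[of _ "cls Y"]) (auto simp: cls_eq_zero_iff ba_le_def cls_eq_iff Int_commute)
qed

end

text \<open>Back-and-forth yields a relation between sets, not a function on classes. Applied to
  symmetric differences, \<open>null\<close> says that left sides are equivalent exactly if right
  sides are, which is at once well-definedness and injectivity of the induced map.\<close>

lemma powerset_quotient_isomorphicI: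
  assumes "powerset_ideal S I" "powerset_ideal T J"
    and sub: "G \<subseteq> Pow S \<times> Pow T" and dom: "Pow S \<subseteq> Domain G" and ran: "Pow T \<subseteq> Range G"
    and un: "\<And>X Y X' Y'. (X, Y) \<in> G \<Longrightarrow> (X', Y') \<in> G \<Longrightarrow> (X \<union> X', Y \<union> Y') \<in> G"
    and compl: "\<And>X Y. (X, Y) \<in> G \<Longrightarrow> (S - X, T - Y) \<in> G"
    and null: "\<And>X Y. (X, Y) \<in> G \<Longrightarrow> X \<in> I \<longleftrightarrow> Y \<in> J"
  shows "ba_isomorphic (powerset_quotient S I) (powerset_quotient T J)"
proof -
  interpret S: powerset_ideal S I by fact
  interpret T: powerset_ideal T J by fact
  have int: "(X \<inter> X', Y \<inter> Y') \<in> G" if "(X, Y) \<in> G" "(X', Y') \<in> G" for X Y X' Y'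
  proof -
    have "(S - ((S - X) \<union> (S - X')), T - ((T - Y) \<union> (T - Y'))) \<in> G"
      using that by (intro compl un)
    moreover have "S - ((S - X) \<union> (S - X')) = X \<inter> X'" "T - ((T - Y) \<union> (T - Y')) = Y \<inter> Y'"
      using that sub by auto
    ultimately show ?thesis by simp
  qed
  have sd: "sym_diff X X' \<in> I \<longleftrightarrow> sym_diff Y Y' \<in> J" if "(X, Y) \<in> G" "(X', Y') \<in> G" for X Y X' Y'
  proof -
    have "((X \<inter> (S - X')) \<union> (X' \<inter> (S - X)), (Y \<inter> (T - Y')) \<union> (Y' \<inter> (T - Y))) \<in> G"
      using that by (intro compl un int)
    moreover have "(X \<inter> (S - X')) \<union> (X' \<inter> (S - X)) = sym_diff X X'"
      "(Y \<inter> (T - Y')) \<union> (Y' \<inter> (T - Y)) = sym_diff Y Y'"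
      using that sub by auto
    ultimately show ?thesis using null by metis
  qed
  define f where "f x = T.cls (SOME Y. \<exists>X. (X, Y) \<in> G \<and> x = S.cls X)" for x
  have f: "f (S.cls X) = T.cls Y" if XY: "(X, Y) \<in> G" for X Y
  proof -
    have "\<exists>X'. (X', SOME Y. \<exists>X'. (X', Y) \<in> G \<and> S.cls X = S.cls X') \<in> G \<and> S.cls X = S.cls X'"
      by (rule someI[where P = "\<lambda>Y. \<exists>X'. (X', Y) \<in> G \<and> S.cls X = S.cls X'"]) (use XY in blast)
    then obtain X' Y' where *: "(X', Y') \<in> G" "S.cls X = S.cls X'" "f (S.cls X) = T.cls Y'"
      unfolding f_def by blast
    then have "sym_diff X X' \<in> I" using XY sub by (subst (asm) S.cls_eq_iff) auto
    then have "sym_diff Y Y' \<in> J" using sd[OF XY *(1)] by blast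
    then have "T.cls Y = T.cls Y'" using XY * sub by (intro T.cls_cong) auto
    then show ?thesis using * by simp
  qed
  have ex: "\<exists>X Y. (X, Y) \<in> G \<and> x = S.cls X \<and> X \<subseteq> S \<and> Y \<subseteq> T" if x: "x \<in> ba_carrier S.B" for x
  proof -
    obtain X where X: "X \<subseteq> S" "x = S.cls X" using x by (elim S.carrier_cases)
    then obtain Y where "(X, Y) \<in> G" using dom by blast
    then show ?thesis using X sub by blast
  qed
  have "bij_betw f (ba_carrier S.B) (ba_carrier T.B)"
    unfolding bij_betw_def
  proof
    show "inj_on f (ba_carrier S.B)"
    proof (rule inj_onI)
      fix x x' assume xx: "x \<in> ba_carrier S.B" "x' \<in> ba_carrier S.B" and eq: "f x = f x'"
      obtain X Y X' Y' where *: "(X, Y) \<in> G" "x = S.cls X" "X \<subseteq> S" "Y \<subseteq> T"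
        "(X', Y') \<in> G" "x' = S.cls X'" "X' \<subseteq> S" "Y' \<subseteq> T"
        using ex[OF xx(1)] ex[OF xx(2)] by auto
      then have "T.cls Y = T.cls Y'" using eq f by metis
      then show "x = x'" using * sd[of X Y X' Y'] by (auto simp: T.cls_eq_iff S.cls_eq_iff)
    qed
    show "f ` ba_carrier S.B = ba_carrier T.B"
    proof safe
      fix x assume "x \<in> ba_carrier S.B"
      then show "f x \<in> ba_carrier T.B" using ex[of x] by (auto simp: f)
    next
      fix y assume "y \<in> ba_carrier T.B"
      then obtain Y where "Y \<subseteq> T" "y = T.cls Y" by (elim T.carrier_cases)
      moreover then obtain X where "(X, Y) \<in> G" using ran by blast
      ultimately have "y = f (S.cls X)" "X \<subseteq> S" using f sub by auto
      then show "y \<in> f ` ba_carrier S.B" using imageI[OF S.cls_in_carrier, of X f] by simp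
    qed
  qed
  moreover have "f (ba_meet S.B x x') = ba_meet T.B (f x) (f x')"
    "f (ba_join S.B x x') = ba_join T.B (f x) (f x')"
    if xx: "x \<in> ba_carrier S.B" "x' \<in> ba_carrier S.B" for x x'
  proof -
    obtain X Y X' Y' where *: "(X, Y) \<in> G" "x = S.cls X" "X \<subseteq> S" "Y \<subseteq> T"
        "(X', Y') \<in> G" "x' = S.cls X'" "X' \<subseteq> S" "Y' \<subseteq> T"
        using ex[OF xx(1)] ex[OF xx(2)] by auto
    then show "f (ba_meet S.B x x') = ba_meet T.B (f x) (f x')"
       "f (ba_join S.B x x') = ba_join T.B (f x) (f x')"
      by (auto simp: f[OF int[OF *(1,5)]] f[OF un[OF *(1,5)]] f[OF *(1)] f[OF *(5)])
  qed
  moreover have "f (ba_compl S.B x) = ba_compl T.B (f x)" if xx: "x \<in> ba_carrier S.B" for x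
    using ex[OF xx] by (auto simp: f f[OF compl])
  \<comment> \<open>The empty pair is the intersection of any pair with its complement.\<close>
  moreover have "({}, {}) \<in> G"
  proof -
    obtain X Y where XY: "(X, Y) \<in> G" using dom by blast
    from int[OF this compl[OF this]] show ?thesis by simp
  qed
  then have "f (ba_zero S.B) = ba_zero T.B" "f (ba_one S.B) = ba_one T.B"
    using compl[of "{}" "{}"] by (auto simp: S.zero_eq T.zero_eq S.one_eq T.one_eq f)
  ultimately show ?thesis unfolding ba_isomorphic_def ba_iso_def by blast
qed

section \<open>The algebras of the ordinals \<open>\<omega>^n\<close>: axioms, atomlessness,
  distinctness\<close>

definition lists_of_length :: "nat \<Rightarrow> nat list set" where
  "lists_of_length n = {xs. length xs = n}"

lemma omega_algebra_eq: "omega_algebra n = powerset_quotient (lists_of_length n) (omega_ideal n)"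
  by (simp add: omega_algebra_def Field_omega_power lists_of_length_def)

lemma mem_omega_ideal_iff:
  "n \<ge> 1 \<Longrightarrow> P \<in> omega_ideal n \<longleftrightarrow> P \<subseteq> lists_of_length n \<and> small n P"
  using omega_ideal_iff[of P "n - 1"] by (auto simp: lists_of_length_def)

lemma powerset_ideal_omega: "n \<ge> 1 \<Longrightarrow> powerset_ideal (lists_of_length n) (omega_ideal n)"
  by unfold_locales (auto simp: mem_omega_ideal_iff intro: small_mono)

lemma boolean_algebra_omega_algebra: "n \<ge> 1 \<Longrightarrow> carrier_boolean_algebra (omega_algebra n)"
  unfolding omega_algebra_eq by (rule powerset_ideal.boolean_algebra[OF powerset_ideal_omega])

text \<open>The infinitely many non-small columns are divided into two infinite groups.\<close>

lemma not_small_splits: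
  assumes "\<not> small (Suc n) X" shows "\<exists>Y\<subseteq>X. \<not> small (Suc n) Y \<and> \<not> small (Suc n) (X - Y)"
proof -
  let ?K = "{k. \<not> small n (slice k X)}"
  have inf: "infinite ?K" using assms by (simp add: eventually_cofinite)
  then obtain A B where "A \<subseteq> ?K" "B \<subseteq> ?K" "infinite A" "infinite B" "A \<inter> B = {}"
    by (rule infinite_split)
  moreover then have "B \<subseteq> ?K - A" by blast
  ultimately have A: "A \<subseteq> ?K" "infinite A" "infinite (?K - A)"
    using infinite_super by blast+
  define Y where "Y = {xs \<in> X. hd xs \<in> A}"
  have "slice k Y = slice k X" if "k \<in> A" for k using that by (auto simp: Y_def)
  then have "A \<subseteq> {k. \<not> small n (slice k Y)}" using A by auto
  moreover have "slice k (X - Y) = slice k X" if "k \<notin> A" for k using that by (auto simp: Y_def)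
  then have "?K - A \<subseteq> {k. \<not> small n (slice k (X - Y))}" by auto
  moreover have "Y \<subseteq> X" by (auto simp: Y_def)
  ultimately show ?thesis using A
    by (intro exI[of _ Y]) (auto simp: eventually_cofinite dest: infinite_super simp del: slice_simps)
qed

lemma atomless_omega_algebra: "n \<ge> 1 \<Longrightarrow> ba_atomless (omega_algebra n)"
  unfolding omega_algebra_eq
proof (rule powerset_ideal.atomlessI[OF powerset_ideal_omega])
  fix X assume n: "n \<ge> 1" and "X \<subseteq> lists_of_length n" "X \<notin> omega_ideal n"
  then show "\<exists>Y\<subseteq>X. Y \<notin> omega_ideal n \<and> X - Y \<notin> omega_ideal n"
    using not_small_splits[of "n - 1" X] by (auto simp: mem_omega_ideal_iff)
qed

text \<open>Distinct here means unequal as records, which holds whatever the isomorphism types are: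
  \<open>n\<close> can be read off because the union of the top class is all of
  \<open>\<omega>^n\<close>.\<close>

lemma infinite_omega_algebras: "infinite (omega_algebra ` {1..})"
proof -
  have "\<Union> (ba_one (omega_algebra n)) = lists_of_length n" if n: "n \<ge> 1" for n
  proof -
    interpret powerset_ideal "lists_of_length n" "omega_ideal n" by (rule powerset_ideal_omega[OF n])
    have "lists_of_length n \<in> cls (lists_of_length n)" by (simp add: in_cls_iff ideal_empty)
    then have "lists_of_length n \<subseteq> \<Union> (cls (lists_of_length n))" by blast
    moreover have "\<Union> (cls (lists_of_length n)) \<subseteq> lists_of_length n" by (auto simp: in_cls_iff)
    ultimately show ?thesis by (simp add: omega_algebra_eq one_eq)
  qed
  then have "\<Union> (ba_one (omega_algebra n)) = lists_of_length n" if "n \<in> {1..}" for n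
    using that by simp
  moreover have "inj lists_of_length"
  proof (rule injI)
    fix m n assume "lists_of_length m = lists_of_length n"
    moreover have "replicate m 0 \<in> lists_of_length m" by (simp add: lists_of_length_def)
    ultimately show "m = n" by (simp add: lists_of_length_def)
  qed
  ultimately have "inj_on omega_algebra {1..}"
    by (intro inj_onI) (metis injD)
  then show ?thesis using finite_imageD infinite_Ici by blast
qed

section \<open>Tree automata for smallness\<close>

text \<open>
  The automaton guesses, on each leftward spine of level \<open>j\<close>, the column from which on all slices
  are small: it is in \<open>pre_state j\<close> before that column and in \<open>post_state j\<close> after it. State \<open>0\<close>
  accepts every tree, and \<open>pre_state 0\<close> reads the letter attached to a tuple. Staying in
  \<open>pre_state j\<close> forever is what acceptance forbids.
\<close>

definition pre_state :: "nat \<Rightarrow> nat" where "pre_state j = 2 * j + 1"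
definition post_state :: "nat \<Rightarrow> nat" where "post_state j = 2 * j + 2"

lemma state_simps [simp]:
  "pre_state i = pre_state j \<longleftrightarrow> i = j" "post_state i = post_state j \<longleftrightarrow> i = j" "pre_state i \<noteq> post_state j" "post_state j \<noteq> pre_state i"
  "pre_state i \<noteq> 0" "post_state i \<noteq> 0" "0 \<noteq> pre_state i" "0 \<noteq> post_state i"
  unfolding pre_state_def post_state_def by presburger+

inductive small_step :: "('s \<Rightarrow> bool) \<Rightarrow> nat \<Rightarrow> 's \<Rightarrow> nat \<Rightarrow> nat \<Rightarrow> bool" for \<phi> where
  "small_step \<phi> 0 a 0 0"
| "\<not> \<phi> a \<Longrightarrow> small_step \<phi> (pre_state 0) a 0 0"
| "small_step \<phi> (pre_state (Suc j)) a (pre_state (Suc j)) 0"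
| "small_step \<phi> (pre_state (Suc j)) a (post_state (Suc j)) 0"
| "small_step \<phi> (post_state (Suc j)) a (post_state (Suc j)) (pre_state j)"

lemma small_step_simps [simp]:
  "small_step \<phi> 0 a p q \<longleftrightarrow> p = 0 \<and> q = 0"
  "small_step \<phi> (pre_state 0) a p q \<longleftrightarrow> \<not> \<phi> a \<and> p = 0 \<and> q = 0"
  "small_step \<phi> (pre_state (Suc j)) a p q \<longleftrightarrow> (p = pre_state (Suc j) \<or> p = post_state (Suc j)) \<and> q = 0"
  "small_step \<phi> (post_state (Suc j)) a p q \<longleftrightarrow> p = post_state (Suc j) \<and> q = pre_state j"
  by (auto simp: small_step.simps)

text \<open>Along a branch of a run the level never rises and \<open>post_state j\<close> never
  returns to \<open>pre_state j\<close>, so the state is eventually constant. Forbidding the limits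
  \<open>{pre_state j}\<close> rejects just the runs that wait forever on some branch.\<close>

definition small_automaton :: "nat \<Rightarrow> 's set \<Rightarrow> ('s \<Rightarrow> bool) \<Rightarrow> (nat, 's) tree_automaton" where
  "small_automaton n \<Sigma> \<phi> =
     \<lparr> states = {..post_state n}, alphabet = \<Sigma>,
       transitions = {(q, a, q1, q2). q \<le> post_state n \<and> a \<in> \<Sigma> \<and> small_step \<phi> q a q1 q2},
       initial = pre_state n, accepting = {X. X \<subseteq> {..post_state n} \<and> (\<forall>j. X \<noteq> {pre_state j})} \<rparr>"

lemma small_step_bound: "small_step \<phi> q a q1 q2 \<Longrightarrow> q \<le> post_state n \<Longrightarrow> q1 \<le> post_state n \<and> q2 \<le> post_state n"
  by (erule small_step.cases) (simp_all add: pre_state_def post_state_def, presburger+)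

lemma muller_small_automaton: "finite \<Sigma> \<Longrightarrow> muller_automaton (small_automaton n \<Sigma> \<phi>)"
  using small_step_bound[of \<phi> _ _ _ _ n]
  by (auto simp: muller_automaton_def small_automaton_def) (auto simp: pre_state_def post_state_def)

text \<open>
  The position in the binary tree at which membership of a tuple is recorded.
\<close>

fun node :: "nat list \<Rightarrow> dir list" where
  "node [] = []"
| "node (a # as) = replicate a Lft @ Rgt # node as"

text \<open>Inverts the decomposition \<open>replicate j Lft @ Rgt # v\<close> of a position, so
  that a run can be defined by cases on the column \<open>j\<close>.\<close>

fun spine :: "nat \<Rightarrow> dir list \<Rightarrow> nat \<times> dir list option" where
  "spine j [] = (j, None)"
| "spine j (Lft # u) = spine (Suc j) u"
| "spine j (Rgt # u) = (j, Some u)"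

lemma spine_replicate [simp]: "spine i (replicate j Lft @ u) = spine (i + j) u"
  by (induction j arbitrary: i) auto

lemma spine_replicate' [simp]: "spine i (replicate j Lft) = (i + j, None)"
  using spine_replicate[of i j "[]"] by (simp del: spine_replicate)

lemma inj_node: "inj node"
proof (rule injI)
  show "node as = node bs \<Longrightarrow> as = bs" for as bs
  proof (induction as arbitrary: bs)
    case Nil
    then show ?case by (cases bs) auto
  next
    case (Cons a as)
    then obtain b bs' where bs: "bs = b # bs'" by (cases bs) auto
    then have "spine 0 (node (a # as)) = spine 0 (node (b # bs'))" using Cons.prems by simp
    then show ?case using Cons.IH bs by simp
  qed
qed

lemma dir_list_cases: obtains j where "u = replicate j Lft" | j v where "u = replicate j Lft @ Rgt # v"
proof (induction u arbitrary: thesis)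
  case Nil
  then show ?case by (metis replicate_0)
next
  case (Cons d u)
  show ?case
  proof (cases d)
    case Lft
    show ?thesis by (rule Cons.IH) (use Cons.prems Lft in \<open>metis replicate_Suc append_Cons\<close>)+
  next
    case Rgt
    then show ?thesis using Cons.prems(2)[of 0 u] by simp
  qed
qed

text \<open>Cutting off the prefix \<open>v\<close> shifts positions by \<open>length v\<close>,
  which \<open>\<exists>\<^sub>\<infinity>\<close> does not notice; this transfers acceptance
  between a tree and its subtrees.\<close>

lemma infinitely_often_append:
  assumes "\<And>m. map \<gamma> [0..<m + length v] = v @ map \<beta> [0..<m]"
  shows "infinitely_often \<rho> \<gamma> = infinitely_often (\<lambda>u. \<rho> (v @ u)) \<beta>"
proof -
  have shift: "(\<exists>\<^sub>\<infinity>n. P n) \<longleftrightarrow> (\<exists>\<^sub>\<infinity>n. P (n + k))" for P :: "nat \<Rightarrow> bool" and k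
    unfolding INFM_nat_le
  proof (intro iffI allI)
    fix m assume "\<forall>m. \<exists>n\<ge>m. P n"
    then obtain n where "n \<ge> m + k" "P n" by blast
    then show "\<exists>n\<ge>m. P (n + k)" by (intro exI[of _ "n - k"]) auto
  next
    fix m assume "\<forall>m. \<exists>n\<ge>m. P (n + k)"
    then show "\<exists>n\<ge>m. P n" by (meson trans_le_add1)
  qed
  have "(\<exists>\<^sub>\<infinity>n. \<rho> (map \<gamma> [0..<n]) = q) \<longleftrightarrow> (\<exists>\<^sub>\<infinity>n. \<rho> (v @ map \<beta> [0..<n]) = q)" for q
    by (subst shift[of _ "length v"]) (simp only: assms)
  then show ?thesis by (simp add: infinitely_often_def)
qed

lemma infinitely_often_eqD:
  "infinitely_often \<rho> \<beta> = {q} \<Longrightarrow> \<exists>m\<ge>N. \<rho> (map \<beta> [0..<m]) = q"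
  unfolding infinitely_often_def INFM_nat_le by blast

text \<open>An accepting run freed from the initial state and from the bound on states, so that it
  passes to subtrees and to lower levels in the inductions below.\<close>

definition good_run :: "('s \<Rightarrow> bool) \<Rightarrow> 's inf_tree \<Rightarrow> nat inf_tree \<Rightarrow> bool" where
  "good_run \<phi> t \<rho> \<longleftrightarrow> (\<forall>u. small_step \<phi> (\<rho> u) (t u) (\<rho> (u @ [Lft])) (\<rho> (u @ [Rgt]))) \<and>
     (\<forall>\<beta> j. infinitely_often \<rho> \<beta> \<noteq> {pre_state j})"

lemma good_run_subtree:
  assumes "good_run \<phi> t \<rho>" shows "good_run \<phi> (\<lambda>u. t (v @ u)) (\<lambda>u. \<rho> (v @ u))"
  unfolding good_run_def
proof (intro conjI allI)
  fix u show "small_step \<phi> (\<rho> (v @ u)) (t (v @ u)) (\<rho> (v @ u @ [Lft])) (\<rho> (v @ u @ [Rgt]))"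
    using assms unfolding good_run_def by (metis append_assoc)
next
  fix \<beta> j
  define \<gamma> where "\<gamma> i = (if i < length v then v ! i else \<beta> (i - length v))" for i
  have "map \<gamma> [0..<m + length v] = v @ map \<beta> [0..<m]" for m
    by (rule nth_equalityI) (auto simp: \<gamma>_def nth_append)
  from infinitely_often_append[OF this] show "infinitely_often (\<lambda>u. \<rho> (v @ u)) \<beta> \<noteq> {pre_state j}"
    using assms unfolding good_run_def by metis
qed

text \<open>Only acceptance forces the leftmost branch out of \<open>pre_state (Suc n)\<close>.
  After the switch it stays in \<open>post_state (Suc n)\<close> and starts a run of level
  \<open>n\<close> in every column, so all those slices are small by induction.\<close>

lemma good_run_imp_small:
  "good_run \<phi> t \<rho> \<Longrightarrow> \<rho> [] = pre_state n \<Longrightarrow> small n {as. \<phi> (t (node as))}"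
proof (induction n arbitrary: t \<rho>)
  case 0
  then show ?case unfolding good_run_def by (metis mem_Collect_eq node.simps(1) small.simps(1) small_step_simps(2))
next
  case (Suc n)
  let ?L = "\<lambda>j. replicate j Lft"
  have step: "small_step \<phi> (\<rho> (?L j)) (t (?L j)) (\<rho> (?L (Suc j))) (\<rho> (?L j @ [Rgt]))" for j
    using Suc.prems(1) unfolding good_run_def by (metis replicate_append_same replicate_Suc)
  have pp: "\<rho> (?L j) = pre_state (Suc n) \<or> \<rho> (?L j) = post_state (Suc n)" for j
  proof (induction j)
    case (Suc j)
    then show ?case using step[of j] by auto
  qed (use Suc.prems in simp)
  have "\<exists>k. \<rho> (?L k) = post_state (Suc n)"
  proof (rule ccontr)
    assume "\<not> ?thesis"
    then have "\<rho> (map (\<lambda>_. Lft) [0..<j]) = pre_state (Suc n)" for j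
      using pp by (simp add: map_replicate_const)
    then have "infinitely_often \<rho> (\<lambda>_. Lft) = {pre_state (Suc n)}"
      by (auto simp: infinitely_often_def)
    then show False using Suc.prems(1) unfolding good_run_def by blast
  qed
  then obtain k where k: "\<rho> (?L k) = post_state (Suc n)" ..
  have post: "\<rho> (?L j) = post_state (Suc n)" if "j \<ge> k" for j
    using that
  proof (induction j rule: dec_induct)
    case (step j)
    then show ?case using \<open>\<And>j. small_step \<phi> (\<rho> (?L j)) _ _ _\<close>[of j] by simp
  qed (rule k)
  have "small n {as. \<phi> (t ((?L j @ [Rgt]) @ node as))}" if "j \<ge> k" for j
    by (rule Suc.IH[OF good_run_subtree[OF Suc.prems(1)]]) (use step[of j] post[OF that] in simp)
  then show ?case by (auto simp: MOST_nat_le slice_def intro!: exI[of _ k])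
qed

lemma small_imp_good_run:
  "small n {as. \<phi> (t (node as))} \<Longrightarrow> \<exists>\<rho>. good_run \<phi> t \<rho> \<and> \<rho> [] = pre_state n"
proof (induction n arbitrary: t)
  case 0
  define \<rho> where "\<rho> u = (if u = [] then pre_state 0 else 0)" for u :: "dir list"
  have "infinitely_often \<rho> \<beta> \<noteq> {pre_state j}" for \<beta> j
    using infinitely_often_eqD[of \<rho> \<beta> "pre_state j" 1] by (auto simp: \<rho>_def)
  then have "good_run \<phi> t \<rho>" using 0 by (auto simp: good_run_def \<rho>_def)
  then show ?case by (auto simp: \<rho>_def)
next
  case (Suc n)
  let ?L = "\<lambda>j. replicate j Lft"
  obtain K where K: "\<And>j. j \<ge> K \<Longrightarrow> small n {as. \<phi> (t (?L j @ Rgt # node as))}"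
    using Suc.prems by (auto simp: MOST_nat_le slice_def)
  have "\<forall>j. \<exists>\<rho>. j > K \<longrightarrow> good_run \<phi> (\<lambda>u. t (?L j @ Rgt # u)) \<rho> \<and> \<rho> [] = pre_state n"
    using Suc.IH[OF K] by (metis less_imp_le)
  then obtain r where r: "\<And>j. j > K \<Longrightarrow> good_run \<phi> (\<lambda>u. t (?L j @ Rgt # u)) (r j)"
    and r0: "\<And>j. j > K \<Longrightarrow> r j [] = pre_state n" by metis
  \<comment> \<open>The spine changes state on the edge from depth \<open>K\<close> to depth
    \<open>K + 1\<close>. At depth \<open>K\<close> it is still in the pre-state, whose right child
    must be in state \<open>0\<close>; hence column \<open>K\<close> goes unchecked and subruns are
    needed only for \<open>j > K\<close>.\<close>
  define \<rho> where "\<rho> u = (case spine 0 u of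
      (j, None) \<Rightarrow> if j \<le> K then pre_state (Suc n) else post_state (Suc n)
    | (j, Some v) \<Rightarrow> if j \<le> K then 0 else r j v)" for u
  have \<rho>1: "\<rho> (?L j) = (if j \<le> K then pre_state (Suc n) else post_state (Suc n))" for j
    by (simp add: \<rho>_def)
  have \<rho>2: "\<rho> (?L j @ Rgt # v) = (if j \<le> K then 0 else r j v)" for j v
    by (simp add: \<rho>_def)
  have "small_step \<phi> (\<rho> u) (t u) (\<rho> (u @ [Lft])) (\<rho> (u @ [Rgt]))" for u
  proof (cases u rule: dir_list_cases)
    case (1 j)
    then have "u @ [Lft] = ?L (Suc j)" by (simp add: replicate_append_same)
    then show ?thesis using 1 r0[of j] \<rho>2[of j "[]"] by (simp only: \<rho>1) auto
  next
    case (2 j v)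
    then show ?thesis
      using r[of j] by (auto simp: \<rho>2 good_run_def)
  qed
  moreover have "infinitely_often \<rho> \<beta> \<noteq> {pre_state i}" for \<beta> i
  proof (cases "\<exists>j. \<beta> j = Rgt")
    case False
    then have "\<beta> = (\<lambda>_. Lft)" by (metis dir.exhaust)
    then show ?thesis
      using infinitely_often_eqD[of \<rho> \<beta> "pre_state i" "Suc K"] by (auto simp: map_replicate_const \<rho>1)
  next
    case True
    \<comment> \<open>A branch whose first right turn is at depth \<open>j\<close> is, up to a
      finite prefix, a branch of the run in column \<open>j\<close>.\<close>
    define j where "j = (LEAST j. \<beta> j = Rgt)"
    have j: "\<beta> j = Rgt" unfolding j_def by (rule LeastI_ex[OF True])
    have j': "\<beta> i = Lft" if "i < j" for i
      using not_less_Least[of i "\<lambda>j. \<beta> j = Rgt"] that unfolding j_def by (cases "\<beta> i") auto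
    define \<beta>' where "\<beta>' m = \<beta> (m + Suc j)" for m
    have "map \<beta> [0..<m + length (?L j @ [Rgt])] = (?L j @ [Rgt]) @ map \<beta>' [0..<m]" for m
      by (rule nth_equalityI) (auto simp: nth_append nth_Cons' \<beta>'_def j j' not_less less_Suc_eq le_eq_less_or_eq simp del: upt_Suc
          intro!: arg_cong[of _ _ \<beta>])
    from infinitely_often_append[OF this, of \<rho>]
    have eq: "infinitely_often \<rho> \<beta> = infinitely_often (\<lambda>u. if j \<le> K then 0 else r j u) \<beta>'"
      by (simp add: \<rho>2)
    show ?thesis
    proof (cases "j \<le> K")
      case True
      then show ?thesis unfolding eq using infinitely_often_eqD[of "\<lambda>_. 0" \<beta>' "pre_state i" 0] by auto
    next
      case False
      then show ?thesis unfolding eq using r[of j] by (simp add: good_run_def)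
    qed
  qed
  ultimately have "good_run \<phi> t \<rho>" by (simp add: good_run_def)
  moreover have "\<rho> [] = pre_state (Suc n)" using \<rho>1[of 0] by simp
  ultimately show ?case by blast
qed

lemma language_small_automaton:
  "language (small_automaton n \<Sigma> \<phi>) = {t. (\<forall>u. t u \<in> \<Sigma>) \<and> small n {as. \<phi> (t (node as))}}"
proof -
  have "(\<exists>\<rho>. accepting_run (small_automaton n \<Sigma> \<phi>) t \<rho>) \<longleftrightarrow> (\<exists>\<rho>. good_run \<phi> t \<rho> \<and> \<rho> [] = pre_state n)"
    if t: "\<And>u. t u \<in> \<Sigma>" for t
  proof (intro iff_exI iffI)
    fix \<rho> assume "accepting_run (small_automaton n \<Sigma> \<phi>) t \<rho>"
    then show "good_run \<phi> t \<rho> \<and> \<rho> [] = pre_state n"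
      by (simp add: accepting_run_def is_run_def small_automaton_def good_run_def)
  next
    fix \<rho> assume \<rho>: "good_run \<phi> t \<rho> \<and> \<rho> [] = pre_state n"
    have b: "\<rho> u \<le> post_state n" for u
    proof (induction u rule: rev_induct)
      case (snoc d u)
      then show ?case using \<rho> small_step_bound[of \<phi> "\<rho> u" "t u" "\<rho> (u @ [Lft])" "\<rho> (u @ [Rgt])" n]
        by (cases d) (auto simp: good_run_def)
    qed (use \<rho> in \<open>simp add: pre_state_def post_state_def\<close>)
    moreover have "infinitely_often \<rho> \<beta> \<subseteq> {..post_state n}" for \<beta>
      unfolding infinitely_often_def using b by (auto dest!: INFM_EX)
    ultimately show "accepting_run (small_automaton n \<Sigma> \<phi>) t \<rho>"
      using \<rho> t by (simp add: accepting_run_def is_run_def small_automaton_def good_run_def)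
  qed
  moreover have "(\<exists>\<rho>. good_run \<phi> t \<rho> \<and> \<rho> [] = pre_state n) \<longleftrightarrow> small n {as. \<phi> (t (node as))}" for t
    using good_run_imp_small small_imp_good_run by blast
  ultimately show ?thesis
    by (auto simp: language_def) (auto simp: small_automaton_def)
qed

section \<open>From automata to a tree-automatic presentation\<close>

text \<open>A presentation is determined by its decoding map \<open>h\<close>: if the automata
  recognise the kernel of \<open>h\<close> and the preimages of the relations, compatibility is
  automatic and the isomorphism is \<open>h\<close> factored through its kernel.\<close>

lemma omega_tree_automaticI:
  fixes A :: "(nat, nat) tree_automaton" and Aeq :: "(nat, nat list) tree_automaton"
    and As :: "(nat, nat list) tree_automaton list" and h :: "nat inf_tree \<Rightarrow> 'a"
  assumes A: "muller_automaton A" "muller_automaton Aeq" "\<forall>C\<in>set As. muller_automaton C"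
    "alphabet Aeq = tuples 2 (alphabet A)" and len: "length As = length (relations M)"
    and al: "\<forall>i<length As. alphabet (As ! i) = tuples (fst (relations M ! i)) (alphabet A)"
    and surj: "h ` language A = universe M"
    and eq: "\<And>s t. [s, t] \<in> recognized_relation 2 Aeq \<longleftrightarrow> s \<in> language A \<and> t \<in> language A \<and> h s = h t"
    and rel: "\<And>i ts. i < length As \<Longrightarrow> ts \<in> recognized_relation (fst (relations M ! i)) (As ! i) \<longleftrightarrow>
        ts \<in> tuples (fst (relations M ! i)) (language A) \<and> map h ts \<in> snd (relations M ! i)"
  shows "omega_tree_automatic M"
proof -
  let ?L = "language A"
  define E where "E = {(s, t). [s, t] \<in> recognized_relation 2 Aeq}"
  define Rs where "Rs = map2 (\<lambda>R C. (fst R, recognized_relation (fst R) C)) (relations M) As"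
  have E: "(s, t) \<in> E \<longleftrightarrow> s \<in> ?L \<and> t \<in> ?L \<and> h s = h t" for s t
    by (simp add: E_def eq)
  have equiv: "equiv ?L E"
    by (rule equivI) (auto simp: E refl_on_def sym_def trans_def)
  define g where "g c = h (SOME t. t \<in> c)" for c
  have g: "g (E `` {t}) = h t" if "t \<in> ?L" for t
  proof -
    have t: "t \<in> E `` {t}" using that by (simp add: E)
    obtain s where s: "s = (SOME s. s \<in> E `` {t})" "s \<in> E `` {t}" using someI[of "\<lambda>s. s \<in> E `` {t}" t, OF t] by blast
    have "h s = h t" using s(2) by (simp add: E)
    then show ?thesis by (simp only: g_def s(1))
  qed
  let ?Q = "quotient_structure \<lparr>universe = ?L, relations = Rs\<rparr> E"
  have Rs_nth: "Rs ! i = (fst (relations M ! i), recognized_relation (fst (relations M ! i)) (As ! i))"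
    if "i < length As" for i using that len by (simp add: Rs_def)
  have lenRs: "length Rs = length As" using len by (simp add: Rs_def)
  have "R \<subseteq> tuples k ?L \<and> compatible E R" if kR: "(k, R) \<in> set Rs" for k R
  proof -
    obtain i where i: "i < length As" "Rs ! i = (k, R)"
      using kR lenRs by (metis in_set_conv_nth)
    then have R: "ts \<in> R \<longleftrightarrow> ts \<in> tuples k ?L \<and> map h ts \<in> snd (relations M ! i)" for ts
      using rel[of i ts] Rs_nth[of i] by auto
    have "ys \<in> R" if l: "list_all2 (\<lambda>x y. (x, y) \<in> E) xs ys" and xs: "xs \<in> R" for xs ys
    proof -
      have "map h xs = map h ys" "set ys \<subseteq> ?L" "length xs = length ys"
        using l by (auto simp: list_all2_conv_all_nth E in_set_conv_nth intro: nth_equalityI)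
      then show ?thesis using xs R by (auto simp: tuples_def)
    qed
    then show ?thesis using R by (auto simp: compatible_def)
  qed
  then have comp: "\<forall>(k, R)\<in>set Rs. R \<subseteq> tuples k ?L \<and> compatible E R" by auto
  have iso: "structure_iso g ?Q M"
    unfolding structure_iso_def
  proof (intro conjI allI impI ballI)
    show "bij_betw g (universe ?Q) (universe M)"
      unfolding bij_betw_def
    proof
      show "inj_on g (universe ?Q)"
      proof (rule inj_onI)
        fix c d assume "c \<in> universe ?Q" "d \<in> universe ?Q" and gg: "g c = g d"
        then obtain s t where st: "s \<in> ?L" "c = E `` {s}" "t \<in> ?L" "d = E `` {t}"
          by (auto simp: quotient_structure_def quotient_def)
        then have "(s, t) \<in> E" using gg g E by simp
        then show "c = d" using st equiv_class_eq[OF equiv] by simp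
      qed
      have "universe ?Q = (\<lambda>t. E `` {t}) ` ?L"
        by (auto simp: quotient_structure_def quotient_def)
      then show "g ` universe ?Q = universe M"
        using g surj by (simp add: image_image)
    qed
    show "map fst (relations ?Q) = map fst (relations M)"
      by (rule nth_equalityI) (auto simp: quotient_structure_def Rs_def len split_beta)
  next
    fix i xs assume i: "i < length (relations ?Q)" and xs: "xs \<in> tuples (fst (relations ?Q ! i)) (universe ?Q)"
    let ?k = "fst (relations M ! i)"
    have i': "i < length As" using i lenRs by (simp add: quotient_structure_def)
    have Qi: "relations ?Q ! i = (?k, map (\<lambda>x. E `` {x}) ` recognized_relation ?k (As ! i))"
      using Rs_nth[OF i'] lenRs i' by (simp add: quotient_structure_def)
    have "\<forall>x\<in>set xs. \<exists>t. t \<in> ?L \<and> x = E `` {t}"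
      using xs by (auto simp: tuples_def quotient_structure_def quotient_def)
    then obtain f where f: "\<And>x. x \<in> set xs \<Longrightarrow> f x \<in> ?L \<and> x = E `` {f x}" by metis
    let ?ts = "map f xs"
    have xs_eq: "xs = map (\<lambda>t. E `` {t}) ?ts"
      by (rule nth_equalityI) (use f in \<open>auto simp: in_set_conv_nth\<close>)
    have ts: "?ts \<in> tuples ?k ?L" using f xs Qi by (auto simp: tuples_def)
    have gm: "map g (map (\<lambda>t. E `` {t}) ts) = map h ts" if "ts \<in> tuples ?k ?L" for ts
      using that g by (auto simp: tuples_def)
    show "xs \<in> snd (relations ?Q ! i) \<longleftrightarrow> map g xs \<in> snd (relations M ! i)"
    proof
      assume "xs \<in> snd (relations ?Q ! i)"
      then obtain ts' where "ts' \<in> recognized_relation ?k (As ! i)" "xs = map (\<lambda>t. E `` {t}) ts'"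
        using Qi by auto
      then show "map g xs \<in> snd (relations M ! i)" using rel[OF i'] gm by metis
    next
      assume "map g xs \<in> snd (relations M ! i)"
      then have "?ts \<in> recognized_relation ?k (As ! i)" using rel[OF i'] gm[OF ts] ts xs_eq by metis
      then show "xs \<in> snd (relations ?Q ! i)" unfolding Qi snd_conv by (subst xs_eq) (rule imageI)
    qed
  qed
  have gb: "\<forall>t\<in>?L. g (E `` {t}) = h t" using g by blast
  show ?thesis
    unfolding omega_tree_automatic_def
    by (intro exI[of _ A] exI[of _ Aeq] exI[of _ As] exI[of _ h] exI[of _ E] exI[of _ Rs] exI[of _ g] conjI)
      (fact A len al E_def equiv Rs_def comp surj iso gb)+
qed

definition decode :: "nat \<Rightarrow> nat inf_tree \<Rightarrow> nat list set" where
  "decode n t = {as \<in> lists_of_length n. t (node as) = 1}"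

text \<open>Each relation says that a Boolean combination of its arguments lies in the ideal; for
  the graph of meet, \<open>X \<inter> Y\<close> and \<open>Z\<close> differ by a small set. So the
  automata differ only in the letter predicate, which marks the tuples at which the identity
  fails.\<close>

lemma omega_tree_automatic_omega_algebra:
  assumes n: "n \<ge> 1"
  shows "omega_tree_automatic (ba_structure (omega_algebra n))"
proof -
  interpret powerset_ideal "lists_of_length n" "omega_ideal n" by (rule powerset_ideal_omega[OF n])
  define aut where "aut k \<phi> = small_automaton n (tuples k {0, 1}) \<phi>" for k and \<phi> :: "nat list \<Rightarrow> bool"
  define bits where "bits = {t :: nat inf_tree. \<forall>u. t u \<in> {0, 1}}"
  have mul: "muller_automaton (aut k \<phi>)" and alph: "alphabet (aut k \<phi>) = tuples k {0, 1}" for k \<phi>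
  proof -
    have "finite (tuples k {0, 1 :: nat})"
      using finite_lists_length_eq[of "{0, 1 :: nat}" k] by (simp add: tuples_def conj_commute)
    then show "muller_automaton (aut k \<phi>)" unfolding aut_def by (rule muller_small_automaton)
    show "alphabet (aut k \<phi>) = tuples k {0, 1}" by (simp add: aut_def small_automaton_def)
  qed
  have rec: "ts \<in> recognized_relation k (aut k \<phi>) \<longleftrightarrow> ts \<in> tuples k bits \<and>
      {as \<in> lists_of_length n. \<phi> (map (\<lambda>t. t (node as)) ts)} \<in> omega_ideal n" for ts k \<phi>
  proof -
    have "small n {as. \<phi> (map (\<lambda>t. t (node as)) ts)} \<longleftrightarrow>
        small n {as \<in> lists_of_length n. \<phi> (map (\<lambda>t. t (node as)) ts)}"
      by (rule small_cong) (simp add: lists_of_length_def)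
    also have "\<dots> \<longleftrightarrow> {as \<in> lists_of_length n. \<phi> (map (\<lambda>t. t (node as)) ts)} \<in> omega_ideal n"
      using n by (auto simp: mem_omega_ideal_iff)
    finally have *: "small n {as. \<phi> (map (\<lambda>t. t (node as)) ts)} \<longleftrightarrow>
        {as \<in> lists_of_length n. \<phi> (map (\<lambda>t. t (node as)) ts)} \<in> omega_ideal n" .
    have "(\<forall>u. map (\<lambda>t. t u) ts \<in> tuples k {0, 1}) \<longleftrightarrow> ts \<in> tuples k bits"
      unfolding tuples_def bits_def subset_iff by force
    moreover have "ts \<in> tuples k bits \<Longrightarrow> length ts = k" by (simp add: tuples_def)
    ultimately show ?thesis using *
      unfolding recognized_relation_def aut_def language_small_automaton convolution_def by auto
  qed
  have sub [simp]: "decode n t \<subseteq> lists_of_length n" for t by (auto simp: decode_def)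
  define h where "h t = cls (decode n t)" for t
  let ?B = "omega_algebra n"
  \<comment> \<open>A predicate that marks nothing yields the empty set, which is small, so every
    tree over \<open>{0, 1}\<close> is accepted.\<close>
  define A where "A = small_automaton n {0, 1 :: nat} (\<lambda>_. False)"
  have LA: "language A = bits"
    by (auto simp: A_def language_small_automaton bits_def)
  have alA: "alphabet A = {0, 1}" and mulA: "muller_automaton A"
    unfolding A_def by (simp add: small_automaton_def) (simp add: muller_small_automaton)
  have hB: "h t \<in> ba_carrier ?B" for t by (simp add: h_def omega_algebra_eq)
  have surj: "h ` bits = ba_carrier ?B"
  proof safe
    fix x assume "x \<in> ba_carrier ?B"
    then obtain X where X: "X \<subseteq> lists_of_length n" "x = cls X"
      unfolding omega_algebra_eq by (elim carrier_cases)
    define t where "t u = (if u \<in> node ` X then 1 else 0 :: nat)" for u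
    have "node as \<in> node ` X \<longleftrightarrow> as \<in> X" for as by (simp add: inj_image_mem_iff inj_node)
    then have "decode n t = X" using X by (auto simp: decode_def t_def)
    then show "x \<in> h ` bits" using X by (intro image_eqI[of _ _ t]) (auto simp: h_def bits_def t_def)
  qed (rule hB)
  have bit: "t u = 0 \<or> t u = 1" if "t \<in> bits" for t u using that by (auto simp: bits_def)
  \<comment> \<open>Violations of meet, join, complement, zero and one, in the order of the
    relations of \<open>ba_structure\<close>.\<close>
  define \<phi>s :: "(nat list \<Rightarrow> bool) list" where "\<phi>s =
    [\<lambda>a. (a ! 0 = 1 \<and> a ! 1 = 1) \<noteq> (a ! 2 = 1), \<lambda>a. (a ! 0 = 1 \<or> a ! 1 = 1) \<noteq> (a ! 2 = 1),
     \<lambda>a. (a ! 0 = 1) = (a ! 1 = 1), \<lambda>a. a ! 0 = 1, \<lambda>a. a ! 0 \<noteq> 1]"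
  define ks :: "nat list" where "ks = [3, 3, 2, 1, 1]"
  show ?thesis
  proof (rule omega_tree_automaticI[where A = A and Aeq = "aut 2 (\<lambda>a. a ! 0 \<noteq> a ! 1)" and h = h
        and As = "map2 aut ks \<phi>s"])
    show "[s, t] \<in> recognized_relation 2 (aut 2 (\<lambda>a. a ! 0 \<noteq> a ! 1)) \<longleftrightarrow>
        s \<in> language A \<and> t \<in> language A \<and> h s = h t" for s t
    proof -
      have "{as \<in> lists_of_length n. s (node as) \<noteq> t (node as)} = sym_diff (decode n s) (decode n t)"
        if "s \<in> bits" "t \<in> bits"
        using bit[OF that(1)] bit[OF that(2)] by (auto simp: decode_def) (metis zero_neq_one)+
      then show ?thesis by (auto simp: rec LA h_def cls_eq_iff tuples_def)
    qed
    fix i ts assume i: "i < length (map2 aut ks \<phi>s)"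
    let ?k = "fst (relations (ba_structure ?B) ! i)"
    have key: "{as \<in> lists_of_length n. (\<phi>s ! i) (map (\<lambda>t. t (node as)) ts)} \<in> omega_ideal n \<longleftrightarrow>
      map h ts \<in> snd (relations (ba_structure ?B) ! i)" if ts: "ts \<in> tuples ?k bits"
    proof -
      have rel: "\<exists>t1 t2 t3. ts = [t1, t2, t3] \<and> t1 \<in> bits \<and> t2 \<in> bits \<and> t3 \<in> bits" if "?k = 3"
        using ts that by (auto simp: tuples_def length_Suc_conv numeral_eq_Suc)
      have rel2: "\<exists>t1 t2. ts = [t1, t2] \<and> t1 \<in> bits \<and> t2 \<in> bits" if "?k = 2"
        using ts that by (auto simp: tuples_def length_Suc_conv numeral_eq_Suc)
      have rel1: "\<exists>t1. ts = [t1] \<and> t1 \<in> bits" if "?k = 1"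
        using ts that by (auto simp: tuples_def length_Suc_conv)
      have cI: "x = y \<Longrightarrow> x \<in> omega_ideal n \<longleftrightarrow> y \<in> omega_ideal n" for x y by simp
      have int [simp]: "decode n s \<inter> decode n t \<subseteq> lists_of_length n" for s t by (auto simp: decode_def)
      consider "i = 0" | "i = 1" | "i = 2" | "i = 3" | "i = 4"
        using i by (auto simp: ks_def \<phi>s_def less_Suc_eq numeral_eq_Suc)
      then show ?thesis
      proof cases
        case 1
        then obtain t1 t2 t3 where "ts = [t1, t2, t3]" using rel by (auto simp: ba_structure_def)
        then have "map h ts \<in> snd (relations (ba_structure ?B) ! i) \<longleftrightarrow>
            sym_diff (decode n t1 \<inter> decode n t2) (decode n t3) \<in> omega_ideal n"
          using 1 hB by (auto simp: ba_structure_def omega_algebra_eq h_def cls_eq_iff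
              eq_commute[of "cls (decode n t3)"])
        then show ?thesis using 1 \<open>ts = _\<close>
          by (simp add: \<phi>s_def) (rule cI, auto simp: decode_def)
      next
        case 2
        then obtain t1 t2 t3 where "ts = [t1, t2, t3]" using rel by (auto simp: ba_structure_def)
        then have "map h ts \<in> snd (relations (ba_structure ?B) ! i) \<longleftrightarrow>
            sym_diff (decode n t1 \<union> decode n t2) (decode n t3) \<in> omega_ideal n"
          using 2 hB by (auto simp: ba_structure_def omega_algebra_eq h_def cls_eq_iff
              eq_commute[of "cls (decode n t3)"])
        then show ?thesis using 2 \<open>ts = _\<close>
          by (simp add: \<phi>s_def) (rule cI, auto simp: decode_def)
      next
        case 3
        then obtain t1 t2 where "ts = [t1, t2]" using rel2 by (auto simp: ba_structure_def)
        then have "map h ts \<in> snd (relations (ba_structure ?B) ! i) \<longleftrightarrow>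
            sym_diff (lists_of_length n - decode n t1) (decode n t2) \<in> omega_ideal n"
          using 3 hB by (auto simp: ba_structure_def omega_algebra_eq h_def cls_eq_iff
              eq_commute[of "cls (decode n t2)"])
        then show ?thesis using 3 \<open>ts = _\<close>
          by (simp add: \<phi>s_def) (rule cI, auto simp: decode_def)
      next
        case 4
        then obtain t1 where "ts = [t1]" using rel1 by (auto simp: ba_structure_def)
        then have "map h ts \<in> snd (relations (ba_structure ?B) ! i) \<longleftrightarrow> decode n t1 \<in> omega_ideal n"
          using 4 by (simp add: ba_structure_def omega_algebra_eq h_def cls_eq_zero_iff)
        then show ?thesis using 4 \<open>ts = _\<close>
          by (simp add: \<phi>s_def) (rule cI, auto simp: decode_def)
      next
        case 5
        then obtain t1 where "ts = [t1]" using rel1 by (auto simp: ba_structure_def)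
        then have "map h ts \<in> snd (relations (ba_structure ?B) ! i) \<longleftrightarrow>
            sym_diff (decode n t1) (lists_of_length n) \<in> omega_ideal n"
          using 5 by (simp add: ba_structure_def omega_algebra_eq h_def one_eq cls_eq_iff)
        then show ?thesis using 5 \<open>ts = _\<close>
          by (simp add: \<phi>s_def) (rule cI, auto simp: decode_def)
      qed
    qed
    have "map2 aut ks \<phi>s ! i = aut ?k (\<phi>s ! i)"
      using i by (auto simp: ks_def \<phi>s_def ba_structure_def less_Suc_eq numeral_eq_Suc)
    then show "ts \<in> recognized_relation ?k (map2 aut ks \<phi>s ! i) \<longleftrightarrow>
        ts \<in> tuples ?k (language A) \<and> map h ts \<in> snd (relations (ba_structure ?B) ! i)"
      using key by (auto simp: rec LA)
  qed (use mul alph surj LA alA mulA in \<open>auto simp: ks_def \<phi>s_def ba_structure_def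
      less_Suc_eq numeral_eq_Suc\<close>)
qed

section \<open>Saturation and isomorphisms under CH\<close>

lemma not_small_columns: "\<not> small (Suc n) X \<Longrightarrow> \<exists>j>m. \<not> small n (slice j X)"
  by (auto simp: MOST_nat not_less)

text \<open>
  Every requirement is met in infinitely many columns, and each column serves a single one of
  them: in the columns from \<open>c t\<close> up to \<open>c (Suc t)\<close> the set \<open>C\<close> is either the union of the first \<open>U i\<close>
  or the complement of the first \<open>V i\<close>, whichever suits requirement \<open>task t\<close>.
\<close>

lemma saturation:
  fixes U V a :: "nat \<Rightarrow> nat list set"
  assumes disj: "\<And>i j. small (Suc n) (U i \<inter> V j)"
  shows "\<exists>C. (\<forall>i. small (Suc n) (U i - C)) \<and> (\<forall>i. small (Suc n) (V i \<inter> C)) \<and>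
    (\<forall>i. (\<forall>k. \<not> small (Suc n) (a i - (\<Union>j\<le>k. U j))) \<longrightarrow> \<not> small (Suc n) (a i - C)) \<and>
    (\<forall>i. (\<forall>k. \<not> small (Suc n) (a i - (\<Union>j\<le>k. V j))) \<longrightarrow> \<not> small (Suc n) (a i \<inter> C))"
proof -
  \<comment> \<open>Every task number occurs at infinitely many stages \<open>t\<close>;
    \<open>2 * i\<close> stands for the requirement on \<open>a i - C\<close> and
    \<open>2 * i + 1\<close> for the one on \<open>a i \<inter> C\<close>.\<close>
  define task where "task t = fst (prod_decode t)" for t
  define W where "W t = (if even (task t) then U else V)" for t
  \<comment> \<open>From column \<open>j\<close> on, the first sets of both lists are disjoint up to
    small sets, and column \<open>j\<close> itself can serve the task of stage \<open>t\<close>. A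
    task whose hypothesis fails asks for nothing.\<close>
  define Q where "Q t j \<longleftrightarrow> (\<forall>j'\<ge>j. \<forall>i\<le>t. \<forall>i'\<le>t. small n (slice j' (U i \<inter> V i'))) \<and>
    ((\<forall>k. \<not> small (Suc n) (a (task t div 2) - (\<Union>i\<le>k. W t i))) \<longrightarrow>
        \<not> small n (slice j (a (task t div 2) - (\<Union>i\<le>t. W t i))))" for t j
  have Q: "\<exists>j>m. Q t j" for t m
  proof -
    have "\<forall>\<^sub>\<infinity>j. small n (slice j (U i \<inter> V i'))" for i i'
      using disj[of i i'] by simp
    then have "\<forall>\<^sub>\<infinity>j. \<forall>i\<in>{..t}. \<forall>i'\<in>{..t}. small n (slice j (U i \<inter> V i'))"
      by (intro eventually_ball_finite ballI) auto
    then obtain J where J: "\<And>j i i'. j \<ge> J \<Longrightarrow> i \<le> t \<Longrightarrow> i' \<le> t \<Longrightarrow> small n (slice j (U i \<inter> V i'))"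
      unfolding MOST_nat_le by (metis atMost_iff)
    show ?thesis
    proof (cases "\<forall>k. \<not> small (Suc n) (a (task t div 2) - (\<Union>i\<le>k. W t i))")
      case True
      then obtain j where "j > max m J" "\<not> small n (slice j (a (task t div 2) - (\<Union>i\<le>t. W t i)))"
        using not_small_columns by blast
      then show ?thesis using J unfolding Q_def by (intro exI[of _ j]) auto
    next
      case False
      then show ?thesis using J unfolding Q_def
        by (intro exI[of _ "Suc (max m J)"]) (auto simp del: small.simps)
    qed
  qed
  have "\<exists>c. \<forall>t. Q t (c t) \<and> c t < c (Suc t)"
    by (rule dependent_nat_choice) (use Q in blast)+
  then obtain c where c: "\<And>t. Q t (c t)" and "\<And>t. c t < c (Suc t)" by blast
  then have mono: "strict_mono c" by (simp add: strict_mono_Suc_iff)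
  \<comment> \<open>The stage in charge of column \<open>j\<close>:
    \<open>c (st j) \<le> j < c (Suc (st j))\<close> once \<open>c 0 \<le> j\<close>. The finitely
    many columns before \<open>c 0\<close> do not affect smallness.\<close>
  define st where "st j = (LEAST t. j < c (Suc t))" for j
  have st: "j < c (Suc (st j))" for j
    unfolding st_def
    by (rule LeastI[of _ j]) (use strict_mono_imp_increasing[OF mono, of "Suc j"] in simp)
  have st_ge: "k \<le> st j" if "c k \<le> j" for k j
  proof (rule ccontr)
    assume "\<not> k \<le> st j"
    then have "c (Suc (st j)) \<le> c k" using mono by (simp add: strict_mono_less_eq)
    then show False using st[of j] that by simp
  qed
  have st_c: "st (c t) = t" for t
    using st_ge[of t "c t"] mono by (auto simp: st_def strict_mono_less intro!: antisym Least_le)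
  have c_st: "c (st j) \<le> j" if "c 0 \<le> j" for j
  proof (cases "st j")
    case (Suc s)
    then have "\<not> j < c (Suc s)" using not_less_Least[of s "\<lambda>t. j < c (Suc t)"] by (simp add: st_def)
    then show ?thesis using Suc by simp
  qed (use that in simp)
  define C where "C = {xs. if even (task (st (hd xs))) then xs \<in> (\<Union>i\<le>st (hd xs). U i)
      else xs \<notin> (\<Union>i\<le>st (hd xs). V i)}"
  have slC: "slice j C = (if even (task (st j)) then (\<Union>i\<le>st j. slice j (U i))
      else - (\<Union>i\<le>st j. slice j (V i)))" for j
    by (auto simp: C_def)
  have UV: "small n (slice j (U i) \<inter> slice j (V i'))" if "c 0 \<le> j" "i \<le> st j" "i' \<le> st j" for i i' j
    using c[of "st j"] c_st[of j] that unfolding Q_def by simp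
  have "small (Suc n) (U i - C)" for i
  proof -
    have "small n (slice j (U i - C))" if "j \<ge> c i" for j
    proof -
      have j: "i \<le> st j" "c 0 \<le> j" using st_ge that mono by (auto simp: strict_mono_less_eq intro: order_trans[of "c 0" "c i"])
      have "slice j (U i - C) \<subseteq> (\<Union>i'\<in>{..st j}. slice j (U i) \<inter> slice j (V i'))"
        using j by (auto simp: slC split: if_splits)
      moreover have "small n (\<Union>i'\<in>{..st j}. slice j (U i) \<inter> slice j (V i'))"
        using UV j by (subst small_UN_finite) auto
      ultimately show ?thesis using small_mono by blast
    qed
    then show ?thesis unfolding small.simps MOST_nat_le by blast
  qed
  moreover have "small (Suc n) (V i \<inter> C)" for i
  proof -
    have "small n (slice j (V i \<inter> C))" if "j \<ge> c i" for j
    proof -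
      have j: "i \<le> st j" "c 0 \<le> j" using st_ge that mono by (auto simp: strict_mono_less_eq intro: order_trans[of "c 0" "c i"])
      have "slice j (V i \<inter> C) \<subseteq> (\<Union>i'\<in>{..st j}. slice j (U i') \<inter> slice j (V i))"
        using j by (auto simp: slC split: if_splits)
      moreover have "small n (\<Union>i'\<in>{..st j}. slice j (U i') \<inter> slice j (V i))"
        using UV j by (subst small_UN_finite) auto
      ultimately show ?thesis using small_mono by blast
    qed
    then show ?thesis unfolding small.simps MOST_nat_le by blast
  qed
  \<comment> \<open>One non-small slice for each stage with task \<open>p\<close> is enough, since
    the stages \<open>prod_encode (p, q)\<close> give infinitely many columns.\<close>
  moreover have "\<not> small (Suc n) X"
    if X: "\<And>t. task t = p \<Longrightarrow> \<not> small n (slice (c t) X)" for X p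
  proof -
    let ?f = "\<lambda>q. c (prod_encode (p, q))"
    have "inj ?f"
      using mono by (auto simp: inj_def strict_mono_eq)
    then have "infinite (range ?f)" by (rule range_inj_infinite)
    moreover have "range ?f \<subseteq> {j. \<not> small n (slice j X)}"
      using X by (auto simp: task_def)
    ultimately show ?thesis by (auto simp: eventually_cofinite dest: infinite_super)
  qed
  note inf = this
  have "\<not> small (Suc n) (a i - C)" if "\<forall>k. \<not> small (Suc n) (a i - (\<Union>j\<le>k. U j))" for i
  proof (rule inf[of "2 * i"])
    fix t assume "task t = 2 * i"
    then show "\<not> small n (slice (c t) (a i - C))"
      using c[of t] that slC[of "c t"] by (auto simp: Q_def st_c W_def)
  qed
  moreover have "\<not> small (Suc n) (a i \<inter> C)" if "\<forall>k. \<not> small (Suc n) (a i - (\<Union>j\<le>k. V j))" for i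
  proof (rule inf[of "2 * i + 1"])
    fix t assume "task t = 2 * i + 1"
    moreover from this have "slice (c t) (a i \<inter> C) = slice (c t) (a i - (\<Union>j\<le>t. V j))"
      using slC[of "c t"] by (auto simp: st_c)
    ultimately show "\<not> small n (slice (c t) (a i \<inter> C))"
      using c[of t] that by (simp add: Q_def W_def del: small.simps slice_simps)
  qed
  ultimately show ?thesis by blast
qed

section \<open>Back-and-forth with partial isomorphisms\<close>

text \<open>Representatives are related, so a set may have several partners. Preservation of
  smallness makes this an isomorphism between the subalgebras formed by the classes of its domain
  and of its range.\<close>

definition partial_iso :: "nat \<Rightarrow> nat \<Rightarrow> (nat list set \<times> nat list set) set \<Rightarrow> bool" where
  "partial_iso m n G \<longleftrightarrow> ({}, {}) \<in> G \<and>
     (\<forall>X Y. (X, Y) \<in> G \<longrightarrow> (- X, - Y) \<in> G \<and> (small m X \<longleftrightarrow> small n Y)) \<and>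
     (\<forall>X Y X' Y'. (X, Y) \<in> G \<longrightarrow> (X', Y') \<in> G \<longrightarrow> (X \<union> X', Y \<union> Y') \<in> G)"

lemma partial_isoD:
  assumes "partial_iso m n G"
  shows "({}, {}) \<in> G" "(UNIV, UNIV) \<in> G" "(X, Y) \<in> G \<Longrightarrow> (- X, - Y) \<in> G"
    "(X, Y) \<in> G \<Longrightarrow> small m X \<longleftrightarrow> small n Y"
    "(X, Y) \<in> G \<Longrightarrow> (X', Y') \<in> G \<Longrightarrow> (X \<union> X', Y \<union> Y') \<in> G"
    "(X, Y) \<in> G \<Longrightarrow> (X', Y') \<in> G \<Longrightarrow> (X \<inter> X', Y \<inter> Y') \<in> G"
    "(X, Y) \<in> G \<Longrightarrow> (X', Y') \<in> G \<Longrightarrow> (X - X', Y - Y') \<in> G"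
proof -
  show 1: "({}, {}) \<in> G" using assms by (simp add: partial_iso_def)
  show 2: "(X, Y) \<in> G \<Longrightarrow> (- X, - Y) \<in> G" for X Y using assms by (simp add: partial_iso_def)
  show 3: "(X, Y) \<in> G \<Longrightarrow> (X', Y') \<in> G \<Longrightarrow> (X \<union> X', Y \<union> Y') \<in> G" for X Y X' Y'
    using assms by (simp add: partial_iso_def)
  show "(UNIV, UNIV) \<in> G" using 2[OF 1] by simp
  show 4: "(X, Y) \<in> G \<Longrightarrow> (X', Y') \<in> G \<Longrightarrow> (X \<inter> X', Y \<inter> Y') \<in> G" for X Y X' Y'
    using 2[OF 3[OF 2 2], of X Y X' Y'] by simp
  show "(X, Y) \<in> G \<Longrightarrow> (X', Y') \<in> G \<Longrightarrow> (X - X', Y - Y') \<in> G"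
    using 4[OF _ 2, of X Y X' Y'] by (simp add: Diff_eq)
  show "(X, Y) \<in> G \<Longrightarrow> small m X \<longleftrightarrow> small n Y" using assms by (simp add: partial_iso_def)
qed

lemma partial_iso_converse: "partial_iso m n G \<Longrightarrow> partial_iso n m (G\<inverse>)"
  unfolding partial_iso_def by auto

lemma partial_iso_UN:
  assumes G: "partial_iso m n G" and u: "\<And>i. u i \<in> G"
  shows "((\<Union>j\<le>k. fst (u j)), (\<Union>j\<le>(k::nat). snd (u j))) \<in> G"
proof (induction k)
  case 0
  then show ?case using u[of 0] by simp
next
  case (Suc k)
  then show ?case using partial_isoD(5)[OF G Suc, of "fst (u (Suc k))" "snd (u (Suc k))"] u[of "Suc k"]
    by (simp add: atMost_Suc Un_commute)
qed

text \<open>The partner \<open>C\<close> of \<open>B\<close> must make \<open>Y - C\<close> small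
  exactly if \<open>X - B\<close> is, and \<open>Y \<inter> C\<close> exactly if
  \<open>X \<inter> B\<close> is, for every pair of \<open>G\<close>. These are countably many
  conditions: \<open>C\<close> covers the partners of the sets almost inside \<open>B\<close>,
  avoids the partners of those almost disjoint from \<open>B\<close>, and covers or avoids no
  others. Saturation of the target side provides it.\<close>

lemma partial_iso_extend:
  assumes G: "partial_iso m (Suc n) G" and cnt: "countable G"
  shows "\<exists>G'. G \<subseteq> G' \<and> countable G' \<and> partial_iso m (Suc n) G' \<and> B \<in> Domain G'"
proof -
  note G' = partial_isoD[OF G]
  define J1 where "J1 = {p \<in> G. small m (fst p - B)}"
  define J2 where "J2 = {p \<in> G. small m (fst p \<inter> B)}"
  have ne: "J1 \<noteq> {}" "J2 \<noteq> {}" "G \<noteq> {}" and cn: "countable J1" "countable J2"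
    using G'(1) cnt by (force simp: J1_def J2_def)+
  define u v p where "u = from_nat_into J1" and "v = from_nat_into J2" and "p = from_nat_into G"
  have ru: "range u = J1" and rv: "range v = J2" and rp: "range p = G"
    unfolding u_def v_def p_def using ne cn cnt by (simp_all add: range_from_nat_into)
  have u: "u i \<in> G" "small m (fst (u i) - B)" for i using ru by (auto simp: J1_def)
  have v: "v i \<in> G" "small m (fst (v i) \<inter> B)" for i using rv by (auto simp: J2_def)
  have "small (Suc n) (snd (u i) \<inter> snd (v j))" for i j
  proof -
    have "small m (fst (u i) \<inter> fst (v j))"
      by (rule small_mono[of _ "(fst (u i) - B) \<union> (fst (v j) \<inter> B)"]) (use u v in auto)
    moreover have "(fst (u i) \<inter> fst (v j), snd (u i) \<inter> snd (v j)) \<in> G"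
      using u v by (intro G'(6)) auto
    ultimately show ?thesis using G'(4) by blast
  qed
  from saturation[of n "\<lambda>i. snd (u i)" "\<lambda>i. snd (v i)" "\<lambda>i. snd (p i)", OF this] obtain C where
    C1: "\<And>i. small (Suc n) (snd (u i) - C)" and C2: "\<And>i. small (Suc n) (snd (v i) \<inter> C)"
    and C3: "\<And>i. (\<And>k. \<not> small (Suc n) (snd (p i) - (\<Union>j\<le>k. snd (u j)))) \<Longrightarrow> \<not> small (Suc n) (snd (p i) - C)"
    and C4: "\<And>i. (\<And>k. \<not> small (Suc n) (snd (p i) - (\<Union>j\<le>k. snd (v j)))) \<Longrightarrow> \<not> small (Suc n) (snd (p i) \<inter> C)"
    by blast
  have diff: "small m (X - B) \<longleftrightarrow> small (Suc n) (Y - C)" if XY: "(X, Y) \<in> G" for X Y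
  proof
    assume "small m (X - B)"
    then have "(X, Y) \<in> range u" using XY unfolding ru by (simp add: J1_def)
    then show "small (Suc n) (Y - C)" using C1 by (metis imageE snd_conv)
  next
    assume small: "small (Suc n) (Y - C)"
    show "small m (X - B)"
    proof (rule ccontr)
      assume ns: "\<not> small m (X - B)"
      obtain i where i: "p i = (X, Y)" using XY rp by (metis rangeE)
      \<comment> \<open>If finitely many \<open>snd (u j)\<close> covered \<open>Y\<close> up to a
        small set, the \<open>fst (u j)\<close> would cover \<open>X\<close> likewise, and
        \<open>X\<close> would be almost inside \<open>B\<close>.\<close>
      have "\<not> small (Suc n) (snd (p i) - (\<Union>j\<le>k. snd (u j)))" for k
      proof
        assume "small (Suc n) (snd (p i) - (\<Union>j\<le>k. snd (u j)))"
        then have "small m (X - (\<Union>j\<le>k. fst (u j)))"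
          using G'(4)[OF G'(7)[OF XY partial_iso_UN[OF G u(1)]]] i by simp
        moreover have "small m (\<Union>j\<in>{..k}. fst (u j) - B)"
          using u(2) by (subst small_UN_finite) auto
        ultimately have "small m ((X - (\<Union>j\<le>k. fst (u j))) \<union> (\<Union>j\<in>{..k}. fst (u j) - B))" by simp
        then have "small m (X - B)" by (rule small_mono) auto
        then show False using ns by simp
      qed
      from C3[OF this] show False using small i by (simp del: small.simps)
    qed
  qed
  have int: "small m (X \<inter> B) \<longleftrightarrow> small (Suc n) (Y \<inter> C)" if XY: "(X, Y) \<in> G" for X Y
  proof
    assume "small m (X \<inter> B)"
    then have "(X, Y) \<in> range v" using XY unfolding rv by (simp add: J2_def)
    then show "small (Suc n) (Y \<inter> C)" using C2 by (metis imageE snd_conv)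
  next
    assume small: "small (Suc n) (Y \<inter> C)"
    show "small m (X \<inter> B)"
    proof (rule ccontr)
      assume ns: "\<not> small m (X \<inter> B)"
      obtain i where i: "p i = (X, Y)" using XY rp by (metis rangeE)
      have "\<not> small (Suc n) (snd (p i) - (\<Union>j\<le>k. snd (v j)))" for k
      proof
        assume "small (Suc n) (snd (p i) - (\<Union>j\<le>k. snd (v j)))"
        then have "small m (X - (\<Union>j\<le>k. fst (v j)))"
          using G'(4)[OF G'(7)[OF XY partial_iso_UN[OF G v(1)]]] i by simp
        moreover have "small m (\<Union>j\<in>{..k}. fst (v j) \<inter> B)"
          using v(2) by (subst small_UN_finite) auto
        ultimately have "small m ((X - (\<Union>j\<le>k. fst (v j))) \<union> (\<Union>j\<in>{..k}. fst (v j) \<inter> B))" by simp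
        then have "small m (X \<inter> B)" by (rule small_mono) auto
        then show False using ns by simp
      qed
      from C4[OF this] show False using small i by (simp del: small.simps)
    qed
  qed
  \<comment> \<open>Normal form of the members of the algebra generated by \<open>G\<close> and
    \<open>(B, C)\<close>.\<close>
  define ext where "ext = (\<lambda>((X, Y), (X', Y')). ((X \<inter> B) \<union> (X' - B), (Y \<inter> C) \<union> (Y' - C)))"
  let ?G = "ext ` (G \<times> G)"
  have extI: "((X \<inter> B) \<union> (X' - B), (Y \<inter> C) \<union> (Y' - C)) \<in> ?G" if "(X, Y) \<in> G" "(X', Y') \<in> G" for X Y X' Y'
    using that by (force simp: ext_def)
  have extE: "\<exists>X Y X' Y'. (X, Y) \<in> G \<and> (X', Y') \<in> G \<and> P = (X \<inter> B) \<union> (X' - B) \<and> Q = (Y \<inter> C) \<union> (Y' - C)"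
    if "(P, Q) \<in> ?G" for P Q
    using that by (force simp: ext_def)
  have sub: "G \<subseteq> ?G"
  proof (clarify)
    fix X Y assume "(X, Y) \<in> G"
    from extI[OF this this] show "(X, Y) \<in> ?G" by (simp add: Int_Diff_Un)
  qed
  moreover have "countable ?G" using cnt by auto
  moreover have "partial_iso m (Suc n) ?G"
    unfolding partial_iso_def
  proof (intro conjI allI impI)
    show "({}, {}) \<in> ?G" using sub G'(1) by blast
  next
    fix P Q assume "(P, Q) \<in> ?G"
    then obtain X Y X' Y' where XY: "(X, Y) \<in> G" "(X', Y') \<in> G"
      and PQ: "P = (X \<inter> B) \<union> (X' - B)" "Q = (Y \<inter> C) \<union> (Y' - C)" using extE by blast
    have "- P = (- X \<inter> B) \<union> (- X' - B)" "- Q = (- Y \<inter> C) \<union> (- Y' - C)" using PQ by auto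
    then show "(- P, - Q) \<in> ?G" using extI[OF G'(3)[OF XY(1)] G'(3)[OF XY(2)]] by simp
    show "small m P \<longleftrightarrow> small (Suc n) Q" unfolding PQ small_Un using int[OF XY(1)] diff[OF XY(2)] by blast
  next
    fix P Q P' Q' assume "(P, Q) \<in> ?G" "(P', Q') \<in> ?G"
    then obtain X Y X' Y' W Z W' Z' where XY: "(X, Y) \<in> G" "(X', Y') \<in> G" "(W, Z) \<in> G" "(W', Z') \<in> G"
      and PQ: "P = (X \<inter> B) \<union> (X' - B)" "Q = (Y \<inter> C) \<union> (Y' - C)"
        "P' = (W \<inter> B) \<union> (W' - B)" "Q' = (Z \<inter> C) \<union> (Z' - C)" using extE by meson
    have "P \<union> P' = ((X \<union> W) \<inter> B) \<union> ((X' \<union> W') - B)" "Q \<union> Q' = ((Y \<union> Z) \<inter> C) \<union> ((Y' \<union> Z') - C)"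
      using PQ by auto
    then show "(P \<union> P', Q \<union> Q') \<in> ?G"
      using extI[OF G'(5)[OF XY(1,3)] G'(5)[OF XY(2,4)]] by simp
  qed
  moreover have "B \<in> Domain ?G" using extI[OF G'(2) G'(1)] by (auto simp: Domain.simps)
  ultimately show ?thesis by blast
qed

lemma countable_converse: "countable G \<Longrightarrow> countable (G\<inverse>)"
proof -
  assume "countable G"
  moreover have "G\<inverse> = prod.swap ` G" by force
  ultimately show ?thesis by simp
qed

text \<open>The back step is the forth step for the converse relation, which is why both exponents
  are positive here.\<close>

lemma partial_iso_extend_both:
  assumes "partial_iso (Suc m) (Suc n) G" "countable G"
  shows "\<exists>G'. G \<subseteq> G' \<and> countable G' \<and> partial_iso (Suc m) (Suc n) G' \<and> B \<in> Domain G' \<and> C \<in> Range G'"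
proof -
  obtain G1 where G1: "G \<subseteq> G1" "countable G1" "partial_iso (Suc m) (Suc n) G1" "B \<in> Domain G1"
    using partial_iso_extend[OF assms, of B] by blast
  have "countable (G1\<inverse>)" using G1(2) by (rule countable_converse)
  from partial_iso_extend[OF partial_iso_converse[OF G1(3)] this, of C]
  obtain G2 where G2: "G1\<inverse> \<subseteq> G2" "countable G2" "partial_iso (Suc n) (Suc m) G2" "C \<in> Domain G2"
    by blast
  show ?thesis
    using G1 G2 partial_iso_converse[OF G2(3)] countable_converse[OF G2(2)] by (intro exI[of _ "G2\<inverse>"]) auto
qed

lemma partial_iso_Union_chain:
  assumes ne: "\<G> \<noteq> {}" and iso: "\<And>G. G \<in> \<G> \<Longrightarrow> partial_iso m n G"
    and chain: "\<And>G H. G \<in> \<G> \<Longrightarrow> H \<in> \<G> \<Longrightarrow> G \<subseteq> H \<or> H \<subseteq> G"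
  shows "partial_iso m n (\<Union>\<G>)"
  unfolding partial_iso_def
proof (intro conjI allI impI)
  show "({}, {}) \<in> \<Union>\<G>" using ne partial_isoD(1)[OF iso] by blast
next
  fix X Y assume "(X, Y) \<in> \<Union>\<G>"
  then show "(- X, - Y) \<in> \<Union>\<G>" "small m X \<longleftrightarrow> small n Y"
    using partial_isoD(3,4)[OF iso] by blast+
next
  fix X Y X' Y' assume "(X, Y) \<in> \<Union>\<G>" "(X', Y') \<in> \<Union>\<G>"
  then obtain G H where "G \<in> \<G>" "H \<in> \<G>" "(X, Y) \<in> G" "(X', Y') \<in> H" by blast
  then obtain K where "K \<in> \<G>" "(X, Y) \<in> K" "(X', Y') \<in> K" using chain[of G H] by blast
  then show "(X \<union> X', Y \<union> Y') \<in> \<Union>\<G>" using partial_isoD(5)[OF iso] by blast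
qed

text \<open>Proper initial segments of a cardinal well-order of the power set of
  \<open>\<omega>\<close> have size below the continuum, which under CH means countable. This is the
  only use of CH.\<close>

lemma CH_well_order:
  assumes CH
  obtains R :: "nat set rel" where "wf R" "trans R" "\<And>i j. i = j \<or> (i, j) \<in> R \<or> (j, i) \<in> R"
    "\<And>i. countable {j. (j, i) \<in> R}"
proof -
  let ?r = "|UNIV :: nat set set|"
  have wo: "Well_order ?r" by (rule card_of_Well_order)
  have F: "Field ?r = UNIV" by (rule Field_card_of)
  let ?R = "?r - Id"
  have "wf ?R" using wo by (simp add: well_order_on_def)
  moreover have "trans ?R"
    using wo by (auto simp: order_on_defs intro: trans_diff_Id)
  moreover have "i = j \<or> (i, j) \<in> ?R \<or> (j, i) \<in> ?R" for i j
    using wo F by (auto simp: order_on_defs total_on_def)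
  moreover have "countable {j. (j, i) \<in> ?R}" for i
  proof -
    have "{j. (j, i) \<in> ?R} = underS ?r i" by (auto simp: underS_def)
    moreover have "|underS ?r i| <o ?r"
      by (rule card_of_underS[OF card_of_Card_order]) (simp add: F)
    then have "|underS ?r i| <o cardSuc natLeq"
      using assms unfolding CH_def by (metis ordLess_ordIso_trans ordIso_symmetric)
    then have "|underS ?r i| \<le>o natLeq"
      using cardSuc_ordLeq_ordLess[OF natLeq_Card_order card_of_Card_order] by blast
    then have "|underS ?r i| \<le>o |UNIV :: nat set|"
      using card_of_nat ordIso_symmetric ordLeq_ordIso_trans by blast
    then obtain f :: "nat set \<Rightarrow> nat" where "inj_on f (underS ?r i)"
      using card_of_ordLeq[of "underS ?r i" "UNIV :: nat set"] by auto
    ultimately show ?thesis by (auto simp: countable_def)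
  qed
  ultimately show ?thesis by (rule that)
qed

lemma CH_total_iso:
  assumes CH
  shows "\<exists>G. partial_iso (Suc m) (Suc n) G \<and> Domain G = UNIV \<and> Range G = UNIV"
proof -
  obtain R :: "nat set rel" where R: "wf R" "trans R" "\<And>i j. i = j \<or> (i, j) \<in> R \<or> (j, i) \<in> R"
    "\<And>i. countable {j. (j, i) \<in> R}" using CH_well_order[OF assms] by blast
  \<comment> \<open>Indexes all sets of lists by sets of naturals, the type ordered by
    \<open>R\<close>.\<close>
  define x :: "nat set \<Rightarrow> nat list set" where "x i = from_nat ` i" for i
  have x: "\<exists>i. x i = X" for X
    by (rule exI[of _ "to_nat ` X"]) (simp add: x_def image_image)
  \<comment> \<open>Contained in every partial isomorphism, so adding it keeps chains comparable and
    supplies the stage that has no predecessors.\<close>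
  define base :: "(nat list set \<times> nat list set) set" where "base = {({}, {}), (UNIV, UNIV)}"
  have base: "partial_iso (Suc m) (Suc n) base"
    by (auto simp: partial_iso_def base_def not_small_UNIV simp del: small.simps)
  have base_sub: "base \<subseteq> G" if "partial_iso (Suc m) (Suc n) G" for G
    using partial_isoD(1,2)[OF that] by (simp add: base_def)
  define good where "good G \<longleftrightarrow> partial_iso (Suc m) (Suc n) G \<and> countable G" for G
  define step where "step i H = (SOME G. H \<subseteq> G \<and> good G \<and> x i \<in> Domain G \<and> x i \<in> Range G)" for i H
  have step: "H \<subseteq> step i H \<and> good (step i H) \<and> x i \<in> Domain (step i H) \<and> x i \<in> Range (step i H)"
    if "good H" for i H
    unfolding step_def
    by (rule someI_ex) (use that partial_iso_extend_both[of m n H "x i" "x i"] in \<open>auto simp: good_def\<close>)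
  define G where "G = wfrec R (\<lambda>g i. step i (\<Union>(insert base (g ` {j. (j, i) \<in> R}))))"
  \<comment> \<open>The union of all earlier stages: a chain, and countable because \<open>i\<close>
    has only countably many predecessors.\<close>
  define H where "H i = \<Union>(insert base (G ` {j. (j, i) \<in> R}))" for i
  have G: "G i = step i (H i)" for i
  proof -
    have "cut G R i ` {j. (j, i) \<in> R} = G ` {j. (j, i) \<in> R}"
      by (rule image_cong) (auto simp: cut_apply)
    moreover have "G i = step i (\<Union>(insert base (cut G R i ` {j. (j, i) \<in> R})))"
      unfolding G_def by (rule wfrec[OF R(1)])
    ultimately show ?thesis by (simp only: H_def)
  qed
  have main: "good (G i) \<and> (\<forall>j. (j, i) \<in> R \<longrightarrow> G j \<subseteq> G i) \<and> x i \<in> Domain (G i) \<and> x i \<in> Range (G i)" for i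
    using R(1)
  proof (induction i rule: wf_induct_rule)
    case (less i)
    have "partial_iso (Suc m) (Suc n) (H i)"
      unfolding H_def
    proof (rule partial_iso_Union_chain)
      show iso: "partial_iso (Suc m) (Suc n) K" if "K \<in> insert base (G ` {j. (j, i) \<in> R})" for K
        using that base less.IH by (auto simp: good_def)
      fix K L assume KL: "K \<in> insert base (G ` {j. (j, i) \<in> R})" "L \<in> insert base (G ` {j. (j, i) \<in> R})"
      show "K \<subseteq> L \<or> L \<subseteq> K"
      proof (cases "K = base \<or> L = base")
        case True
        then show ?thesis using base_sub iso KL by blast
      next
        case False
        then obtain j k where "(j, i) \<in> R" "(k, i) \<in> R" "K = G j" "L = G k" using KL by auto
        then show ?thesis using R(3)[of j k] less.IH[of j] less.IH[of k] by blast
      qed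
    qed simp
    moreover have "countable (H i)"
      unfolding H_def using less.IH R(4)[of i] by (auto simp: good_def base_def)
    ultimately have "good (H i)" by (simp add: good_def)
    from step[OF this, of i] have "H i \<subseteq> G i" "good (G i)" "x i \<in> Domain (G i)" "x i \<in> Range (G i)"
      by (simp_all add: G)
    moreover have "G j \<subseteq> H i" if "(j, i) \<in> R" for j using that by (auto simp: H_def)
    ultimately show ?case by blast
  qed
  have "partial_iso (Suc m) (Suc n) (\<Union>(range G))"
  proof (rule partial_iso_Union_chain)
    fix K L assume "K \<in> range G" "L \<in> range G"
    then obtain i j where "K = G i" "L = G j" by blast
    then show "K \<subseteq> L \<or> L \<subseteq> K" using main[of i] main[of j] R(3)[of i j] by blast
  qed (use main in \<open>auto simp: good_def\<close>)
  moreover have "X \<in> Domain (\<Union>(range G)) \<and> X \<in> Range (\<Union>(range G))" for X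
  proof -
    obtain i where "x i = X" using x by blast
    then have "X \<in> Domain (G i)" "X \<in> Range (G i)" using main[of i] by auto
    then show ?thesis by blast
  qed
  ultimately show ?thesis by (intro exI[of _ "\<Union>(range G)"]) auto
qed

lemma CH_imp_isomorphic:
  assumes CH "m \<ge> 1" "n \<ge> 1"
  shows "ba_isomorphic (omega_algebra m) (omega_algebra n)"
proof -
  obtain G where G: "partial_iso m n G" and dom: "Domain G = UNIV" and ran: "Range G = UNIV"
    using CH_total_iso[OF assms(1), of "m - 1" "n - 1"] assms by auto
  let ?S = "lists_of_length m" and ?T = "lists_of_length n"
  \<comment> \<open>Trimming to tuples of the right length commutes with the Boolean operations and
    does not change smallness.\<close>
  let ?G = "{(X \<inter> ?S, Y \<inter> ?T) | X Y. (X, Y) \<in> G}"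
  show ?thesis
    unfolding omega_algebra_eq
  proof (rule powerset_quotient_isomorphicI[where G = ?G])
    show "Pow ?S \<subseteq> Domain ?G"
    proof
      fix X assume "X \<in> Pow ?S"
      moreover obtain Y where "(X, Y) \<in> G" using dom by blast
      ultimately show "X \<in> Domain ?G" by (intro DomainI[of _ "Y \<inter> ?T"]) auto
    qed
    show "Pow ?T \<subseteq> Range ?G"
    proof
      fix Y assume "Y \<in> Pow ?T"
      moreover obtain X where "(X, Y) \<in> G" using ran by blast
      ultimately show "Y \<in> Range ?G" by (intro RangeI[of "X \<inter> ?S"]) auto
    qed
  next
    fix X Y X' Y' assume "(X, Y) \<in> ?G" "(X', Y') \<in> ?G"
    then obtain P Q P' Q' where "(P, Q) \<in> G" "(P', Q') \<in> G" and
      eq: "X = P \<inter> ?S" "Y = Q \<inter> ?T" "X' = P' \<inter> ?S" "Y' = Q' \<inter> ?T" by blast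
    then have "(P \<union> P', Q \<union> Q') \<in> G" using partial_isoD(5)[OF G] by blast
    moreover have "X \<union> X' = (P \<union> P') \<inter> ?S" "Y \<union> Y' = (Q \<union> Q') \<inter> ?T" using eq by auto
    ultimately show "(X \<union> X', Y \<union> Y') \<in> ?G" by blast
  next
    fix X Y assume "(X, Y) \<in> ?G"
    then obtain P Q where PQ: "(P, Q) \<in> G" and eq: "X = P \<inter> ?S" "Y = Q \<inter> ?T" by blast
    then have "(- P, - Q) \<in> G" using partial_isoD(3)[OF G] by blast
    moreover have "?S - X = - P \<inter> ?S" "?T - Y = - Q \<inter> ?T" using eq by auto
    ultimately show "(?S - X, ?T - Y) \<in> ?G" by blast
    have "small m X \<longleftrightarrow> small m P" "small n Y \<longleftrightarrow> small n Q"
      unfolding eq by (rule small_cong, simp add: lists_of_length_def)+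
    then show "X \<in> omega_ideal m \<longleftrightarrow> Y \<in> omega_ideal n"
      using partial_isoD(4)[OF G PQ] assms eq by (simp add: mem_omega_ideal_iff)
  qed (use assms powerset_ideal_omega in auto)
qed

section \<open>The Borel complexity of the ideals\<close>

definition clopen :: "(nat \<Rightarrow> bool) set \<Rightarrow> bool" where
  "clopen S \<longleftrightarrow> open S \<and> closed S"

lemma clopen_simps [simp]: "clopen {}" "clopen UNIV"
  by (auto simp: clopen_def)

lemma clopen_Compl: "clopen S \<Longrightarrow> clopen (- S)"
  by (auto simp: clopen_def)

lemma clopen_Int: "clopen S \<Longrightarrow> clopen T \<Longrightarrow> clopen (S \<inter> T)"
  by (auto simp: clopen_def)

lemma clopen_UN: "finite A \<Longrightarrow> (\<And>i. i \<in> A \<Longrightarrow> clopen (S i)) \<Longrightarrow> clopen (\<Union>i\<in>A. S i)"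
  by (auto simp: clopen_def)

lemma clopen_INT: "finite A \<Longrightarrow> (\<And>i. i \<in> A \<Longrightarrow> clopen (S i)) \<Longrightarrow> clopen (\<Inter>i\<in>A. S i)"
  by (auto simp: clopen_def)

lemma clopen_iff_continuous: "clopen {x. h x} \<longleftrightarrow> continuous_on UNIV h"
proof
  assume h: "clopen {x. h x}"
  then have n: "open {x. \<not> h x}" using clopen_Compl[OF h] by (simp add: clopen_def Collect_neg_eq)
  show "continuous_on UNIV h"
    unfolding continuous_on_open_vimage[OF open_UNIV]
  proof (intro allI impI)
    fix B :: "bool set"
    have "h -` B = (if True \<in> B then {x. h x} else {}) \<union> (if False \<in> B then {x. \<not> h x} else {})"
      (is "_ = ?R")
    proof (rule set_eqI)
      show "x \<in> h -` B \<longleftrightarrow> x \<in> ?R" for x by (cases "h x") auto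
    qed
    then show "open (h -` B \<inter> UNIV)" using h n by (auto simp: clopen_def)
  qed
next
  assume h: "continuous_on UNIV h"
  have "{x. h x} = h -` {True}" by auto
  then show "clopen {x. h x}"
    unfolding clopen_def using open_vimage[OF _ h, of "{True}"] closed_vimage[OF _ h, of "{True}"]
    by (simp add: open_discrete)
qed

lemma clopen_coordinate: "clopen {x. x i}"
  by (simp add: clopen_iff_continuous continuous_on_product_coordinates)

lemma open_contains_cylinder:
  fixes S :: "(nat \<Rightarrow> bool) set"
  assumes "open S" "x \<in> S"
  shows "\<exists>l. \<forall>z. (\<forall>i<l. z i = x i) \<longrightarrow> z \<in> S"
proof -
  have "openin (product_topology (\<lambda>_. euclidean) UNIV) S"
    using assms(1) by (simp add: open_fun_def)
  from product_topology_open_contains_basis[OF this assms(2)] obtain X where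
    X: "x \<in> PiE UNIV X" "finite {i. X i \<noteq> UNIV}" "PiE UNIV X \<subseteq> S" by auto
  obtain l where l: "\<And>i. X i \<noteq> UNIV \<Longrightarrow> i < l"
    using finite_nat_set_iff_bounded[of "{i. X i \<noteq> UNIV}"] X(2) by auto
  have "z \<in> S" if z: "\<forall>i<l. z i = x i" for z
  proof -
    have "z i \<in> X i" for i
      using z X(1) l[of i] by (cases "i < l") auto
    then show ?thesis using X(3) by auto
  qed
  then show ?thesis by blast
qed

text \<open>
  These are the clopen sets and then the boldface pointclasses \<open>\<Pi>\<^sup>0\<^sub>2\<close>, \<open>\<Pi>\<^sup>0\<^sub>4\<close>, \<open>\<Pi>\<^sup>0\<^sub>6\<close>, \<open>\<dots>\<close> of the Cantor space.
\<close>

fun limsup_class :: "nat \<Rightarrow> (nat \<Rightarrow> bool) set set" where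
  "limsup_class 0 = {S. clopen S}"
| "limsup_class (Suc n) = {{x. \<exists>\<^sub>\<infinity>k::nat. x \<in> S k} | S. \<forall>k. S k \<in> limsup_class n}"

lemma limsup_classE:
  assumes "T \<in> limsup_class (Suc n)"
  obtains S :: "nat \<Rightarrow> (nat \<Rightarrow> bool) set" where "\<And>k. S k \<in> limsup_class n" "T = {x. \<exists>\<^sub>\<infinity>k. x \<in> S k}"
proof -
  obtain S :: "nat \<Rightarrow> (nat \<Rightarrow> bool) set" where "\<forall>k. S k \<in> limsup_class n" "T = {x. \<exists>\<^sub>\<infinity>k. x \<in> S k}"
    using assms by auto
  then show ?thesis using that by blast
qed

lemma limsup_class_INFM:
  "(\<And>k::nat. {x. P k x} \<in> limsup_class n) \<Longrightarrow> {x. \<exists>\<^sub>\<infinity>k. P k x} \<in> limsup_class (Suc n)"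
  by (auto intro!: exI[of _ "\<lambda>k. {x. P k x}"])

lemma limsup_class_Suc: "S \<in> limsup_class n \<Longrightarrow> S \<in> limsup_class (Suc n)"
  by (auto intro!: exI[of _ "\<lambda>_. S"])

lemma limsup_class_mono: "m \<le> n \<Longrightarrow> limsup_class m \<subseteq> limsup_class n"
  by (rule lift_Suc_mono_le) (auto intro: limsup_class_Suc simp del: limsup_class.simps)

lemma limsup_class_trivial: "{} \<in> limsup_class n" "UNIV \<in> limsup_class n"
proof -
  show "{} \<in> limsup_class n" by (induction n) (simp, metis limsup_class_Suc)
  show "UNIV \<in> limsup_class n" by (induction n) (simp, metis limsup_class_Suc)
qed

text \<open>Allows finite sequences and pairs as indices. Numbers that code no index get the empty
  set and contribute nothing.\<close>

lemma limsup_classI: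
  fixes S :: "'i :: countable \<Rightarrow> (nat \<Rightarrow> bool) set"
  assumes "\<And>i. S i \<in> limsup_class n"
  shows "{x. infinite {i. x \<in> S i}} \<in> limsup_class (Suc n)"
proof -
  define S' where "S' k = (if k \<in> range (to_nat :: 'i \<Rightarrow> nat) then S (from_nat k) else {})" for k
  have "{k. x \<in> S' k} = to_nat ` {i. x \<in> S i}" for x
    by (auto simp: S'_def)
  then have "infinite {k. x \<in> S' k} \<longleftrightarrow> infinite {i. x \<in> S i}" for x
    by (simp add: finite_image_iff)
  then have "{x. infinite {i. x \<in> S i}} = {x. \<exists>\<^sub>\<infinity>k. x \<in> S' k}"
    by (simp add: INFM_iff_infinite)
  moreover have "\<forall>k. S' k \<in> limsup_class n"
    using assms limsup_class_trivial by (simp add: S'_def)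
  ultimately show ?thesis by auto
qed

lemma limsup_class_INT:
  assumes "\<And>S T. S \<in> limsup_class n \<Longrightarrow> T \<in> limsup_class n \<Longrightarrow> S \<inter> T \<in> limsup_class n"
    and "\<And>j. j < l \<Longrightarrow> F j \<in> limsup_class n"
  shows "(\<Inter>j<(l::nat). F j) \<in> limsup_class n"
  using assms(2)
proof (induction l)
  case 0
  then show ?case using limsup_class_trivial by simp
next
  case (Suc l)
  then show ?case by (simp add: lessThan_Suc assms(1))
qed

text \<open>
  Intersections and complements have to be treated together. Disjointness makes the witnesses
  \<open>i\<close> with \<open>x \<in> D k i\<close> unique, so that a universal quantifier over \<open>k\<close> can be expressed by the
  existence of infinitely many finite sequences of witnesses.
\<close>

lemma limsup_class_Int_Compl:
  "(\<forall>S\<in>limsup_class n. \<forall>T\<in>limsup_class n. S \<inter> T \<in> limsup_class n) \<and>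
   (\<forall>S\<in>limsup_class n. \<exists>D :: nat \<Rightarrow> _. (\<forall>i. D i \<in> limsup_class n) \<and> disjoint_family D \<and> - S = (\<Union>i. D i))"
proof (induction n)
  case 0
  have "\<exists>D :: nat \<Rightarrow> _. (\<forall>i. D i \<in> limsup_class 0) \<and> disjoint_family D \<and> - S = (\<Union>i. D i)"
    if "S \<in> limsup_class 0" for S
    using that by (intro exI[of _ "\<lambda>i. if i = 0 then - S else {}"])
      (auto simp: clopen_Compl disjoint_family_on_def split: if_splits)
  then show ?case by (auto simp: clopen_Int simp del: ex_simps)
next
  case (Suc n)
  have int: "S \<inter> T \<in> limsup_class n" if "S \<in> limsup_class n" "T \<in> limsup_class n" for S T
    using Suc.IH that by blast
  have ex: "\<exists>D. \<forall>k. (\<forall>i::nat. D k i \<in> limsup_class n) \<and> disjoint_family (D k) \<and> - S k = (\<Union>i. D k i)"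
    if "\<And>k. S k \<in> limsup_class n" for S :: "nat \<Rightarrow> _"
    using Suc.IH that by (intro choice) blast
  have compl: "\<exists>D. (\<forall>k. \<forall>i::nat. D k i \<in> limsup_class n) \<and>
      (\<forall>k i j x. x \<in> D k i \<longrightarrow> x \<in> D k j \<longrightarrow> i = j) \<and> (\<forall>k x. x \<notin> S k \<longleftrightarrow> (\<exists>i. x \<in> D k i))"
    if S: "\<And>k. S k \<in> limsup_class n" for S :: "nat \<Rightarrow> _"
  proof -
    obtain D where "\<forall>k. (\<forall>i::nat. D k i \<in> limsup_class n) \<and> disjoint_family (D k) \<and> - S k = (\<Union>i. D k i)"
      using ex[OF S] ..
    then have D: "D k i \<in> limsup_class n" "disjoint_family (D k)" "- S k = (\<Union>i. D k i)" for k i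
      by auto
    have "x \<in> D k i \<Longrightarrow> x \<in> D k j \<Longrightarrow> i = j" for x k i j
      using D(2)[of k] by (auto simp: disjoint_family_on_def)
    moreover have "x \<notin> S k \<longleftrightarrow> (\<exists>i. x \<in> D k i)" for x k
      using D(3)[of k] by blast
    ultimately show ?thesis using D(1) by (intro exI[of _ D] conjI allI impI) auto
  qed
  show ?case
  proof (intro conjI ballI)
    fix P Q assume "P \<in> limsup_class (Suc n)" "Q \<in> limsup_class (Suc n)"
    then obtain S T :: "nat \<Rightarrow> (nat \<Rightarrow> bool) set" where S: "\<And>k. S k \<in> limsup_class n" "P = {x. \<exists>\<^sub>\<infinity>k. x \<in> S k}"
      and T: "\<And>k. T k \<in> limsup_class n" "Q = {x. \<exists>\<^sub>\<infinity>k. x \<in> T k}"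
      by (elim limsup_classE) blast
    obtain D where D: "\<And>k i. D k i \<in> limsup_class n" "\<And>k i j x. x \<in> D k i \<Longrightarrow> x \<in> D k j \<Longrightarrow> i = j"
      "\<And>k x. x \<notin> T k \<longleftrightarrow> (\<exists>i::nat. x \<in> D k i)"
      using compl[of T] T(1) by metis
    \<comment> \<open>\<open>k + length is\<close> is the first index from \<open>k\<close> on at
      which \<open>x\<close> lies in some \<open>T l\<close>, and \<open>is\<close> lists the
      witnesses for the failures before it. Unique witnesses give exactly one \<open>is\<close> for
      each \<open>k\<close> with \<open>x \<in> S k\<close> if such an index exists, so infinitely
      many pairs express both conditions at once.\<close>
    define E where "E = (\<lambda>(k, is). S k \<inter> T (k + length is) \<inter> (\<Inter>j<length is. D (k + j) (is ! j)))"
    have E: "x \<in> E (k, is) \<longleftrightarrow> x \<in> S k \<and> x \<in> T (k + length is) \<and> (\<forall>j<length is. x \<in> D (k + j) (is ! j))"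
      for x k "is" by (auto simp: E_def)
    have "E p \<in> limsup_class n" for p
      unfolding E_def using S T D by (auto split: prod.splits intro!: int limsup_class_INT)
    then have "{x. infinite {p. x \<in> E p}} \<in> limsup_class (Suc n)" by (rule limsup_classI)
    moreover have "infinite {p. x \<in> E p} \<longleftrightarrow> x \<in> P \<and> x \<in> Q" for x
    proof
      assume inf: "infinite {p. x \<in> E p}"
      have "inj_on fst {p. x \<in> E p}"
      proof (rule inj_onI, clarify)
        fix k "is" k' js assume a: "x \<in> E (k, is)" "x \<in> E (k', js)" and eq: "fst (k, is) = fst (k', js)"
        have le: "length is \<le> length js" if "x \<in> E (k, is)" "x \<in> E (k, js)" for "is" js
        proof (rule ccontr)
          assume "\<not> length is \<le> length js"
          then have "x \<in> D (k + length js) (is ! length js)" "x \<in> T (k + length js)" using that E by auto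
          then show False using D(3) by blast
        qed
        have "length is = length js" using le[of "is" js] le[of js "is"] a eq by simp
        then have "is = js" using a eq D(2) E by (intro nth_equalityI) auto
        then show "k = k' \<and> is = js" using eq by simp
      qed
      then have "infinite (fst ` {p. x \<in> E p})" using inf finite_imageD by blast
      moreover have "fst ` {p. x \<in> E p} \<subseteq> {k. x \<in> S k}" using E by auto
      ultimately have "infinite {k. x \<in> S k}" using infinite_super by blast
      moreover have "\<exists>l\<ge>m. x \<in> T l" for m
      proof -
        obtain k where "k \<in> fst ` {p. x \<in> E p}" "k \<ge> m"
          using \<open>infinite (fst ` _)\<close> infinite_nat_iff_unbounded_le by blast
        then obtain "is" :: "nat list" where "x \<in> T (k + length is)" using E by auto
        then show ?thesis using \<open>k \<ge> m\<close> by (meson trans_le_add1)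
      qed
      ultimately show "x \<in> P \<and> x \<in> Q"
        unfolding S(2) T(2) by (simp add: INFM_iff_infinite INFM_nat_le infinite_nat_iff_unbounded_le)
    next
      assume PQ: "x \<in> P \<and> x \<in> Q"
      have "{k. x \<in> S k} \<subseteq> fst ` {p. x \<in> E p}"
      proof
        fix k assume k: "k \<in> {k. x \<in> S k}"
        have ex: "\<exists>l. x \<in> T (k + l)"
        proof -
          obtain l where "l \<ge> k" "x \<in> T l" using PQ T(2) by (auto simp: INFM_nat_le)
          then show ?thesis by (intro exI[of _ "l - k"]) simp
        qed
        define l where "l = (LEAST l. x \<in> T (k + l))"
        have l: "x \<in> T (k + l)" unfolding l_def by (rule LeastI_ex[OF ex])
        have "x \<notin> T (k + j)" if "j < l" for j using that not_less_Least unfolding l_def by blast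
        then have "\<forall>j. \<exists>i. j < l \<longrightarrow> x \<in> D (k + j) i" using D(3) by blast
        then obtain i where i: "\<And>j. j < l \<Longrightarrow> x \<in> D (k + j) (i j)" by metis
        have "x \<in> E (k, map i [0..<l])" using k l i by (simp add: E)
        then show "k \<in> fst ` {p. x \<in> E p}" by force
      qed
      moreover have "infinite {k. x \<in> S k}" using PQ S(2) by (simp add: INFM_iff_infinite)
      ultimately show "infinite {p. x \<in> E p}" using finite_surj by blast
    qed
    ultimately show "P \<inter> Q \<in> limsup_class (Suc n)" by (simp add: Int_def del: limsup_class.simps)
  next
    fix P assume "P \<in> limsup_class (Suc n)"
    then obtain S :: "nat \<Rightarrow> (nat \<Rightarrow> bool) set" where S: "\<And>k. S k \<in> limsup_class n" "P = {x. \<exists>\<^sub>\<infinity>k. x \<in> S k}"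
      by (elim limsup_classE) blast
    obtain D where D: "\<And>k i. D k i \<in> limsup_class n" "\<And>k i j x. x \<in> D k i \<Longrightarrow> x \<in> D k j \<Longrightarrow> i = j"
      "\<And>k x. x \<notin> S k \<longleftrightarrow> (\<exists>i::nat. x \<in> D k i)"
      using compl[of S] S(1) by metis
    \<comment> \<open>\<open>T k\<close> says that \<open>k\<close> is the least index from which on
      \<open>x\<close> avoids all \<open>S l\<close>; \<open>F k\<close> expresses minimality and
      makes the \<open>T k\<close> disjoint.\<close>
    define F where "F k = (if k = 0 then UNIV else S (k - 1))" for k
    define T where "T k = {x \<in> F k. \<forall>j. x \<notin> S (k + j)}" for k
    have "T k \<in> limsup_class (Suc n)" for k
    proof -
      \<comment> \<open>\<open>is\<close> witnesses that \<open>x\<close> avoids the next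
        \<open>length is\<close> sets from \<open>S k\<close> on. For each length there is at most
        one such list, so there are infinitely many lists exactly if all these sets are
        avoided.\<close>
      define E where "E is = F k \<inter> (\<Inter>j<length is. D (k + j) (is ! j))" for "is"
      have E: "x \<in> E is \<longleftrightarrow> x \<in> F k \<and> (\<forall>j<length is. x \<in> D (k + j) (is ! j))"
        for x "is" by (auto simp: E_def)
      have "E is \<in> limsup_class n" for "is"
        unfolding E_def F_def using S D limsup_class_trivial by (auto intro!: int limsup_class_INT)
      then have "{x. infinite {is. x \<in> E is}} \<in> limsup_class (Suc n)" by (rule limsup_classI)
      moreover have "infinite {is. x \<in> E is} \<longleftrightarrow> x \<in> T k" for x
      proof
        assume inf: "infinite {is. x \<in> E is}"
        have "inj_on length {is. x \<in> E is}"
          using E D(2) by (intro inj_onI nth_equalityI) auto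
        then have infl: "infinite (length ` {is. x \<in> E is})" using inf finite_imageD by blast
        have "x \<notin> S (k + j)" for j
        proof -
          obtain l where "l \<in> length ` {is. x \<in> E is}" "l > j"
            using infl infinite_nat_iff_unbounded by blast
          then show ?thesis using E D(3) by blast
        qed
        moreover have "x \<in> F k"
          using inf E by (metis (mono_tags, lifting) empty_Collect_eq finite.emptyI)
        ultimately show "x \<in> T k" by (simp add: T_def)
      next
        assume x: "x \<in> T k"
        then have "\<forall>j. \<exists>i. x \<in> D (k + j) i" unfolding T_def using D(3) by blast
        then obtain i where i: "\<And>j. x \<in> D (k + j) (i j)" by metis
        have "range (\<lambda>l. map i [0..<l]) \<subseteq> {is. x \<in> E is}" using x i by (auto simp: E T_def)
        moreover have "inj (\<lambda>l. map i [0..<l])" by (rule injI) (metis length_map length_upt minus_nat.diff_0)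
        ultimately show "infinite {is. x \<in> E is}" using range_inj_infinite infinite_super by blast
      qed
      ultimately show ?thesis by (simp del: limsup_class.simps)
    qed
    moreover have "disjoint_family T"
    proof -
      have "False" if "k < l" "x \<in> T k" "x \<in> T l" for k l x
        using that by (auto simp: T_def F_def dest!: spec[of _ "l - 1 - k"])
      then show ?thesis unfolding disjoint_family_on_def by (metis disjoint_iff linorder_neqE_nat)
    qed
    moreover have "- P = (\<Union>k. T k)"
    proof safe
      fix x assume "x \<notin> P"
      then have ex: "\<exists>k. \<forall>j. x \<notin> S (k + j)"
        unfolding S(2) by (auto simp: INFM_nat_le) (metis le_add1)
      define k where "k = (LEAST k. \<forall>j. x \<notin> S (k + j))"
      have k: "\<forall>j. x \<notin> S (k + j)" unfolding k_def by (rule LeastI_ex[OF ex])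
      have "x \<in> F k"
      proof (cases k)
        case (Suc k')
        then obtain j where "x \<in> S (k' + j)"
          using not_less_Least[of k' "\<lambda>k. \<forall>j. x \<notin> S (k + j)"] unfolding k_def by auto
        then have "x \<in> S k'" using k Suc by (cases j) auto
        then show ?thesis using Suc by (simp add: F_def)
      qed (simp add: F_def)
      then show "x \<in> (\<Union>k. T k)" using k by (auto simp: T_def)
    next
      fix x k assume "x \<in> T k" "x \<in> P"
      then obtain l where "l \<ge> k" "x \<in> S l" unfolding S(2) by (auto simp: INFM_nat_le)
      then show False using \<open>x \<in> T k\<close> by (auto simp: T_def dest!: spec[of _ "l - k"])
    qed
    ultimately show "\<exists>D :: nat \<Rightarrow> _. (\<forall>i. D i \<in> limsup_class (Suc n)) \<and> disjoint_family D \<and> - P = (\<Union>i. D i)"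
      by blast
  qed
qed

text \<open>The complement is a countable union of sets of class \<open>n\<close>, and repeating
  each of these infinitely often turns the union into a limit superior.\<close>

lemma limsup_class_Compl:
  assumes "S \<in> limsup_class n" shows "- S \<in> limsup_class (Suc n)"
proof -
  obtain D :: "nat \<Rightarrow> _" where "(\<forall>i. D i \<in> limsup_class n) \<and> disjoint_family D \<and> - S = (\<Union>i. D i)"
    using bspec[OF conjunct2[OF limsup_class_Int_Compl[of n]] assms] ..
  then have D: "D i \<in> limsup_class n" "- S = (\<Union>i. D i)" for i by auto
  have "{x. infinite {p :: nat \<times> nat. x \<in> D (fst p)}} \<in> limsup_class (Suc n)"
    by (rule limsup_classI) (rule D)
  moreover have "infinite {p :: nat \<times> nat. x \<in> D (fst p)} \<longleftrightarrow> x \<in> - S" for x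
  proof
    assume "infinite {p :: nat \<times> nat. x \<in> D (fst p)}"
    then have "{p :: nat \<times> nat. x \<in> D (fst p)} \<noteq> {}" by (metis finite.emptyI)
    then show "x \<in> - S" unfolding D(2) by blast
  next
    assume "x \<in> - S"
    then obtain i where "x \<in> D i" unfolding D(2) by blast
    then have "range (\<lambda>q. (i, q)) \<subseteq> {p :: nat \<times> nat. x \<in> D (fst p)}" by auto
    moreover have "infinite (range (\<lambda>q::nat. (i, q)))" by (rule range_inj_infinite) (auto simp: inj_def)
    ultimately show "infinite {p :: nat \<times> nat. x \<in> D (fst p)}" using infinite_super by blast
  qed
  ultimately show ?thesis by (simp add: Compl_eq del: limsup_class.simps)
qed

section \<open>Universal sets and strictness of the hierarchy\<close>

text \<open>At level \<open>0\<close>, \<open>y\<close> is a set of codes of finite prefixes and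
  \<open>x\<close> must have infinitely many prefixes in it, the usual universal
  \<open>\<Pi>\<^sup>0\<^sub>2\<close> set; above, \<open>prod_encode\<close> splits
  \<open>y\<close> into one code for each \<open>k\<close>. Level \<open>n\<close> thus belongs to
  \<open>limsup_class (Suc n)\<close>.\<close>

fun universal :: "nat \<Rightarrow> (nat \<Rightarrow> bool) \<Rightarrow> (nat \<Rightarrow> bool) \<Rightarrow> bool" where
  "universal 0 y x \<longleftrightarrow> (\<exists>\<^sub>\<infinity>l. y (to_nat (map x [0..<l])))"
| "universal (Suc n) y x \<longleftrightarrow> (\<exists>\<^sub>\<infinity>k. universal n (\<lambda>i. y (prod_encode (k, i))) x)"

lemma universal_complete: "S \<in> limsup_class (Suc n) \<Longrightarrow> \<exists>y. S = {x. universal n y x}"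
proof (induction n arbitrary: S)
  case 0
  then obtain T :: "nat \<Rightarrow> (nat \<Rightarrow> bool) set" where T: "\<And>k. clopen (T k)" "S = {x. \<exists>\<^sub>\<infinity>k. x \<in> T k}" by (elim limsup_classE) auto
  define cyl where "cyl s = {z :: nat \<Rightarrow> bool. map z [0..<length s] = s}" for s
  \<comment> \<open>\<open>s\<close> is the shortest prefix of length at least \<open>k\<close> that forces membership in \<open>T k\<close>; each \<open>k\<close>
    with \<open>x \<in> T k\<close> contributes exactly one prefix of \<open>x\<close>, and each prefix serves finitely many \<open>k\<close>.\<close>
  define first where "first k s \<longleftrightarrow> k \<le> length s \<and> cyl s \<subseteq> T k \<and>
      (\<forall>l<length s. k \<le> l \<longrightarrow> \<not> cyl (take l s) \<subseteq> T k)" for k s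
  define y where "y m \<longleftrightarrow> (\<exists>s k. m = to_nat s \<and> first k s)" for m
  have "x \<in> S \<longleftrightarrow> universal 0 y x" for x
  proof -
    let ?r = "\<lambda>l. map x [0..<l]"
    have first: "first k (?r l) \<longleftrightarrow> k \<le> l \<and> cyl (?r l) \<subseteq> T k \<and> (\<forall>l'<l. k \<le> l' \<longrightarrow> \<not> cyl (?r l') \<subseteq> T k)" for k l
      by (auto simp: first_def take_map)
    have in_cyl: "x \<in> cyl (?r l)" for l by (simp add: cyl_def)
    have ex: "\<exists>l. first k (?r l)" if xk: "x \<in> T k" for k
    proof -
      obtain l where l: "\<And>z. \<forall>i<l. z i = x i \<Longrightarrow> z \<in> T k"
        using open_contains_cylinder[OF _ xk] T(1) unfolding clopen_def by blast
      have "cyl (?r (max k l)) \<subseteq> T k"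
        using l by (auto simp: cyl_def)
      then have "\<exists>l. k \<le> l \<and> cyl (?r l) \<subseteq> T k" by (intro exI[of _ "max k l"]) simp
      then obtain l where "k \<le> l \<and> cyl (?r l) \<subseteq> T k" "\<And>l'. l' < l \<Longrightarrow> \<not> (k \<le> l' \<and> cyl (?r l') \<subseteq> T k)"
        using exists_least_iff[of "\<lambda>l. k \<le> l \<and> cyl (?r l) \<subseteq> T k"] by blast
      then have "first k (?r l)" unfolding first by simp
      then show ?thesis ..
    qed
    have mem: "x \<in> T k" if "first k (?r l)" for k l
      using that in_cyl[of l] unfolding first by auto
    have uniq: "l = l'" if "first k (?r l)" "first k (?r l')" for k l l'
      using that unfolding first by (metis linorder_neqE_nat)
    have y: "y (to_nat (?r l)) \<longleftrightarrow> (\<exists>k. first k (?r l))" for l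
      by (auto simp: y_def)
    have "infinite {k. x \<in> T k} \<longleftrightarrow> infinite {l. \<exists>k. first k (?r l)}"
    proof
      assume inf: "infinite {k. x \<in> T k}"
      show "infinite {l. \<exists>k. first k (?r l)}"
        unfolding infinite_nat_iff_unbounded_le
      proof
        fix m
        obtain k where "k \<ge> m" "x \<in> T k" using inf unfolding infinite_nat_iff_unbounded_le by blast
        moreover from this obtain l where "first k (?r l)" using ex by metis
        ultimately have "first k (?r l)" "l \<ge> m" unfolding first by simp_all
        then show "\<exists>l\<ge>m. l \<in> {l. \<exists>k. first k (?r l)}" by blast
      qed
    next
      assume inf: "infinite {l. \<exists>k. first k (?r l)}"
      have "{l. \<exists>k. first k (?r l)} \<subseteq> (\<lambda>k. THE l. first k (?r l)) ` {k. x \<in> T k}"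
      proof clarify
        fix l k assume "first k (?r l)"
        then have "(THE l. first k (?r l)) = l" "x \<in> T k" using uniq mem by blast+
        then show "l \<in> (\<lambda>k. THE l. first k (?r l)) ` {k. x \<in> T k}" by (metis image_eqI mem_Collect_eq)
      qed
      then show "infinite {k. x \<in> T k}" using inf finite_surj by blast
    qed
    then show ?thesis by (simp add: T(2) y INFM_iff_infinite)
  qed
  then show ?case by blast
next
  case (Suc n)
  from Suc.prems obtain T :: "nat \<Rightarrow> (nat \<Rightarrow> bool) set" where T: "\<And>k. T k \<in> limsup_class (Suc n)" "S = {x. \<exists>\<^sub>\<infinity>k. x \<in> T k}"
    by (elim limsup_classE) blast
  obtain y where y: "\<And>k. T k = {x. universal n (y k) x}" using Suc.IH[OF T(1)] by metis
  have "S = {x. universal (Suc n) (\<lambda>m. case prod_decode m of (k, i) \<Rightarrow> y k i) x}"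
    by (simp add: T(2) y)
  then show ?case by blast
qed

text \<open>The code may depend continuously on \<open>x\<close>: the diagonal takes
  \<open>x\<close> itself as code, and the induction takes sections of the code.\<close>

lemma universal_in_class:
  "(\<And>i. clopen {x. g x i}) \<Longrightarrow> {x. universal n (g x) x} \<in> limsup_class (Suc n)"
proof (induction n arbitrary: g)
  case 0
  have "clopen {x. g x (to_nat (map x [0..<l]))}" for l
  proof -
    \<comment> \<open>The coordinate of \<open>g x\<close> that is read depends on the first
      \<open>l\<close> bits of \<open>x\<close>; there are finitely many cases.\<close>
    have eq: "{x. g x (to_nat (map x [0..<l]))} =
        (\<Union>s\<in>{s. length s = l}. (\<Inter>i<l. if s ! i then {x. x i} else - {x. x i}) \<inter> {x. g x (to_nat s)})"
      (is "_ = ?R")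
    proof (intro set_eqI iffI)
      fix x assume "x \<in> {x. g x (to_nat (map x [0..<l]))}"
      then show "x \<in> ?R" by (intro UN_I[of "map x [0..<l]"]) (auto split: if_splits)
    next
      fix x assume "x \<in> ?R"
      then obtain s where s: "length s = l" "g x (to_nat s)"
        and bits: "x \<in> (\<Inter>i<l. if s ! i then {x. x i} else - {x. x i})" by blast
      have "x i = s ! i" if "i < l" for i
      proof -
        have "x \<in> (if s ! i then {x. x i} else - {x. x i})" using bits that by blast
        then show ?thesis by (simp split: if_splits)
      qed
      then have "map x [0..<l] = s" using s by (intro nth_equalityI) auto
      then show "x \<in> {x. g x (to_nat (map x [0..<l]))}" using s by simp
    qed
    have fin: "finite {s :: bool list. length s = l}"
      using finite_lists_length_eq[of "UNIV :: bool set" l] by simp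
    have c: "clopen (if b then {x. x i} else - {x. x i})" for b i
      by (simp add: clopen_coordinate clopen_Compl)
    show ?thesis
      unfolding eq by (intro clopen_UN clopen_Int clopen_INT c 0 fin finite_lessThan)
  qed
  then show ?case unfolding universal.simps by (intro limsup_class_INFM) simp
next
  case (Suc n)
  have "{x. universal n (\<lambda>i. g x (prod_encode (k, i))) x} \<in> limsup_class (Suc n)" for k
    by (rule Suc.IH) (rule Suc.prems)
  then show ?case unfolding universal.simps by (rule limsup_class_INFM)
qed

text \<open>Cantor's diagonal: the set of \<open>x\<close> outside the universal set when used as
  their own code lies in the next class, and a code \<open>y\<close> for it in class
  \<open>n\<close> is refuted at \<open>x = y\<close>.\<close>

lemma limsup_class_strict:
  assumes "n < m" "1 \<le> n" shows "\<not> limsup_class m \<subseteq> limsup_class n"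
proof
  assume sub: "limsup_class m \<subseteq> limsup_class n"
  obtain n' where n: "n = Suc n'" using assms by (cases n) auto
  have "- {x. universal n' x x} \<in> limsup_class (Suc n)"
    unfolding n by (intro limsup_class_Compl universal_in_class clopen_coordinate)
  then have "- {x. universal n' x x} \<in> limsup_class n"
    using sub limsup_class_mono[of "Suc n" m] assms by (auto simp del: limsup_class.simps)
  then obtain y where "- {x. universal n' x x} = {x. universal n' y x}"
    using universal_complete n by blast
  then show False by blast
qed

section \<open>Non-smallness is complete for its class\<close>

lemma not_small_in_class:
  "(\<And>xs. clopen {x. xs \<in> g x}) \<Longrightarrow> {x. \<not> small n (g x)} \<in> limsup_class n"
proof (induction n arbitrary: g)
  case (Suc n)
  have "{x. \<not> small n (slice k (g x))} \<in> limsup_class n" for k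
    by (rule Suc.IH) (simp add: Suc.prems)
  then show ?case by (auto intro!: exI[of _ "\<lambda>k. {x. \<not> small n (slice k (g x))}"])
qed simp

text \<open>The \<open>j\<close>-th non-small column of \<open>D\<close> carries a reduction of
  \<open>T j\<close>, so infinitely many columns of \<open>f x\<close> are non-small exactly if
  \<open>x\<close> lies in infinitely many \<open>T j\<close>. The clopen condition is continuity of
  \<open>f\<close>, coordinate by coordinate.\<close>

lemma class_reducible_to_not_small:
  "S \<in> limsup_class n \<Longrightarrow> \<not> small n D \<Longrightarrow>
     \<exists>f. (\<forall>xs. clopen {x. xs \<in> f x}) \<and> (\<forall>x. f x \<subseteq> D) \<and> (\<forall>x. small n (f x) \<longleftrightarrow> x \<notin> S)"
proof (induction n arbitrary: S D)
  case 0
  have "{x. xs \<in> (if x \<in> S then {[]} else {})} = (if xs = [] then S else {})" for xs :: "nat list" by auto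
  then show ?case using 0 by (intro exI[of _ "\<lambda>x. if x \<in> S then {[]} else {}"]) auto
next
  case (Suc n)
  from Suc.prems(1) obtain T :: "nat \<Rightarrow> (nat \<Rightarrow> bool) set" where T: "\<And>k. T k \<in> limsup_class n" "S = {x. \<exists>\<^sub>\<infinity>k. x \<in> T k}"
    by (elim limsup_classE) blast
  let ?K = "{k. \<not> small n (slice k D)}"
  have inf: "infinite ?K" using Suc.prems by (simp add: eventually_cofinite)
  define e where "e = enumerate ?K"
  have e: "\<not> small n (slice (e j) D)" for j
    using enumerate_in_set[OF inf, of j] by (simp add: e_def)
  have inj: "inj e"
    unfolding e_def using strict_mono_enumerate[OF inf] by (rule strict_mono_imp_inj_on)
  have "\<forall>j. \<exists>f. (\<forall>xs. clopen {x. xs \<in> f x}) \<and> (\<forall>x. f x \<subseteq> slice (e j) D) \<and> (\<forall>x. small n (f x) \<longleftrightarrow> x \<notin> T j)"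
    by (intro allI Suc.IH T(1) e)
  from choice[OF this] obtain f where "\<forall>j. (\<forall>xs. clopen {x. xs \<in> f j x}) \<and> (\<forall>x. f j x \<subseteq> slice (e j) D) \<and>
      (\<forall>x. small n (f j x) \<longleftrightarrow> x \<notin> T j)" ..
  then have f: "clopen {x. xs \<in> f j x}" "f j x \<subseteq> slice (e j) D" "small n (f j x) \<longleftrightarrow> x \<notin> T j" for j xs x
    by auto
  define F where "F x = {e j # ys | j ys. ys \<in> f j x}" for x
  have slice: "slice k (F x) = (if k \<in> range e then f (inv e k) x else {})" for k x
    using inj by (auto simp: F_def inj_eq)
  show ?case
  proof (intro exI[of _ F] conjI allI)
    fix xs
    show "clopen {x. xs \<in> F x}"
    proof (cases xs)
      case (Cons k ys)
      have "{x. xs \<in> F x} = {x. ys \<in> slice k (F x)}" by (simp add: Cons)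
      then show ?thesis using f(1) by (cases "k \<in> range e") (simp_all add: slice)
    qed (simp add: F_def)
  next
    have "e j # ys \<in> D" if "ys \<in> f j x" for j ys x using f(2)[of j x] that by auto
    then show "F x \<subseteq> D" for x by (auto simp: F_def)
  next
    fix x
    have "{k. \<not> small n (slice k (F x))} = e ` {j. x \<in> T j}"
      using inj by (auto simp: slice f(3) inj_eq)
    then show "small (Suc n) (F x) \<longleftrightarrow> x \<notin> S"
      using inj by (simp add: T(2) eventually_cofinite INFM_iff_infinite finite_image_iff inj_on_subset)
  qed
qed

section \<open>The ideals are analytic\<close>

text \<open>A Skolem function for \<open>small\<close>: \<open>w 0\<close> is the threshold and the
  remaining values code a witness for every slice. Smallness becomes the projection of a closed set,
  the form in which \<open>analytic_family\<close> is stated.\<close>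

fun smallness_witness :: "nat \<Rightarrow> nat list set \<Rightarrow> (nat \<Rightarrow> nat) \<Rightarrow> bool" where
  "smallness_witness 0 P w \<longleftrightarrow> [] \<notin> P"
| "smallness_witness (Suc n) P w \<longleftrightarrow>
     (\<forall>j\<ge>w 0. smallness_witness n (slice j P) (\<lambda>i. w (Suc (prod_encode (j, i)))))"

lemma small_iff_witness: "small n P \<longleftrightarrow> (\<exists>w. smallness_witness n P w)"
proof (induction n arbitrary: P)
  case (Suc n)
  show ?case
  proof
    assume "small (Suc n) P"
    then obtain K where "\<And>j. j \<ge> K \<Longrightarrow> \<exists>w. smallness_witness n (slice j P) w"
      using Suc.IH by (auto simp: MOST_nat_le)
    then obtain v where v: "\<And>j. j \<ge> K \<Longrightarrow> smallness_witness n (slice j P) (v j)" by metis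
    define w where "w m = (case m of 0 \<Rightarrow> K | Suc m \<Rightarrow> (case prod_decode m of (j, i) \<Rightarrow> v j i))" for m
    have "smallness_witness (Suc n) P w" using v by (simp add: w_def)
    then show "\<exists>w. smallness_witness (Suc n) P w" by (intro exI[of _ w])
  next
    assume "\<exists>w. smallness_witness (Suc n) P w"
    then obtain w where w: "\<forall>j\<ge>w 0. smallness_witness n (slice j P) (\<lambda>i. w (Suc (prod_encode (j, i))))"
      by auto
    have "small n (slice j P)" if "j \<ge> w 0" for j
      unfolding Suc.IH using w that by (intro exI[of _ "\<lambda>i. w (Suc (prod_encode (j, i)))"]) simp
    then show "small (Suc n) P" unfolding small.simps MOST_nat_le by blast
  qed
qed (metis small.simps(1) smallness_witness.simps(1))

text \<open>The reindexings \<open>e\<close> and \<open>d\<close> absorb the passage to slices and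
  to their witnesses. Each threshold comparison reads one coordinate, and the quantifier over
  \<open>j\<close> is an intersection of closed sets.\<close>

lemma closed_smallness_witness:
  "closed {(x :: nat \<Rightarrow> bool, w :: nat \<Rightarrow> nat). smallness_witness n {xs. x (e xs)} (\<lambda>i. w (d i))}"
proof (induction n arbitrary: e d)
  case 0
  have "continuous_on UNIV (\<lambda>p :: (nat \<Rightarrow> bool) \<times> (nat \<Rightarrow> nat). fst p (e []))"
    by (rule continuous_on_product_then_coordinatewise[OF continuous_on_fst[OF continuous_on_id]])
  then have "closed ((\<lambda>p :: (nat \<Rightarrow> bool) \<times> (nat \<Rightarrow> nat). fst p (e [])) -` {False})"
    by (intro closed_vimage) (simp_all add: closed_def open_discrete)
  then show ?case by (simp add: vimage_def split_beta)
next
  case (Suc n)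
  have c: "continuous_on UNIV (\<lambda>p :: (nat \<Rightarrow> bool) \<times> (nat \<Rightarrow> nat). snd p (d 0))"
    by (rule continuous_on_product_then_coordinatewise[OF continuous_on_snd[OF continuous_on_id]])
  have "closed ((\<lambda>p :: (nat \<Rightarrow> bool) \<times> (nat \<Rightarrow> nat). snd p (d 0)) -` {k. j < k})" for j
    using c by (intro closed_vimage) (simp_all add: closed_def open_discrete)
  moreover have "{(x :: nat \<Rightarrow> bool, w :: nat \<Rightarrow> nat). smallness_witness (Suc n) {xs. x (e xs)} (\<lambda>i. w (d i))} =
     (\<Inter>j. (\<lambda>p. snd p (d 0)) -` {k. j < k} \<union>
        {(x, w). smallness_witness n {xs. x (e (j # xs))} (\<lambda>i. w (d (Suc (prod_encode (j, i)))))})"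
    by (auto simp: slice_def) (meson not_le)+
  ultimately show ?case using Suc.IH by (auto intro!: closed_INT closed_Un)
qed

section \<open>Rigidity under AT\<close>

text \<open>AT speaks of ideals on \<open>\<omega>\<close>, so the ideal is transported along
  \<open>to_nat\<close>; numbers that do not code a list of length \<open>n\<close> are
  ignored.\<close>

definition coded_ideal :: "nat \<Rightarrow> nat set set" where
  "coded_ideal n = {Y. small n {xs. to_nat xs \<in> Y}}"

lemma ideal_coded_ideal: "ideal_of_sets (coded_ideal n)"
proof -
  have *: "{xs :: nat list. to_nat xs \<in> X \<union> Y} = {xs. to_nat xs \<in> X} \<union> {xs. to_nat xs \<in> Y}" for X Y
    by auto
  have "small n {xs. to_nat xs \<in> Y}" if "small n {xs. to_nat xs \<in> X}" "Y \<subseteq> X" for X Y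
    using that(1) by (rule small_mono) (use that(2) in auto)
  then show ?thesis
    unfolding ideal_of_sets_def coded_ideal_def mem_Collect_eq * by simp
qed

lemma analytic_coded_ideal: "analytic_family (coded_ideal n)"
  unfolding analytic_family_def
proof (intro exI conjI)
  let ?C = "{(x :: nat \<Rightarrow> bool, w :: nat \<Rightarrow> nat). smallness_witness n {xs. x (to_nat xs)} (\<lambda>i. w i)}"
  show "closed ?C" by (rule closed_smallness_witness)
  show "char_fun ` coded_ideal n = fst ` ?C"
  proof (intro set_eqI iffI)
    fix x assume "x \<in> char_fun ` coded_ideal n"
    then obtain w where "smallness_witness n {xs. x (to_nat xs)} w"
      by (auto simp: coded_ideal_def char_fun_def small_iff_witness)
    then show "x \<in> fst ` ?C" by (intro image_eqI[of _ _ "(x, w)"]) auto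
  next
    fix x assume "x \<in> fst ` ?C"
    then have "{k. x k} \<in> coded_ideal n" by (auto simp: coded_ideal_def small_iff_witness)
    moreover have "x = char_fun {k. x k}" by (simp add: char_fun_def)
    ultimately show "x \<in> char_fun ` coded_ideal n" by blast
  qed
qed

lemma not_small_lists: "infinite A \<Longrightarrow> \<not> small n {xs. set xs \<subseteq> A}"
proof (induction n)
  case (Suc n)
  have "slice k {xs. set xs \<subseteq> A} = {xs. set xs \<subseteq> A}" if "k \<in> A" for k using that by auto
  then have "A \<subseteq> {k. \<not> small n (slice k {xs. set xs \<subseteq> A})}" using Suc by auto
  then show ?case using Suc.prems by (auto simp: eventually_cofinite dest: infinite_super)
qed simp

text \<open>The sets \<open>B r\<close> of prefixes of branches \<open>r\<close> of the binary tree
  are infinite and almost disjoint. The \<open>m\<close>-tuples over \<open>B r\<close> are still of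
  full order type, and two of these sets share only tuples over the finite set
  \<open>B r \<inter> B s\<close>.\<close>

lemma almost_disjoint_not_small:
  assumes "m \<ge> 1"
  shows "\<exists>\<A>. uncountable \<A> \<and> almost_disjoint_family \<A> \<and>
    (\<forall>A\<in>\<A>. \<exists>L \<subseteq> lists_of_length m. A = to_nat ` L \<and> \<not> small m L)"
proof -
  define B where "B r = range (\<lambda>l. to_nat (map r [0..<l]))" for r :: "nat \<Rightarrow> bool"
  have "inj (\<lambda>l. to_nat (map r [0..<l]))" for r :: "nat \<Rightarrow> bool"
    by (rule injI) (metis from_nat_to_nat length_map length_upt minus_nat.diff_0)
  then have infB: "infinite (B r)" for r unfolding B_def by (rule range_inj_infinite)
  have finB: "finite (B r \<inter> B s)" if "r \<noteq> s" for r s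
  proof -
    obtain d where d: "r d \<noteq> s d" using \<open>r \<noteq> s\<close> by blast
    have "B r \<inter> B s \<subseteq> (\<lambda>l. to_nat (map r [0..<l])) ` {..d}"
    proof
      fix b assume "b \<in> B r \<inter> B s"
      then obtain l l' where l: "b = to_nat (map r [0..<l])" "map r [0..<l] = map s [0..<l']"
        by (auto simp: B_def)
      then have "l = l'" by (metis length_map length_upt minus_nat.diff_0)
      then have "r i = s i" if "i < l" for i using l(2) that by auto
      then have "l \<le> d" using d by (meson not_le)
      then show "b \<in> (\<lambda>l. to_nat (map r [0..<l])) ` {..d}" using l by blast
    qed
    then show ?thesis by (rule finite_subset) simp
  qed
  define L where "L r = {xs \<in> lists_of_length m. set xs \<subseteq> B r}" for r
  define F where "F r = (to_nat :: nat list \<Rightarrow> nat) ` L r" for r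
  have ns: "\<not> small m (L r)" for r
  proof -
    have "small m (L r) \<longleftrightarrow> small m {xs. set xs \<subseteq> B r}"
      by (rule small_cong) (simp add: L_def lists_of_length_def)
    then show ?thesis using not_small_lists infB by blast
  qed
  have infF: "infinite (F r)" for r
    using ns[of r] small_finite[of "L r" "m - 1"] assms
    by (auto simp: F_def finite_image_iff inj_on_subset[OF inj_to_nat])
  have finF: "finite (F r \<inter> F s)" if "r \<noteq> s" for r s
  proof -
    have "F r \<inter> F s = to_nat ` (L r \<inter> L s)"
      unfolding F_def by (rule image_Int[symmetric]) simp
    moreover have "L r \<inter> L s \<subseteq> {xs. set xs \<subseteq> B r \<inter> B s \<and> length xs = m}"
      unfolding L_def lists_of_length_def by blast
    then have "finite (L r \<inter> L s)"
      using finite_lists_length_eq[OF finB[OF that]] by (rule finite_subset)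
    ultimately show ?thesis by simp
  qed
  have "inj F" using finF infF by (metis Int_absorb injI)
  moreover have "uncountable (UNIV :: (nat \<Rightarrow> bool) set)"
  proof
    assume "countable (UNIV :: (nat \<Rightarrow> bool) set)"
    then obtain f :: "nat \<Rightarrow> nat \<Rightarrow> bool" where "range f = UNIV"
      using uncountable_def by blast
    then obtain k where "f k = (\<lambda>i. \<not> f i i)" by (metis rangeE UNIV_I)
    then show False by metis
  qed
  ultimately have "uncountable (range F)" using countable_image_inj_on by blast
  moreover have "almost_disjoint_family (range F)"
    unfolding almost_disjoint_family_def
  proof (intro conjI ballI impI)
    fix A C assume "A \<in> range F" "C \<in> range F" "A \<noteq> C"
    then obtain r s where "A = F r" "C = F s" "r \<noteq> s" by auto
    then show "finite (A \<inter> C)" using finF by simp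
  qed (use infF in auto)
  moreover have "\<forall>A\<in>range F. \<exists>L \<subseteq> lists_of_length m. A = to_nat ` L \<and> \<not> small m L"
    using ns by (auto simp: F_def intro!: exI[of _ "L _"]) (auto simp: L_def)
  ultimately show ?thesis by blast
qed

text \<open>Needed because the complexity argument excludes isomorphisms only from the larger
  exponent to the smaller.\<close>

lemma ba_isomorphic_sym:
  assumes "carrier_boolean_algebra A" "ba_isomorphic A B" shows "ba_isomorphic B A"
proof -
  interpret carrier_boolean_algebra A by fact
  obtain f where bij: "bij_betw f (ba_carrier A) (ba_carrier B)"
    and meet: "\<And>x y. x \<in> ba_carrier A \<Longrightarrow> y \<in> ba_carrier A \<Longrightarrow> f (ba_meet A x y) = ba_meet B (f x) (f y)"
    and join: "\<And>x y. x \<in> ba_carrier A \<Longrightarrow> y \<in> ba_carrier A \<Longrightarrow> f (ba_join A x y) = ba_join B (f x) (f y)"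
    and compl: "\<And>x. x \<in> ba_carrier A \<Longrightarrow> f (ba_compl A x) = ba_compl B (f x)"
    and const: "f (ba_zero A) = ba_zero B" "f (ba_one A) = ba_one B"
    using assms(2) by (auto simp: ba_isomorphic_def ba_iso_def)
  define g where "g = inv_into (ba_carrier A) f"
  have gf: "g (f x) = x" if "x \<in> ba_carrier A" for x
    using bij that by (simp add: g_def bij_betw_inv_into_left)
  have ex: "\<exists>x\<in>ba_carrier A. y = f x" if "y \<in> ba_carrier B" for y
    using bij that by (auto simp: bij_betw_def)
  have "bij_betw g (ba_carrier B) (ba_carrier A)" unfolding g_def by (rule bij_betw_inv_into[OF bij])
  moreover have "g (ba_meet B x y) = ba_meet A (g x) (g y) \<and> g (ba_join B x y) = ba_join A (g x) (g y)"
    if "x \<in> ba_carrier B" "y \<in> ba_carrier B" for x y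
    using ex[OF that(1)] ex[OF that(2)]
    by (auto simp: gf meet_closed join_closed meet[symmetric] join[symmetric])
  moreover have "g (ba_compl B x) = ba_compl A (g x)" if "x \<in> ba_carrier B" for x
    using ex[OF that] by (auto simp: gf compl_closed compl[symmetric])
  moreover have "g (ba_zero B) = ba_zero A" "g (ba_one B) = ba_one A"
    by (simp_all add: const[symmetric] gf zero_closed one_closed)
  ultimately show ?thesis unfolding ba_isomorphic_def ba_iso_def by blast
qed

text \<open>A set \<open>S\<close> of class \<open>m\<close> is reduced in two steps: completeness
  turns \<open>x\<close> continuously into a subset of the piece found by AT, and the lifting turns
  this continuously into a subset of \<open>\<omega>^n\<close>. Smallness is tracked throughout
  because the isomorphism sends only zero to zero.\<close>

lemma AT_not_isomorphic_less:
  assumes AT "n \<ge> 1" "n < m"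
  shows "\<not> ba_isomorphic (omega_algebra m) (omega_algebra n)"
proof
  assume "ba_isomorphic (omega_algebra m) (omega_algebra n)"
  have m: "m \<ge> 1" using assms by simp
  interpret M: powerset_ideal "lists_of_length m" "omega_ideal m" by (rule powerset_ideal_omega[OF m])
  interpret N: powerset_ideal "lists_of_length n" "omega_ideal n" by (rule powerset_ideal_omega[OF assms(2)])
  obtain f where "ba_iso f M.B N.B"
    using \<open>ba_isomorphic _ _\<close> unfolding omega_algebra_eq ba_isomorphic_def ..
  then have bij: "bij_betw f (ba_carrier M.B) (ba_carrier N.B)"
    and meet: "\<And>x y. x \<in> ba_carrier M.B \<Longrightarrow> y \<in> ba_carrier M.B \<Longrightarrow> f (ba_meet M.B x y) = ba_meet N.B (f x) (f y)"
    and zero: "f (ba_zero M.B) = ba_zero N.B"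
    by (simp_all add: ba_iso_def)
  define dec where "dec X = {xs \<in> lists_of_length m. to_nat xs \<in> X}" for X
  have decS [simp]: "dec X \<subseteq> lists_of_length m" for X by (auto simp: dec_def)
  \<comment> \<open>The representative of the image class is chosen arbitrarily, so \<open>H\<close>
    respects finite changes and intersections only modulo \<open>coded_ideal n\<close>, which is
    what AT asks for.\<close>
  have "\<exists>Y\<subseteq>lists_of_length n. N.cls Y = f (M.cls (dec X))" for X
  proof -
    have "f (M.cls (dec X)) \<in> ba_carrier N.B"
      by (rule bij_betwE[OF bij, rule_format]) simp
    then show ?thesis by (elim N.carrier_cases) auto
  qed
  then obtain \<phi> where \<phi>S: "\<And>X. \<phi> X \<subseteq> lists_of_length n" and \<phi>: "\<And>X. N.cls (\<phi> X) = f (M.cls (dec X))"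
    by metis
  define H where "H X = (to_nat :: nat list \<Rightarrow> nat) ` \<phi> X" for X
  have H: "to_nat xs \<in> H X \<longleftrightarrow> xs \<in> \<phi> X" for xs X
    by (simp add: H_def inj_image_mem_iff)
  \<comment> \<open>\<open>f\<close> is injective and preserves zero, so \<open>H\<close> reduces
    one ideal to the other, though without any continuity yet.\<close>
  have \<phi>_small: "small n (\<phi> X) \<longleftrightarrow> small m (dec X)" for X
  proof -
    have "\<phi> X \<in> omega_ideal n \<longleftrightarrow> f (M.cls (dec X)) = f (ba_zero M.B)"
      using N.cls_eq_zero_iff[OF \<phi>S] \<phi> zero by simp
    also have "\<dots> \<longleftrightarrow> M.cls (dec X) = ba_zero M.B"
      using bij by (subst inj_on_eq_iff[of f "ba_carrier M.B"]) (auto simp: bij_betw_def M.zero_eq)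
    also have "\<dots> \<longleftrightarrow> dec X \<in> omega_ideal m" by (rule M.cls_eq_zero_iff) simp
    finally show ?thesis using \<phi>S m assms(2) by (simp add: mem_omega_ideal_iff)
  qed
  have H_pres: "preserves_intersections_mod (coded_ideal n) H"
    unfolding preserves_intersections_mod_def
  proof (intro conjI allI impI)
    fix X Y :: "nat set" assume fin: "finite (sym_diff X Y)"
    have "finite (sym_diff (dec X) (dec Y))"
    proof (rule finite_subset)
      show "sym_diff (dec X) (dec Y) \<subseteq> to_nat -` sym_diff X Y" by (auto simp: dec_def)
      show "finite (to_nat -` sym_diff X Y :: nat list set)" using fin by (rule finite_vimageI) simp
    qed
    then have "small m (sym_diff (dec X) (dec Y))" using small_finite[of _ "m - 1"] m by simp
    moreover have "sym_diff (dec X) (dec Y) \<subseteq> lists_of_length m" by (auto simp: dec_def)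
    ultimately have "sym_diff (dec X) (dec Y) \<in> omega_ideal m" using m by (simp add: mem_omega_ideal_iff)
    then have "N.cls (\<phi> X) = N.cls (\<phi> Y)" unfolding \<phi> by (intro arg_cong[of _ _ f] M.cls_cong) simp_all
    then have "sym_diff (\<phi> X) (\<phi> Y) \<in> omega_ideal n" using \<phi>S by (simp add: N.cls_eq_iff)
    moreover have "{xs. to_nat xs \<in> sym_diff (H X) (H Y)} = sym_diff (\<phi> X) (\<phi> Y)" using H by auto
    ultimately show "sym_diff (H X) (H Y) \<in> coded_ideal n"
      using assms by (simp add: coded_ideal_def mem_omega_ideal_iff)
  next
    fix X Y :: "nat set"
    have "dec (X \<inter> Y) = dec X \<inter> dec Y" by (auto simp: dec_def)
    then have "N.cls (\<phi> (X \<inter> Y)) = f (M.cls (dec X \<inter> dec Y))" by (simp add: \<phi>)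
    also have "\<dots> = ba_meet N.B (f (M.cls (dec X))) (f (M.cls (dec Y)))"
      using meet[of "M.cls (dec X)" "M.cls (dec Y)"] by simp
    also have "\<dots> = N.cls (\<phi> X \<inter> \<phi> Y)" using \<phi>S by (simp add: \<phi>[symmetric])
    finally have "N.cls (\<phi> (X \<inter> Y)) = N.cls (\<phi> X \<inter> \<phi> Y)" .
    moreover have "\<phi> X \<inter> \<phi> Y \<subseteq> lists_of_length n" using \<phi>S by blast
    ultimately have "sym_diff (\<phi> (X \<inter> Y)) (\<phi> X \<inter> \<phi> Y) \<in> omega_ideal n" using \<phi>S by (simp add: N.cls_eq_iff)
    moreover have "{xs. to_nat xs \<in> sym_diff (H (X \<inter> Y)) (H X \<inter> H Y)} = sym_diff (\<phi> (X \<inter> Y)) (\<phi> X \<inter> \<phi> Y)"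
      using H by auto
    ultimately show "sym_diff (H (X \<inter> Y)) (H X \<inter> H Y) \<in> coded_ideal n"
      using assms by (simp add: coded_ideal_def mem_omega_ideal_iff)
  qed
  obtain \<A> where \<A>: "uncountable \<A>" "almost_disjoint_family \<A>"
    "\<forall>A\<in>\<A>. \<exists>L \<subseteq> lists_of_length m. A = to_nat ` L \<and> \<not> small m L"
    using almost_disjoint_not_small[OF m] by auto
  obtain A where A: "A \<in> \<A>" and ADF: "\<exists>(k :: nat) D F. A = (\<Union>i<k. D i) \<and>
      (\<forall>i<k. continuous_on_Pow (D i) (F i) \<and> (\<forall>X. X \<subseteq> D i \<longrightarrow> sym_diff (F i X) (H X) \<in> coded_ideal n))"
    using assms(1)[unfolded AT_def, rule_format, of "coded_ideal n" H \<A>]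
      ideal_coded_ideal[of n] analytic_coded_ideal[of n] H_pres \<A> by blast
  from ADF obtain k :: nat and D F where kDF: "A = (\<Union>i<k. D i) \<and>
      (\<forall>i<k. continuous_on_Pow (D i) (F i) \<and> (\<forall>X. X \<subseteq> D i \<longrightarrow> sym_diff (F i X) (H X) \<in> coded_ideal n))"
    by (elim exE)
  then have AD: "A = (\<Union>i<k. D i)"
    and DF: "\<And>i. i < k \<Longrightarrow> continuous_on_Pow (D i) (F i)"
      "\<And>i X. i < k \<Longrightarrow> X \<subseteq> D i \<Longrightarrow> sym_diff (F i X) (H X) \<in> coded_ideal n"
    by simp_all
  obtain L where L: "L \<subseteq> lists_of_length m" "A = to_nat ` L" "\<not> small m L" using bspec[OF \<A>(3) A] by blast
  have "dec A = L" using L by (auto simp: dec_def)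
  moreover have "dec A = (\<Union>i\<in>{..<k}. dec (D i))" using AD by (auto simp: dec_def)
  \<comment> \<open>A non-small set is not a finite union of small ones, so some piece keeps the
    full order type.\<close>
  ultimately obtain i where i: "i < k" "\<not> small m (dec (D i))"
    using L(3) small_UN_finite[OF finite_lessThan, of m "\<lambda>i. dec (D i)" k] by auto
  have "limsup_class m \<subseteq> limsup_class n"
  proof
    fix S assume "S \<in> limsup_class m"
    from class_reducible_to_not_small[OF this i(2)] obtain h where
      h: "\<And>xs. clopen {x. xs \<in> h x}" "\<And>x. h x \<subseteq> dec (D i)" "\<And>x. small m (h x) \<longleftrightarrow> x \<notin> S" by blast
    define X where "X x = (to_nat :: nat list \<Rightarrow> nat) ` h x" for x
    have XD: "X x \<subseteq> D i" for x using h(2)[of x] by (auto simp: X_def dec_def)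
    have decX: "dec (X x) = h x" for x
      using h(2)[of x] by (auto simp: X_def dec_def)
    define g where "g x = {xs :: nat list. to_nat xs \<in> F i (X x)}" for x
    \<comment> \<open>Smallness is unaffected by small changes, so the continuous \<open>F i\<close>
      may replace \<open>H\<close>.\<close>
    have "small n (g x) \<longleftrightarrow> small n (\<phi> (X x))" for x
    proof -
      have "small n {xs. to_nat xs \<in> sym_diff (F i (X x)) (H (X x))}"
        using DF(2)[OF i(1) XD[of x]] by (simp add: coded_ideal_def)
      also have "{xs. to_nat xs \<in> sym_diff (F i (X x)) (H (X x))} = (g x - \<phi> (X x)) \<union> (\<phi> (X x) - g x)"
        using H by (auto simp: g_def)
      finally have *: "small n (g x - \<phi> (X x))" "small n (\<phi> (X x) - g x)" by simp_all
      have "small n Q" if "small n P" "small n (Q - P)" for P Q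
      proof -
        have "small n (P \<union> (Q - P))" unfolding small_Un using that by blast
        then show ?thesis by (rule small_mono) blast
      qed
      then show ?thesis using * by blast
    qed
    then have S: "S = {x. \<not> small n (g x)}" using \<phi>_small decX h(3) by auto
    have cX: "continuous_on UNIV (\<lambda>x. char_fun (X x))"
    proof (rule continuous_on_coordinatewise_then_product)
      fix j
      have "{x. j \<in> X x} = (if j \<in> range (to_nat :: nat list \<Rightarrow> nat) then {x. from_nat j \<in> h x} else {})"
        by (auto simp: X_def inj_image_mem_iff)
      then have "clopen {x. j \<in> X x}" using h(1) by simp
      then show "continuous_on UNIV (\<lambda>x. char_fun (X x) j)"
        by (simp add: char_fun_def clopen_iff_continuous)
    qed
    have "continuous_on UNIV (\<lambda>x. char_fun (F i {k. char_fun (X x) k}))"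
      by (rule continuous_on_compose2[OF DF(1)[OF i(1), unfolded continuous_on_Pow_def] cX]) (use XD in auto)
    then have "continuous_on UNIV (\<lambda>x. char_fun (F i (X x)))" by (simp add: char_fun_def)
    then have "continuous_on UNIV (\<lambda>x. char_fun (F i (X x)) (to_nat xs))" for xs :: "nat list"
      by (rule continuous_on_product_then_coordinatewise)
    then have "clopen {x. xs \<in> g x}" for xs
      unfolding g_def by (simp add: char_fun_def clopen_iff_continuous)
    then show "S \<in> limsup_class n" unfolding S by (rule not_small_in_class)
  qed
  then show False using limsup_class_strict assms by blast
qed

lemma AT_imp_not_isomorphic:
  assumes AT "m \<ge> 1" "n \<ge> 1" "m \<noteq> n"
  shows "\<not> ba_isomorphic (omega_algebra m) (omega_algebra n)"
proof (cases "n < m")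
  case True
  then show ?thesis using AT_not_isomorphic_less assms by blast
next
  case False
  then show ?thesis
    using AT_not_isomorphic_less[of m n] ba_isomorphic_sym[OF boolean_algebra_omega_algebra[OF assms(2)]] assms
    by auto
qed

theorem theorem6p12:
  shows "infinite (omega_algebra ` {1..}) \<and>
    (\<forall>n\<ge>1. carrier_boolean_algebra (omega_algebra n) \<and> ba_atomless (omega_algebra n) \<and>
       omega_tree_automatic (ba_structure (omega_algebra n))) \<and>
    (CH \<longrightarrow> (\<forall>m\<ge>1. \<forall>n\<ge>1. ba_isomorphic (omega_algebra m) (omega_algebra n))) \<and>
    (AT \<longrightarrow> (\<forall>m\<ge>1. \<forall>n\<ge>1. m \<noteq> n \<longrightarrow> \<not> ba_isomorphic (omega_algebra m) (omega_algebra n)))"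
  using infinite_omega_algebras boolean_algebra_omega_algebra atomless_omega_algebra
    omega_tree_automatic_omega_algebra CH_imp_isomorphic AT_imp_not_isomorphic
  by blast

end
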